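(* Let $\mathfrak g$ be a real nilpotent Lie algebra of dimension $8$ whose center has dimension $1$. Then $\mathfrak g$ has a complex structure if and only if it is isomorphic to one (and only one) of the Lie algebras in the following list: 1. $\mathfrak g_{1}^{\gamma} = (0^5,\, 13+15+24,\, 14-23+25,\, 16+27+\gamma\cdot 34)$, where $\gamma\in\{0,1\}$; 2. $\mathfrak g_2^{\alpha} = (0^4,\, 12,\, 13+15+24,\, 14-23+25,\, 16+27+\alpha\cdot 34)$, where $\alpha\in\mathbb R$; 3. $\mathfrak g_3^{\gamma} = (0^4,\,12,\, 13+\gamma\cdot 15+25,\, 15+24+\gamma\cdot 25,\, 16+27)$, where $\gamma\in\{0,1\}$; 4. $\mathfrak g_4^{\alpha,\beta} = (0^4,\,12,\, 15+(\alpha+1)\cdot 24,\, (\alpha-1)\cdot 14-23+(\beta-1)\cdot 25,\, 16+27+34-2\cdot 45)$, where $(\alpha, \beta)\in\mathbb R^*\times \mathbb R^{+}$ or $(\alpha,\beta)\in\mathbb R^{+}\times \{0\}$; 5. $\mathfrak g_5 = (0^4,\,2\cdot 12,\,14-23,\,13+24,\,16+27+35)$; 6. $\mathfrak g_6 = (0^4,\,2\cdot 12,\,14+15-23,\,13+24+25,\,16+27+35)$; 7. $\mathfrak g_7 = (0^5,\,15,\,25,\,16+27+34)$; 8. $\mathfrak g_8 = (0^4,\,12,\,15,\,25,\,16+27+34)$; 9. $\mathfrak g_9^{\gamma} = (0^3,\, 13,\, 23,\, 35,\, \gamma\cdot 12-34,\, 16+27+45)$, where $\gamma\in\{0,1\}$;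 10. $\mathfrak g_{10}^{\gamma} = (0^3,\, 13,\, 23,\, 14+25,\, 15+24,\, 16+ \gamma\cdot 25 +27)$, where $\gamma\in\{0,1\}$; 11. $\mathfrak g_{11}^{\alpha, \beta} = (0^3,\, 13,\, 23,\, 14+25-35,\, \alpha \cdot 12+15+24+34,\, 16+27-45-\beta(2\cdot 25 + 35))$, where $(\alpha, \beta)=(0,0)$, $(1,0)$, $(0,1)$, or $(\alpha, 1)$ with $\alpha\in\mathbb R^{+}$; 12. $\mathfrak g_{12}^{\gamma} = (0^2,\, 12,\, 13,\, 23,\, 14+25,\, 15+24,\, 16+27+ \gamma\cdot 25)$, where $\gamma\in\{0,1\}$.
   Context: $\mathbb R^*$ denotes the nonzero reals and $\mathbb R^+$ the positive reals. A complex structure on a real Lie algebra $\mathfrak g$ is a linear endomorphism $J:\mathfrak g\to\mathfrak g$ with $J^2=-\mathrm{Id}$ and $[X,Y]+J[JX,Y]+J[X,JY]-[JX,JY]=0$ for all $X,Y\in\mathfrak g$. Notation for Lie algebras: an 8-tuple lists the Chevalley–Eilenberg differentials $(de^1,\dots,de^8)$ of a basis $\{e^j\}_{j=1}^8$ of the dual space $\mathfrak g^*$, where $de(X,Y)=-e([X,Y])$ for $e\in\mathfrak g^*$, $X,Y\in\mathfrak g$. The symbol $ij$ stands for $e^i\wedge e^j$, $c\cdot ij$ for $c\,e^i\wedge e^j$, and $0^k$ stands for $k$ consecutive entries equal to $0$. For instance, $\mathfrak g_1^\gamma=(0^5,\,13+15+24,\,14-23+25,\,16+27+\gamma\cdot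 34)$ means $de^1=\cdots=de^5=0$, $de^6=e^1\wedge e^3+e^1\wedge e^5+e^2\wedge e^4$, $de^7=e^1\wedge e^4-e^2\wedge e^3+e^2\wedge e^5$, $de^8=e^1\wedge e^6+e^2\wedge e^7+\gamma\, e^3\wedge e^4$. "One and only one" means that the listed Lie algebras, for all listed values of the parameters, are pairwise non-isomorphic. *)

theory Defs
  imports "HOL-Analysis.Analysis"
begin

text \<open>A finite-dimensional real Lie algebra is given by a bracket on a type of class
  \<^class>\<open>real_vector\<close>; its underlying space is the whole type.\<close>

definition lie_algebra :: "('a::real_vector \<Rightarrow> 'a \<Rightarrow> 'a) \<Rightarrow> bool" where
  "lie_algebra br \<longleftrightarrow>
     bilinear br \<and> (\<forall>X. br X X = 0) \<and>
     (\<forall>X Y Z. br X (br Y Z) + br Y (br Z X) + br Z (br X Y) = 0)"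

fun lower_central_series :: "('a::real_vector \<Rightarrow> 'a \<Rightarrow> 'a) \<Rightarrow> nat \<Rightarrow> 'a set" where
  "lower_central_series br 0 = UNIV"
| "lower_central_series br (Suc k) = span {br X Y | X Y. Y \<in> lower_central_series br k}"

definition lie_nilpotent :: "('a::real_vector \<Rightarrow> 'a \<Rightarrow> 'a) \<Rightarrow> bool" where
  "lie_nilpotent br \<longleftrightarrow> (\<exists>k. lower_central_series br k = {0})"

definition lie_center :: "('a::real_vector \<Rightarrow> 'a \<Rightarrow> 'a) \<Rightarrow> 'a set" where
  "lie_center br = {X. \<forall>Y. br X Y = 0}"

definition complex_structure :: "('a::real_vector \<Rightarrow> 'a \<Rightarrow> 'a) \<Rightarrow> ('a \<Rightarrow> 'a) \<Rightarrow> bool" where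
  "complex_structure br J \<longleftrightarrow>
     linear J \<and> (\<forall>X. J (J X) = - X) \<and>
     (\<forall>X Y. br X Y + J (br (J X) Y) + J (br X (J Y)) - br (J X) (J Y) = 0)"

definition lie_isomorphic ::
  "('a::real_vector \<Rightarrow> 'a \<Rightarrow> 'a) \<Rightarrow> ('b::real_vector \<Rightarrow> 'b \<Rightarrow> 'b) \<Rightarrow> bool" where
  "lie_isomorphic br br' \<longleftrightarrow>
     (\<exists>f. linear f \<and> bij f \<and> (\<forall>X Y. f (br X Y) = br' (f X) (f Y)))"

text \<open>The bracket on \<open>\<real>\<^sup>8\<close> whose Chevalley--Eilenberg differentials, in the basis
  \<open>e\<^sup>1, \<dots>, e\<^sup>8\<close> dual to the standard one, are the entries of a list of eight 2-forms.
  A 2-form is given as an expression in its values \<open>e i j = (e\<^sup>i \<and> e\<^sup>j)(X, Y)\<close>,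
  and the sign is that of \<open>de(X, Y) = - e([X, Y])\<close>.
  Indices are elements of the numeral type \<open>8\<close>, where the index 8 is the residue class 0.\<close>

definition ce_bracket :: "((8 \<Rightarrow> 8 \<Rightarrow> real) \<Rightarrow> real list) \<Rightarrow> real^8 \<Rightarrow> real^8 \<Rightarrow> real^8" where
  "ce_bracket d X Y = - vector (d (\<lambda>i j. X $ i * Y $ j - X $ j * Y $ i))"

lemma vector_8 [simp]:
  fixes a b c d e f g h :: "'a::zero"
  defines "v \<equiv> vector [a, b, c, d, e, f, g, h] :: 'a^8"
  shows "v $ 1 = a" "v $ 2 = b" "v $ 3 = c" "v $ 4 = d"
    "v $ 5 = e" "v $ 6 = f" "v $ 7 = g" "v $ 8 = h"
  unfolding v_def vector_def by simp_all

text \<open>The constructors name the algebras together with their parameters; the parameter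
  ranges are imposed by \<open>admissible\<close>.\<close>

datatype algebra_name =
    G1 real
  | G2 real
  | G3 real
  | G4 real real
  | G5
  | G6
  | G7
  | G8
  | G9 real
  | G10 real
  | G11 real real
  | G12 real

fun admissible :: "algebra_name \<Rightarrow> bool" where
  "admissible (G1 \<gamma>) \<longleftrightarrow> \<gamma> \<in> {0, 1}"
| "admissible (G2 \<alpha>) \<longleftrightarrow> True"
| "admissible (G3 \<gamma>) \<longleftrightarrow> \<gamma> \<in> {0, 1}"
| "admissible (G4 \<alpha> \<beta>) \<longleftrightarrow> \<alpha> \<noteq> 0 \<and> \<beta> > 0 \<or> \<alpha> > 0 \<and> \<beta> = 0"
| "admissible G5 \<longleftrightarrow> True"
| "admissible G6 \<longleftrightarrow> True"
| "admissible G7 \<longleftrightarrow> True"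
| "admissible G8 \<longleftrightarrow> True"
| "admissible (G9 \<gamma>) \<longleftrightarrow> \<gamma> \<in> {0, 1}"
| "admissible (G10 \<gamma>) \<longleftrightarrow> \<gamma> \<in> {0, 1}"
| "admissible (G11 \<alpha> \<beta>) \<longleftrightarrow> (\<alpha>, \<beta>) \<in> {(0, 0), (1, 0), (0, 1)} \<or> \<alpha> > 0 \<and> \<beta> = 1"
| "admissible (G12 \<gamma>) \<longleftrightarrow> \<gamma> \<in> {0, 1}"

fun algebra_bracket :: "algebra_name \<Rightarrow> real^8 \<Rightarrow> real^8 \<Rightarrow> real^8" where
  "algebra_bracket (G1 \<gamma>) = ce_bracket (\<lambda>e.
     [0, 0, 0, 0, 0,
      e 1 3 + e 1 5 + e 2 4,
      e 1 4 - e 2 3 + e 2 5,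
      e 1 6 + e 2 7 + \<gamma> * e 3 4])"
| "algebra_bracket (G2 \<alpha>) = ce_bracket (\<lambda>e.
     [0, 0, 0, 0,
      e 1 2,
      e 1 3 + e 1 5 + e 2 4,
      e 1 4 - e 2 3 + e 2 5,
      e 1 6 + e 2 7 + \<alpha> * e 3 4])"
| "algebra_bracket (G3 \<gamma>) = ce_bracket (\<lambda>e.
     [0, 0, 0, 0,
      e 1 2,
      e 1 3 + \<gamma> * e 1 5 + e 2 5,
      e 1 5 + e 2 4 + \<gamma> * e 2 5,
      e 1 6 + e 2 7])"
| "algebra_bracket (G4 \<alpha> \<beta>) = ce_bracket (\<lambda>e.
     [0, 0, 0, 0,
      e 1 2,
      e 1 5 + (\<alpha> + 1) * e 2 4,
      (\<alpha> - 1) * e 1 4 - e 2 3 + (\<beta> - 1) * e 2 5,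
      e 1 6 + e 2 7 + e 3 4 - 2 * e 4 5])"
| "algebra_bracket G5 = ce_bracket (\<lambda>e.
     [0, 0, 0, 0,
      2 * e 1 2,
      e 1 4 - e 2 3,
      e 1 3 + e 2 4,
      e 1 6 + e 2 7 + e 3 5])"
| "algebra_bracket G6 = ce_bracket (\<lambda>e.
     [0, 0, 0, 0,
      2 * e 1 2,
      e 1 4 + e 1 5 - e 2 3,
      e 1 3 + e 2 4 + e 2 5,
      e 1 6 + e 2 7 + e 3 5])"
| "algebra_bracket G7 = ce_bracket (\<lambda>e.
     [0, 0, 0, 0, 0,
      e 1 5,
      e 2 5,
      e 1 6 + e 2 7 + e 3 4])"
| "algebra_bracket G8 = ce_bracket (\<lambda>e.
     [0, 0, 0, 0,
      e 1 2,
      e 1 5,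
      e 2 5,
      e 1 6 + e 2 7 + e 3 4])"
| "algebra_bracket (G9 \<gamma>) = ce_bracket (\<lambda>e.
     [0, 0, 0,
      e 1 3,
      e 2 3,
      e 3 5,
      \<gamma> * e 1 2 - e 3 4,
      e 1 6 + e 2 7 + e 4 5])"
| "algebra_bracket (G10 \<gamma>) = ce_bracket (\<lambda>e.
     [0, 0, 0,
      e 1 3,
      e 2 3,
      e 1 4 + e 2 5,
      e 1 5 + e 2 4,
      e 1 6 + \<gamma> * e 2 5 + e 2 7])"
| "algebra_bracket (G11 \<alpha> \<beta>) = ce_bracket (\<lambda>e.
     [0, 0, 0,
      e 1 3,
      e 2 3,
      e 1 4 + e 2 5 - e 3 5,
      \<alpha> * e 1 2 + e 1 5 + e 2 4 + e 3 4,
      e 1 6 + e 2 7 - e 4 5 - \<beta> * (2 * e 2 5 + e 3 5)])"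
| "algebra_bracket (G12 \<gamma>) = ce_bracket (\<lambda>e.
     [0, 0,
      e 1 2,
      e 1 3,
      e 2 3,
      e 1 4 + e 2 5,
      e 1 5 + e 2 4,
      e 1 6 + e 2 7 + \<gamma> * e 2 5])"

end

theory Submission
  imports Defs
begin

text \<open>Let \<open>z\<close> span the center of a nilpotent Lie algebra with complex structure \<open>J\<close>. Integrability for
  the pairs \<open>(z, X)\<close> makes the nilpotent derivation \<open>D = ad (J z)\<close> complex linear, so \<open>D\<close> can be put in Jordan
  form on a basis of (1,0)-forms. Since \<open>D\<close> is a derivation, only few coefficients survive in the differentials
  of these forms. The Jacobi identity and the nilpotency of the operators
  \<open>Y \<mapsto> [X, Y] - [J X, J Y]\<close> and \<open>Y \<mapsto> [X, Y] + J [J X, Y]\<close> eliminate most of the others. What is left are two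
  kinds of structure equations, which linear changes of the forms bring to two families of real normal forms;
  rescaling the basis of a normal form gives an algebra of the list.
  Conversely, the normal forms carry explicit complex structures. An isomorphism respects the upper central
  series, whose dimensions separate the two families; inside a family its matrix is block triangular,
  and comparing entries yields the invariants that distinguish the parameters.\<close>

text \<open>A one-dimensional center makes \<open>D\<close> effective: \<open>J z\<close> is not
  central, so \<open>D\<close> is nonzero, and a nonzero \<open>D X\<close> lies outside the plane
  of \<open>z\<close> and \<open>J z\<close>, since otherwise some \<open>br (J X')\<close> would
  have the eigenvalue -1 at \<open>J z\<close>. So \<open>D\<close> induces a nonzero nilpotent
  complex linear map on the 3-dimensional complex quotient by this plane, and only the Jordan types
  (3) and (2,1) occur. Type (3) leads to \<open>std2\<close> with \<open>m = 1\<close>; type (2,1)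
  leads to \<open>std1\<close> or to \<open>std2\<close> with \<open>m = 0\<close>, so the two
  families do not follow the Jordan type. The obstacle is that \<open>br X\<close> is nilpotent but
  only real linear, so it has no complex matrix on (1,0)-forms. The two auxiliary operators are
  complex linear and still nilpotent: one keeps the (2,0)-part of a differential, the other the half
  of the (1,1)-part that is linear in the second argument. On kernels of closed forms they act by
  matrices of size one or two, whose entries are the coefficients sought. The nonvanishing of the
  decisive coefficients comes from the center again: otherwise an explicit vector off the line of
  \<open>z\<close> would be central.\<close>

lemma forall_8: "(\<forall>i::8. P i) \<longleftrightarrow> P 1 \<and> P 2 \<and> P 3 \<and> P 4 \<and> P 5 \<and> P 6
    \<and> P 7 \<and> P 8"
proof -
  have "x = 1 \<or> x = 2 \<or> x = 3 \<or> x = 4 \<or> x = 5 \<or> x = 6 \<or> x = 7 \<or> x = 8" for x :: 8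
  proof (induct x)
    case (of_int z)
    then have "z = 0 \<or> z = 1 \<or> z = 2 \<or> z = 3 \<or> z = 4 \<or> z = 5 \<or> z = 6 \<or> z = 7" by fastforce
    then show ?case by auto
  qed
  then show ?thesis by metis
qed

lemma vec8_eq_iff:
  fixes x y :: "'a^8"
  shows "x = y \<longleftrightarrow> x$1 = y$1 \<and> x$2 = y$2 \<and> x$3 = y$3 \<and> x$4 = y$4 \<and> x$5 = y$5
      \<and> x$6 = y$6 \<and> x$7 = y$7 \<and> x$8 = y$8"
  by (simp add: vec_eq_iff forall_8)

section \<open>Isomorphisms and transport of complex structures\<close>

lemma linear_inv:
  assumes "linear f" "bij f"
  shows "linear (inv f)"
proof (rule linearI)
  have *: "f (inv f x) = x" "inv f (f y) = y" for x y
    using assms(2) by (simp_all add: bij_is_surj surj_f_inv_f bij_is_inj)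
  show "inv f (x + y) = inv f x + inv f y" for x y
    using *(2)[of "inv f x + inv f y"] by (simp add: linear_add[OF assms(1)] *(1))
  show "inv f (c *\<^sub>R x) = c *\<^sub>R inv f x" for c x
    using *(2)[of "c *\<^sub>R inv f x"] by (simp add: linear_scale[OF assms(1)] *(1))
qed

lemma lie_isomorphic_refl: "lie_isomorphic br br"
  unfolding lie_isomorphic_def by (intro exI[of _ id]) (simp add: linear_id)

lemma lie_isomorphic_sym:
  assumes "lie_isomorphic br br'"
  shows "lie_isomorphic br' br"
proof -
  obtain f where f: "linear f" "bij f" and h: "\<And>X Y. f (br X Y) = br' (f X) (f Y)"
    using assms unfolding lie_isomorphic_def by blast
  have fg: "f (inv f X) = X" "inv f (f Y) = Y" for X Y
    using f(2) by (simp_all add: bij_is_surj surj_f_inv_f bij_is_inj)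
  have "inv f (br' X Y) = br (inv f X) (inv f Y)" for X Y
    using h[of "inv f X" "inv f Y"] by (metis fg)
  then show ?thesis
    unfolding lie_isomorphic_def
    using linear_inv[OF f] bij_imp_bij_inv[OF f(2)] by blast
qed

lemma lie_isomorphic_trans:
  assumes "lie_isomorphic br br'" "lie_isomorphic br' br''"
  shows "lie_isomorphic br br''"
proof -
  obtain f where f: "linear f" "bij f" and h: "\<And>X Y. f (br X Y) = br' (f X) (f Y)"
    using assms unfolding lie_isomorphic_def by blast
  obtain g where g: "linear g" "bij g" and k: "\<And>X Y. g (br' X Y) = br'' (g X) (g Y)"
    using assms unfolding lie_isomorphic_def by blast
  show ?thesis
    unfolding lie_isomorphic_def
    using linear_compose[OF f(1) g(1)] bij_comp[OF f(2) g(2)] h k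
    by (intro exI[of _ "g \<circ> f"]) simp
qed

lemma complex_structure_transport:
  assumes "lie_isomorphic br br'" "complex_structure br' J'"
  shows "\<exists>J. complex_structure br J"
proof -
  obtain f where f: "linear f" "bij f" and h: "\<And>X Y. f (br X Y) = br' (f X) (f Y)"
    using assms unfolding lie_isomorphic_def by blast
  define g where "g = inv f"
  have fg: "f (g X) = X" "g (f Y) = Y" for X Y
    using f(2) by (simp_all add: g_def bij_is_surj surj_f_inv_f bij_is_inj)
  have g: "linear g" using linear_inv[OF f] by (simp add: g_def)
  have gh: "g (br' X Y) = br (g X) (g Y)" for X Y
    using h[of "g X" "g Y"] by (metis fg)
  have lf: "f (x + y) = f x + f y" "f (- x) = - f x" "f (x - y) = f x - f y" for x y
    using f(1) by (simp_all add: linear_add linear_neg linear_diff)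
  have lg: "g (x + y) = g x + g y" "g (- x) = - g x" "g (x - y) = g x - g y" "g 0 = 0" for x y
    using g by (simp_all add: linear_add linear_neg linear_diff linear_0)
  have J: "linear J'" "\<And>X. J' (J' X) = - X"
    and N: "\<And>X Y. br' X Y + J' (br' (J' X) Y) + J' (br' X (J' Y)) - br' (J' X) (J' Y) = 0"
    using assms(2) unfolding complex_structure_def by auto
  have "linear (g \<circ> J' \<circ> f)"
    using f(1) g J(1) by (intro linear_compose)
  moreover have "br X Y + g (J' (f (br (g (J' (f X))) Y))) + g (J' (f (br X (g (J' (f Y)))))) - br (g (J' (f X))) (g
      (J' (f Y))) = 0" for X Y
    using arg_cong[OF N[of "f X" "f Y"], of g] by (simp add: lg h fg gh)
  ultimately show ?thesis
    unfolding complex_structure_def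
    by (intro exI[of _ "g \<circ> J' \<circ> f"]) (simp add: fg J lg)
qed

lemma lie_isomorphicI:
  fixes f :: "real^8 \<Rightarrow> real^8"
  assumes "linear f" "\<And>X. f X = 0 \<Longrightarrow> X = 0" "\<And>X Y. f (br X Y) = br' (f X) (f Y)"
  shows "lie_isomorphic br br'"
proof -
  have "inj f" using assms(1,2) by (simp add: linear_injective_0)
  then have "bij f" using linear_inj_imp_surj[OF assms(1)] by (simp add: bij_def)
  then show ?thesis unfolding lie_isomorphic_def using assms by blast
qed

text \<open>In terms of 1-forms \<open>w\<close>, the bracket \<open>w (br X Y)\<close> is given by \<open>-
    dw\<close>; replacing \<open>w\<close> by \<open>- w\<close>
  absorbs the sign.\<close>

lemma lie_isomorphic_coframe:
  fixes w :: "'a::euclidean_space \<Rightarrow> real^8"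
  assumes "br' = ce_bracket d" "linear w" "\<And>X. w X = 0 \<Longrightarrow> X = 0" "DIM('a) = 8"
    and "\<And>X Y. w (br X Y) = - br' (w X) (w Y)"
  shows "lie_isomorphic br br'"
proof -
  have lin: "linear (\<lambda>X. - w X)" using assms(2) by (rule linear_compose_neg)
  have "inj (\<lambda>X. - w X)" using lin assms(3) by (simp add: linear_injective_0)
  moreover have "surj (\<lambda>X. - w X)"
    using linear_injective_imp_surjective[OF lin] \<open>inj _\<close> assms(4) by simp
  ultimately have "bij (\<lambda>X. - w X)" by (simp add: bij_def)
  then show ?thesis
    unfolding lie_isomorphic_def using lin assms(5)
    by (intro exI[of _ "\<lambda>X. - w X"]) (simp add: assms(1) ce_bracket_def)
qed

section \<open>Two families of normal forms\<close>

text \<open>\<open>nf1\<close> covers the first eight algebras of the list and \<open>nf2\<close> the last four;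
    \<open>nf2c\<close> is \<open>nf2\<close> with
  \<open>H = 1\<close> in a basis on which a complex structure acts with constant coefficients.\<close>

definition nf1 :: "real \<Rightarrow> real \<Rightarrow> real \<Rightarrow> real \<Rightarrow> real^8 \<Rightarrow>
    real^8 \<Rightarrow> real^8" where
  "nf1 f v C G = ce_bracket (\<lambda>e.
     [0, 0, C * e 1 2, 0, v * e 1 2,
      e 1 5 + f * (e 1 3 + e 2 4) + G * C / 2 * e 2 4,
      e 2 5 + f * (e 1 4 - e 2 3) - G * C / 2 * e 1 4,
      e 1 6 + e 2 7 + G * e 3 4])"

definition nf2 :: "real \<Rightarrow> real \<Rightarrow> real \<Rightarrow> real \<Rightarrow> real \<Rightarrow>
    real^8 \<Rightarrow> real^8 \<Rightarrow> real^8" where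
  "nf2 m v H C h = ce_bracket (\<lambda>e.
     [0, 0, v * e 1 2, e 1 3, e 2 3,
      H * (e 1 4 + e 2 5) - m * e 3 5,
      C * e 1 2 + H * (e 1 5 + e 2 4) + m * e 3 4,
      e 1 6 + e 2 7 - m * e 4 5 + h * (e 2 5 + m / 2 * e 3 5)])"

definition nf2c :: "real \<Rightarrow> real \<Rightarrow> real \<Rightarrow> real \<Rightarrow> real^8 \<Rightarrow>
    real^8 \<Rightarrow> real^8" where
  "nf2c m v C k = ce_bracket (\<lambda>e.
     [0, 0, v * e 1 2, e 1 3, e 2 3,
      e 1 4 + e 2 5 - m * e 3 5,
      C * e 1 2 + e 1 5 + e 2 4 + m * e 3 4,
      e 1 6 + e 2 7 - m * e 4 5 + k * (e 1 4 + 3 * e 2 5)])"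

lemma nf1_complex: "\<exists>J. complex_structure (nf1 f v C G) J"
proof
  show "complex_structure (nf1 f v C G)
     (\<lambda>X. vector [- X$2, X$1, - X$4, X$3, - X$8, - X$7, X$6, X$5])"
    unfolding complex_structure_def
    by (intro conjI allI linearI)
      (simp_all add: vec8_eq_iff nf1_def ce_bracket_def field_simps)
qed

text \<open>In \<open>std2_nf2c\<close> the imaginary parts of the (1,0)-forms are stretched by sqrt
  3; multiplication by \<open>\<i>\<close> read in those coordinates produces the factors
  \<open>s\<close> and \<open>s / 3\<close>.\<close>

lemma nf2c_complex: "\<exists>J. complex_structure (nf2c m v C k) J"
proof
  define s where "s = sqrt 3"
  have s: "s * s = 3" "s * (s * x) = 3 * x" for x by (auto simp: s_def)
  have s0: "s \<noteq> 0" by (simp add: s_def)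
  have si: "s / 3 = 1 / s" using s(1) s0 by (simp add: field_simps)
  show "complex_structure (nf2c m v C k)
     (\<lambda>X. vector [s * X$2, - (s * X$1) / 3, X$8, s * X$5, - (s * X$4) / 3, s * X$7 / 3, - s * X$6, - X$3])"
    unfolding complex_structure_def
    apply (intro conjI allI linearI)
    apply (simp_all add: vec8_eq_iff nf2c_def ce_bracket_def field_simps s)
    done
qed

text \<open>This algebra has \<open>H = 0\<close>, whereas the coefficient of
  \<open>e 1 4 + e 2 5\<close> in \<open>nf2c\<close> is 1, so it needs a structure of its
  own.\<close>

lemma G9_complex: "\<exists>J. complex_structure (algebra_bracket (G9 g)) J"
proof
  show "complex_structure (algebra_bracket (G9 g))
     (\<lambda>X. vector [- X$2, X$1, X$8, - X$5, X$4, - X$7, X$6, - X$3])"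
    unfolding complex_structure_def
    apply (intro conjI allI linearI)
    apply (simp_all add: vec8_eq_iff ce_bracket_def algebra_simps)
    done
qed

text \<open>The shifts of coordinates 6 and 7 absorb \<open>k * (e 1 4 + e 2 5)\<close> into
  \<open>e 1 6 + e 2 7\<close>, which leaves \<open>2 * k * e 2 5\<close>; the other shifts follow
  from the equations of coordinates 6 and 7. The hypothesis is what the Jacobi identity demands, as
  the second differential of the sixth form is \<open>- m * v\<close> times a basis 3-form.\<close>

lemma nf2c_iso_nf2:
  assumes "m * v = 0"
  shows "lie_isomorphic (nf2c m v C k) (nf2 m v 1 C (2 * k))"
proof (rule lie_isomorphicI)
  let ?w = "\<lambda>X::real^8. vector [X$1, X$2, X$3 + k * v * X$2, X$4 + k * X$3, X$5, X$6 + k * X$4, X$7 + k * X$5, X$8] :: real^8"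
  show "linear ?w" by (intro linearI) (simp_all add: vec8_eq_iff algebra_simps)
  show "X = 0" if "?w X = 0" for X using that by (auto simp: vec8_eq_iff)
  show "?w (nf2c m v C k X Y) = nf2 m v 1 C (2 * k) (?w X) (?w Y)" for X Y
    by (simp add: vec8_eq_iff nf2c_def nf2_def ce_bracket_def field_simps) (use assms in auto)
qed

section \<open>Coordinate changes from the normal forms to the list\<close>

lemma G10_eq: "algebra_bracket (G10 g) = nf2 0 0 1 0 g"
  by (intro ext) (simp add: vec8_eq_iff nf2_def ce_bracket_def algebra_simps)
lemma G12_eq: "algebra_bracket (G12 g) = nf2 0 1 1 0 g"
  by (intro ext) (simp add: vec8_eq_iff nf2_def ce_bracket_def algebra_simps)
lemma G11_eq: "algebra_bracket (G11 a b) = nf2 1 0 1 a (- 2 * b)"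
  by (intro ext) (simp add: vec8_eq_iff nf2_def ce_bracket_def algebra_simps)
lemma G1_eq: "algebra_bracket (G1 g) = nf1 1 0 0 g"
  by (intro ext) (simp add: vec8_eq_iff nf1_def ce_bracket_def algebra_simps)
lemma G2_eq: "algebra_bracket (G2 a) = nf1 1 1 0 a"
  by (intro ext) (simp add: vec8_eq_iff nf1_def ce_bracket_def algebra_simps)
lemma G7_eq: "algebra_bracket G7 = nf1 0 0 0 1"
  by (intro ext) (simp add: vec8_eq_iff nf1_def ce_bracket_def algebra_simps)
lemma G8_eq: "algebra_bracket G8 = nf1 0 1 0 1"
  by (intro ext) (simp add: vec8_eq_iff nf1_def ce_bracket_def algebra_simps)

text \<open>For nonzero \<open>H\<close> the first conditions force
  \<open>a\<^sup>2 = b\<^sup>2\<close>, so the scalings of the first two coordinates agree up to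
  sign; that sign is the last freedom used for \<open>G11\<close>.\<close>

lemma nf2_scale:
  assumes "a \<noteq> 0" "b \<noteq> 0" "r \<noteq> 0" "c \<noteq> 0"
    and "H * c * b = H' * r * a\<^sup>2" "H * c * b = H' * r * b\<^sup>2" "H * c * a = H' * r * a * b"
    and "m * c = m' * r\<^sup>2" "v * r = v' * a * b" "C * c = C' * b"
    and "h * a * c = h' * r * b" "h * m * a * c = h' * m' * r\<^sup>2"
  shows "lie_isomorphic (nf2 m v H C h) (nf2 m' v' H' C' h')"
proof (rule lie_isomorphicI)
  let ?w = "\<lambda>X::real^8. vector [a * X$1, b * X$2, r * X$3, r * a * X$4, r * b * X$5, c * b * X$6, c * a * X$7,
      a * b * c * X$8] :: real^8"
  show "linear ?w" by (intro linearI) (simp_all add: vec8_eq_iff algebra_simps)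
  show "X = 0" if "?w X = 0" for X using that assms(1-4) by (auto simp: vec8_eq_iff)
  show "?w (nf2 m v H C h X Y) = nf2 m' v' H' C' h' (?w X) (?w Y)" for X Y
    apply (simp add: vec8_eq_iff nf2_def ce_bracket_def)
    apply (intro conjI)
    using assms(5-) by algebra+
qed

text \<open>Adding \<open>C * X$2\<close> to the fifth coordinate turns \<open>e 1 5\<close> into
  \<open>e 1 5 + C * e 1 2\<close> and leaves \<open>e 2 5\<close> alone. It would alter
  \<open>e 3 5\<close>, hence \<open>m = 0\<close>.\<close>

lemma nf2_drop_C: "lie_isomorphic (nf2 0 v 1 C h) (nf2 0 v 1 0 h)"
proof (rule lie_isomorphicI)
  let ?w = "\<lambda>X::real^8. vector [X$1, X$2, X$3, X$4, X$5 + C * X$2, X$6, X$7, X$8] :: real^8"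
  show "linear ?w" by (intro linearI) (simp_all add: vec8_eq_iff algebra_simps)
  show "X = 0" if "?w X = 0" for X using that by (auto simp: vec8_eq_iff)
  show "?w (nf2 0 v 1 C h X Y) = nf2 0 v 1 0 h (?w X) (?w Y)" for X Y
    by (simp add: vec8_eq_iff nf2_def ce_bracket_def algebra_simps)
qed

lemma nf2_G9:
  "\<exists>a. admissible a \<and> lie_isomorphic (nf2 1 0 0 C 0) (algebra_bracket a)"
proof -
  \<comment> \<open>Scaling the second coordinate by \<open>b\<close> divides the coefficient of
    \<open>e 1 2\<close> by \<open>b\<close>; the minus sign matches the sign of the seventh
    coordinate in \<open>?w\<close>.\<close>
  define b g where "b = (if C = 0 then 1 else - C)" and "g = (if C = 0 then 0 else 1::real)"
  have b: "b \<noteq> 0" "- C = g * b" by (auto simp: b_def g_def)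
  have "lie_isomorphic (nf2 1 0 0 C 0) (algebra_bracket (G9 g))"
  proof (rule lie_isomorphicI)
    let ?w = "\<lambda>X::real^8. vector [X$1, b * X$2, X$3, X$4, b * X$5, - b * X$6, - X$7, - b * X$8] :: real^8"
    show "linear ?w" by (intro linearI) (simp_all add: vec8_eq_iff algebra_simps)
    show "X = 0" if "?w X = 0" for X using that b(1) by (auto simp: vec8_eq_iff)
    show "?w (nf2 1 0 0 C 0 X Y) = algebra_bracket (G9 g) (?w X) (?w Y)" for X Y
      apply (simp add: vec8_eq_iff nf2_def ce_bracket_def)
      apply (intro conjI)
      using b(2) by (algebra | simp add: algebra_simps)+
  qed
  moreover have "admissible (G9 g)" by (simp add: g_def)
  ultimately show ?thesis by blast
qed

lemma nf2_G11:
  "\<exists>a. admissible a \<and> lie_isomorphic (nf2 1 0 1 C h) (algebra_bracket a)"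
proof -
  have *: "lie_isomorphic (nf2 1 0 1 C h) (nf2 1 0 1 (C * b) (h * a))"
    if "a \<noteq> 0" "b = a \<or> b = - a" for a b
    by (rule nf2_scale[where a = a and b = b and r = b and c = "b\<^sup>2"])
      (use that in \<open>auto simp: power2_eq_square\<close>)
  show ?thesis
  proof (cases "h = 0")
    case True
    show ?thesis
    proof (cases "C = 0")
      case True
      then show ?thesis using *[of 1 1] \<open>h = 0\<close>
        by (intro exI[of _ "G11 0 0"]) (simp add: G11_eq del: algebra_bracket.simps)
    next
      case False
      then show ?thesis using *[of "1 / C" "1 / C"] \<open>h = 0\<close>
        by (intro exI[of _ "G11 1 0"]) (simp add: G11_eq del: algebra_bracket.simps)
    qed
  next
    case False
    \<comment> \<open>\<open>a\<close> normalises \<open>h\<close> to -2, which is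
      \<open>\<beta> = 1\<close> in \<open>G11\<close>; the sign of \<open>b\<close> relative to
      \<open>a\<close> is still free and makes \<open>C * b\<close> nonnegative.\<close>
    define a b where "a = - 2 / h" and "b = (if C * a \<ge> 0 then a else - a)"
    have ab: "a \<noteq> 0" "b = a \<or> b = - a" "C * b \<ge> 0" "h * a = - 2 * 1"
      using False by (auto simp: a_def b_def)
    have "lie_isomorphic (nf2 1 0 1 C h) (algebra_bracket (G11 (C * b) 1))"
      unfolding G11_eq using *[OF ab(1,2)] ab(4) by simp
    moreover have "admissible (G11 (C * b) 1)"
      using ab(3) by (cases "C * b = 0") (auto simp: less_le)
    ultimately show ?thesis by blast
  qed
qed

lemma nf2_G10_G12:
  "\<exists>a. admissible a \<and> lie_isomorphic (nf2 0 v 1 C h) (algebra_bracket a)"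
proof -
  \<comment> \<open>For \<open>a = b\<close> and \<open>c = r * a\<close> the conditions of
    \<open>nf2_scale\<close> reduce to \<open>h * a = h'\<close> and
    \<open>v * r = v' * a\<^sup>2\<close>, so \<open>h\<close> and \<open>v\<close> are normalised
    independently.\<close>
  define a where "a = (if h = 0 then 1 else 1 / h)"
  define r where "r = (if v = 0 then 1 else a * a / v)"
  define g where "g = (if h = 0 then 0 else 1::real)"
  define v' where "v' = (if v = 0 then 0 else 1::real)"
  have "a \<noteq> 0" "r \<noteq> 0" by (auto simp: a_def r_def)
  have "lie_isomorphic (nf2 0 v 1 0 h) (nf2 0 v' 1 0 g)"
    by (rule nf2_scale[where a = a and b = a and r = r and c = "r * a"])
      (auto simp: a_def r_def g_def v'_def power2_eq_square field_simps)
  then have "lie_isomorphic (nf2 0 v 1 C h) (nf2 0 v' 1 0 g)"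
    using lie_isomorphic_trans nf2_drop_C by blast
  moreover have "nf2 0 v' 1 0 g = algebra_bracket (if v = 0 then G10 g else G12 g)"
    by (simp add: G10_eq G12_eq v'_def del: algebra_bracket.simps)
  moreover have "admissible (if v = 0 then G10 g else G12 g)" by (simp add: g_def)
  ultimately show ?thesis by metis
qed

text \<open>The products \<open>v * G\<close> and \<open>C * G\<close> are unchanged, which singles
  them out as candidates for invariants when \<open>G\<close> is nonzero.\<close>

lemma nf1_scale:
  assumes "k \<noteq> 0"
  shows "lie_isomorphic (nf1 f v C G) (nf1 f (k * v) (k * C) (G / k))"
proof (rule lie_isomorphicI)
  let ?w = "\<lambda>X::real^8. vector [X$1, X$2, k * X$3, k * X$4, k * X$5, k * X$6, k * X$7, k * X$8] :: real^8"
  show "linear ?w" by (intro linearI) (simp_all add: vec8_eq_iff algebra_simps)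
  show "X = 0" if "?w X = 0" for X using that assms by (auto simp: vec8_eq_iff)
  show "?w (nf1 f v C G X Y) = nf1 f (k * v) (k * C) (G / k) (?w X) (?w Y)" for X Y
    using assms by (simp add: vec8_eq_iff nf1_def ce_bracket_def field_simps)
qed

lemma nf1_swap: "lie_isomorphic (nf1 f v C G) (nf1 f (- v) C (- G))"
proof (rule lie_isomorphicI)
  let ?w = "\<lambda>X::real^8. vector [X$2, X$1, - X$3, X$4, X$5, X$7, X$6, X$8] :: real^8"
  show "linear ?w" by (intro linearI) (simp_all add: vec8_eq_iff algebra_simps)
  show "X = 0" if "?w X = 0" for X using that by (auto simp: vec8_eq_iff)
  show "?w (nf1 f v C G X Y) = nf1 f (- v) C (- G) (?w X) (?w Y)" for X Y
    by (simp add: vec8_eq_iff nf1_def ce_bracket_def field_simps)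
qed

lemma nf1_negate_C: "lie_isomorphic (nf1 f v C G) (nf1 f v (- C) G)"
  using lie_isomorphic_trans[OF nf1_swap nf1_scale[of "- 1"], of f v C G] by simp

text \<open>The symmetric matrix attached to the direction of \<open>[e\<^sub>1, e\<^sub>2]\<close> is
  \<open>diag (v + C, v - C)\<close>; it is rescaled here to have determinant \<open>\<plusminus>1\<close>.\<close>

lemma nf1_diagonal:
  assumes "t \<noteq> 0" "v + C \<noteq> 0" "v - C = s * (v + C) * t\<^sup>2"
  shows "lie_isomorphic (nf1 1 v C 0) (nf1 1 ((1 + s) / 2) ((1 - s) / 2) 0)"
proof -
  define k where "k = t / (v + C)"
  have k: "k \<noteq> 0" "k * (v + C) = t" "k * (v - C) = s * t^3"
    using assms(1,2) by (auto simp: k_def assms(3) power2_eq_square power3_eq_cube)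
  define q where "q = k / t\<^sup>2"
  have q: "q * t\<^sup>2 = k" "q * (v - C) = s * t" using k assms(1) by (auto simp: q_def field_simps power2_eq_square power3_eq_cube)
  have qt: "q \<noteq> 0" using q k by auto
  have kC: "k * v = t - k * C" using k(2) by (simp add: algebra_simps)
  have qC: "q * v = s * t + q * C" using q(2) by (simp add: algebra_simps)
  have qk: "k = q * t\<^sup>2" using q by simp
  show ?thesis
  proof (rule lie_isomorphicI)
    \<comment> \<open>\<open>X$5 + X$3\<close> and \<open>X$5 - X$3\<close> are the combinations
      with differentials \<open>(v + C) * e 1 2\<close> and \<open>(v - C) * e 1 2\<close>; they are
      scaled by \<open>k\<close> and \<open>q\<close> respectively, to reach the values 1 and
      \<open>s\<close>.\<close>
    let ?w = "\<lambda>X::real^8. vector [X$1, t * X$2,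
        (k * (X$5 + X$3) - q * (X$5 - X$3)) / 2, q * t * X$4,
        (k * (X$5 + X$3) + q * (X$5 - X$3)) / 2, k * X$6, q * t * X$7, k * X$8] :: real^8"
    show "linear ?w" by (intro linearI) (simp_all add: vec8_eq_iff field_simps)
    show "X = 0" if "?w X = 0" for X
    proof -
      have "k * (X$5 + X$3) - q * (X$5 - X$3) = 0" "k * (X$5 + X$3) + q * (X$5 - X$3) = 0"
        using that by (auto simp: vec8_eq_iff)
      then have "k * (X$5 + X$3) = 0" "q * (X$5 - X$3) = 0" by linarith+
      then have "X$3 = 0" "X$5 = 0" using k(1) qt by simp_all
      then show ?thesis using that assms(1) k(1) qt by (auto simp: vec8_eq_iff)
    qed
    show "?w (nf1 1 v C 0 X Y) = nf1 1 ((1 + s) / 2) ((1 - s) / 2) 0 (?w X) (?w Y)" for X Y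
      apply (simp add: vec8_eq_iff nf1_def ce_bracket_def)
      apply (intro conjI)
      using kC qC apply algebra
      using kC qC apply algebra
      by (simp_all add: qk field_simps power2_eq_square)
  qed
qed

text \<open>The symmetric matrix is \<open>diag (1, -1)\<close>. The coordinates
  \<open>X$1 + X$2\<close> and \<open>X$1 - X$2\<close> follow its isotropic directions and make it
  antidiagonal, as in \<open>G3 0\<close>.\<close>

lemma nf1_G3_0: "lie_isomorphic (nf1 1 0 1 0) (algebra_bracket (G3 0))"
proof (rule lie_isomorphicI)
  let ?w = "\<lambda>X::real^8. vector [X$1 + X$2, X$1 - X$2, - 2 * (X$5 + X$4), - 2 * (X$5 - X$4), - 2 * X$3,
     - 2 * (X$6 + X$7), - 2 * (X$6 - X$7), - 4 * X$8] :: real^8"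
  show "linear ?w" by (intro linearI) (simp_all add: vec8_eq_iff algebra_simps)
  show "X = 0" if "?w X = 0" for X using that by (auto simp: vec8_eq_iff)
  show "?w (nf1 1 0 1 0 X Y) = algebra_bracket (G3 0) (?w X) (?w Y)" for X Y
    by (simp add: vec8_eq_iff nf1_def ce_bracket_def algebra_simps)
qed

text \<open>The degenerate case: \<open>diag (2 * C, 0)\<close> has rank one, and so has the matrix
  of \<open>G3 1\<close>, whose four entries are 1.\<close>

lemma nf1_G3_1:
  assumes "C \<noteq> 0"
  shows "lie_isomorphic (nf1 1 C C 0) (algebra_bracket (G3 1))"
proof (rule lie_isomorphicI)
  define p where "p = 1 / (2 * C)"
  have p: "p \<noteq> 0" "2 * p * C = 1" using assms by (auto simp: p_def)
  let ?w = "\<lambda>X::real^8. vector [X$1 - X$2, X$2, - p * X$4, p * (X$4 + X$5 - X$3), p * (X$5 + X$3 + X$4),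
     p * X$6, p * (X$6 + X$7), p * X$8] :: real^8"
  show "linear ?w" by (intro linearI) (simp_all add: vec8_eq_iff algebra_simps)
  show "X = 0" if "?w X = 0" for X using that p by (auto simp: vec8_eq_iff)
  show "?w (nf1 1 C C 0 X Y) = algebra_bracket (G3 1) (?w X) (?w Y)" for X Y
    apply (simp add: vec8_eq_iff nf1_def ce_bracket_def)
    apply (intro conjI)
    using p(2) by (algebra | simp add: algebra_simps)+
qed

lemma nf1_G4:
  assumes "C \<noteq> 0" "v / C > - 1"
  shows "lie_isomorphic (nf1 1 v C 1) (algebra_bracket (G4 (2 / C) (v / C)))"
proof -
  define b u t where "b = v / C" and "u = 1 / C" and "t = sqrt (1 / (b + 1))"
  have u: "u \<noteq> 0" "u * C = 1" and v: "v = b * C" using assms(1) by (auto simp: u_def b_def)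
  have t: "t \<noteq> 0" "b * t\<^sup>2 = 1 - t\<^sup>2" using assms(2) by (auto simp: t_def b_def field_simps)
  have "lie_isomorphic (nf1 1 v C 1) (algebra_bracket (G4 (2 * u) b))"
  proof (rule lie_isomorphicI)
    \<comment> \<open>The third coordinate is the combination of \<open>X$5 + X$3\<close> and
      \<open>X$5 - X$3\<close> that is closed; \<open>t\<^sup>2 * (b + 1) = 1\<close> makes the
      differential of the fifth the product of the new first two.\<close>
    let ?w = "\<lambda>X::real^8. vector [X$1, t * X$2,
        (b - 1) * t^3 * u * (X$5 + X$3) - t * u * (X$5 - X$3), t\<^sup>2 / 2 * X$4, t^3 * u * (X$5 + X$3),
        t^3 * u * X$6, t\<^sup>2 * u * X$7, t^3 * u * X$8] :: real^8"
    show "linear ?w" by (intro linearI) (simp_all add: vec8_eq_iff algebra_simps)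
    show "X = 0" if "?w X = 0" for X using that t(1) u(1) by (auto simp: vec8_eq_iff)
    have bC: "b = 1 / t\<^sup>2 - 1" "C = 1 / u" using t u by (simp_all add: field_simps)
    show "?w (nf1 1 v C 1 X Y) = algebra_bracket (G4 (2 * u) b) (?w X) (?w Y)" for X Y
      using t(1) u(1)
      by (simp add: vec8_eq_iff nf1_def ce_bracket_def v bC field_simps power2_eq_square power3_eq_cube)
  qed
  then show ?thesis by (simp add: u_def b_def del: algebra_bracket.simps)
qed

lemma nf1_G5_G6:
  assumes "C \<noteq> 0" "G \<noteq> 0"
  shows "lie_isomorphic (nf1 0 v C G) (algebra_bracket (if v = 0 then G5 else G6))"
proof -
  define m where "m = (if v = 0 then 1 else 2 / v)"
  define n where "n = (if v = 0 then 0 else 1::real)"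
  define u where "u = 1 / C"
  have m: "m \<noteq> 0" "m * v = 2 * n" by (auto simp: m_def n_def)
  have u: "u \<noteq> 0" "u * C = 1" using assms(1) by (auto simp: u_def)
  have "lie_isomorphic (nf1 0 v C G) (ce_bracket (\<lambda>e. [0, 0, 0, 0,
      2 * e 1 2,
      e 1 4 + n * e 1 5 - e 2 3,
      e 1 3 + e 2 4 + n * e 2 5,
      e 1 6 + e 2 7 + e 3 5]))"
  proof (rule lie_isomorphicI)
    \<comment> \<open>The fourth coordinate is closed because \<open>m * v = 2 * n\<close> and
      \<open>u * C = 1\<close>.\<close>
    let ?w = "\<lambda>X::real^8. vector [X$1, X$2, - m * G * C / 2 * X$4, m * X$5 - n * (2 * u * X$3), 2 * u * X$3,
      m * X$6, m * X$7, m * X$8] :: real^8"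
    show "linear ?w" by (intro linearI) (simp_all add: vec8_eq_iff algebra_simps)
    show "X = 0" if "?w X = 0" for X using that m(1) u(1) assms by (auto simp: vec8_eq_iff)
    have vC: "v = 2 * n / m" "C = 1 / u" using m u by (simp_all add: field_simps)
    show "?w (nf1 0 v C G X Y) = ce_bracket (\<lambda>e. [0, 0, 0, 0,
      2 * e 1 2,
      e 1 4 + n * e 1 5 - e 2 3,
      e 1 3 + e 2 4 + n * e 2 5,
      e 1 6 + e 2 7 + e 3 5]) (?w X) (?w Y)" for X Y
      using m(1) u(1) by (simp add: vec8_eq_iff nf1_def ce_bracket_def vC field_simps)
  qed
  also have "(ce_bracket (\<lambda>e. [0, 0, 0, 0,
      2 * e 1 2,
      e 1 4 + n * e 1 5 - e 2 3,
      e 1 3 + e 2 4 + n * e 2 5,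
      e 1 6 + e 2 7 + e 3 5])) = algebra_bracket (if v = 0 then G5 else G6)"
    by (intro ext) (simp add: n_def vec8_eq_iff ce_bracket_def)
  finally show ?thesis .
qed

lemma nf1_G7_G8:
  assumes "G \<noteq> 0"
  shows "lie_isomorphic (nf1 0 v 0 G) (algebra_bracket (if v = 0 then G7 else G8))"
proof -
  define m where "m = (if v = 0 then 1 else 1 / v)"
  define n where "n = (if v = 0 then 0 else 1::real)"
  have m: "m \<noteq> 0" "m * v = n" by (auto simp: m_def n_def)
  have "lie_isomorphic (nf1 0 v 0 G) (nf1 0 n 0 1)"
  proof (rule lie_isomorphicI)
    let ?w = "\<lambda>X::real^8. vector [X$1, X$2, m * G * X$3, X$4, m * X$5, m * X$6, m * X$7, m * X$8] :: real^8"
    show "linear ?w" by (intro linearI) (simp_all add: vec8_eq_iff algebra_simps)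
    show "X = 0" if "?w X = 0" for X using that m(1) assms by (auto simp: vec8_eq_iff)
    show "?w (nf1 0 v 0 G X Y) = nf1 0 n 0 1 (?w X) (?w Y)" for X Y
      using m(2) by (auto simp: vec8_eq_iff nf1_def ce_bracket_def algebra_simps)
  qed
  then show ?thesis by (simp add: n_def G7_eq G8_eq del: algebra_bracket.simps split: if_splits)
qed

lemma nf1_G1_to_G4:
  "\<exists>a. admissible a \<and> lie_isomorphic (nf1 1 v C G) (algebra_bracket a)"
proof (cases "G = 0")
  case True
  show ?thesis
  proof (cases "v = 0 \<and> C = 0")
    case True
    then show ?thesis using lie_isomorphic_refl \<open>G = 0\<close>
      by (intro exI[of _ "G1 0"]) (simp add: G1_eq del: algebra_bracket.simps)
  next
    case False
    have "\<exists>a. admissible a \<and> lie_isomorphic (nf1 1 v C 0) (algebra_bracket a)" if n: "v + C \<noteq> 0" for v C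
    proof (cases "v = C")
      case True
      then show ?thesis using nf1_G3_1[of C] n by (intro exI[of _ "G3 1"]) auto
    next
      case False
      \<comment> \<open>Sign and square root of the ratio of the two diagonal entries. A definite
        matrix gives \<open>G2 0\<close>, an indefinite one \<open>G3 0\<close>.\<close>
      define s where "s = sgn ((v - C) / (v + C))"
      define t where "t = sqrt \<bar>(v - C) / (v + C)\<bar>"
      have "s * t\<^sup>2 = (v - C) / (v + C)"
        unfolding s_def t_def by (subst real_sqrt_pow2) (simp_all only: sgn_mult_abs abs_ge_zero)
      then have t: "t \<noteq> 0" "v - C = s * (v + C) * t\<^sup>2"
        using n False by (auto simp: t_def field_simps)
      have "s = 1 \<or> s = - 1" using n False by (auto simp: s_def sgn_if)
      then show ?thesis
      proof
        assume "s = 1"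
        then show ?thesis using nf1_diagonal[OF t(1) n t(2)]
          by (intro exI[of _ "G2 0"]) (simp add: G2_eq del: algebra_bracket.simps)
      next
        assume "s = - 1"
        then show ?thesis using lie_isomorphic_trans[OF nf1_diagonal[OF t(1) n t(2)]] nf1_G3_0
          by (intro exI[of _ "G3 0"]) (simp del: algebra_bracket.simps)
      qed
    qed
    note * = this
    show ?thesis
    proof (cases "v + C = 0")
      case True
      \<comment> \<open>\<open>nf1_swap\<close> exchanges the roles of \<open>v + C\<close> and
        \<open>v - C\<close> up to sign, and these do not both vanish here.\<close>
      then have "- v + C \<noteq> 0" using False by auto
      then show ?thesis using *[of "- v" C] lie_isomorphic_trans[OF nf1_swap[of 1 v C 0]] \<open>G = 0\<close>
        by auto
    qed (use * \<open>G = 0\<close> in auto)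
  qed
next
  case False
  show ?thesis
  proof (cases "C = 0")
    case True
    show ?thesis
    proof (cases "v = 0")
      case True
      then show ?thesis using nf1_scale[of G 1 v C G] \<open>C = 0\<close> False
        by (intro exI[of _ "G1 1"]) (simp add: G1_eq del: algebra_bracket.simps)
    next
      case v: False
      then show ?thesis using nf1_scale[of "1 / v" 1 v C G] \<open>C = 0\<close>
        by (intro exI[of _ "G2 (G * v)"]) (simp add: G2_eq del: algebra_bracket.simps)
    qed
  next
    case C: False
    define V K where "V = G * v" and "K = G * C"
    \<comment> \<open>After scaling to \<open>G = 1\<close>, \<open>nf1_negate_C\<close> leaves the
      sign of \<open>C\<close> free. It is chosen so that \<open>V / c\<close> is positive, or
      \<open>c\<close> is positive if \<open>V = 0\<close>; this is the parameter range of
      \<open>G4\<close>.\<close>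
    define c where "c = (if V * K > 0 \<or> V = 0 \<and> K > 0 then K else - K)"
    have "K \<noteq> 0" using False C by (simp add: K_def)
    then have c: "c \<noteq> 0" "V * c > 0 \<or> V = 0 \<and> c > 0"
      by (auto simp: c_def not_less order_le_less mult_less_0_iff)
    then have "V / c > 0 \<or> V = 0 \<and> 2 / c > 0"
      by (auto simp: zero_less_mult_iff zero_less_divide_iff)
    then have "admissible (G4 (2 / c) (G * v / c))" using c(1) by (auto simp: V_def)
    moreover have "lie_isomorphic (nf1 1 v C G) (nf1 1 (G * v) c 1)"
      using nf1_scale[of G 1 v C G] lie_isomorphic_trans[OF nf1_scale[of G 1 v C G] nf1_negate_C] False
      by (auto simp: c_def K_def)
    moreover note c(1)
    moreover from calculation(1) have "G * v / c > - 1" by auto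
    ultimately show ?thesis using nf1_G4[of c "G * v"] lie_isomorphic_trans by blast
  qed
qed

section \<open>Invariants of the normal forms\<close>

fun upper_central_series :: "('a::real_vector \<Rightarrow> 'a \<Rightarrow> 'a) \<Rightarrow> nat \<Rightarrow> 'a set" where
  "upper_central_series br 0 = {0}"
| "upper_central_series br (Suc k) = {X. \<forall>Y. br X Y \<in> upper_central_series br k}"

lemma upper_central_series_image:
  assumes "linear f" "bij f" "\<And>X Y. f (br X Y) = br' (f X) (f Y)"
  shows "f X \<in> upper_central_series br' k \<longleftrightarrow> X \<in> upper_central_series br k"
proof (induction k arbitrary: X)
  case 0
  have "f X = 0 \<longleftrightarrow> X = 0" using assms(1,2) by (metis bij_is_inj injD linear_0)
  then show ?case by simp
next
  case (Suc k)
  have "(\<forall>Y. br' (f X) Y \<in> upper_central_series br' k) \<longleftrightarrow> (\<forall>Y. br' (f X) (f Y)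
      \<in> upper_central_series br' k)"
    using assms(2) by (metis bij_is_surj surjD)
  also have "\<dots> \<longleftrightarrow> (\<forall>Y. br X Y \<in> upper_central_series br k)"
    using Suc by (simp flip: assms(3))
  finally show ?case by simp
qed

lemma dim_upper_central_series:
  fixes br :: "'a::euclidean_space \<Rightarrow> 'a \<Rightarrow> 'a" and br' :: "'b::euclidean_space \<Rightarrow> 'b \<Rightarrow> 'b"
  assumes "lie_isomorphic br br'"
  shows "dim (upper_central_series br k) = dim (upper_central_series br' k)"
proof -
  obtain f where f: "linear f" "bij f" "\<And>X Y. f (br X Y) = br' (f X) (f Y)"
    using assms unfolding lie_isomorphic_def by blast
  have "f ` upper_central_series br k = upper_central_series br' k"
  proof (intro set_eqI iffI)
    fix Y assume "Y \<in> upper_central_series br' k"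
    moreover obtain X where "Y = f X" using f(2) by (metis bij_is_surj surjD)
    ultimately show "Y \<in> f ` upper_central_series br k"
      using upper_central_series_image[where br = br and br' = br' and f = f, OF f] by blast
  qed (use upper_central_series_image[where br = br and br' = br' and f = f, OF f] in blast)
  moreover have "dim (f ` upper_central_series br k) = dim (upper_central_series br k)"
    by (rule dim_image_eq[OF f(1)]) (use f(2) in \<open>auto simp: bij_def inj_on_def\<close>)
  ultimately show ?thesis by simp
qed

lemma dim_coordinate_subspace:
  "dim {X::real^'n. \<forall>i\<in>S. X $ i = 0} = CARD('n) - card S"
proof -
  have "dim {X::real^'n. \<forall>i. i \<notin> - S \<longrightarrow> X $ i = 0} = card (- S)"
    using dim_substandard_cart[where 'a = real and d = "- S"] unfolding dim_vec_eq .
  moreover have "{X::real^'n. \<forall>i. i \<notin> - S \<longrightarrow> X $ i = 0} = {X. \<forall>i\<in>S. X $ i = 0}" by auto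
  moreover have "card (- S) = CARD('n) - card S"
    using card_Diff_subset[of S UNIV] by (simp add: Compl_eq_Diff_UNIV)
  ultimately show ?thesis by simp
qed

section \<open>Upper central series of the normal forms\<close>

lemma nf1_ucs1:
  assumes "f \<noteq> 0 \<or> G \<noteq> 0"
  shows "upper_central_series (nf1 f v C G) 1 =
    {X. \<forall>i\<in>{1,2,3,4,5,6,7}. X $ i = 0}"
proof (intro set_eqI)
  fix X :: "real^8"
  have "X $ 1 = 0 \<and> X $ 2 = 0 \<and> X $ 3 = 0 \<and> X $ 4 = 0 \<and> X $ 5 = 0 \<and> X $ 6 = 0 \<and> X $ 7 = 0"
    if *: "\<And>Y. nf1 f v C G X Y = 0"
    using *[of "axis 1 1"] *[of "axis 2 1"] *[of "axis 3 1"] *[of "axis 4 1"] *[of "axis 5 1"]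
      *[of "axis 6 1"] *[of "axis 7 1"] assms
    by (auto simp: nf1_def ce_bracket_def vec8_eq_iff axis_def)
  then show "X \<in> upper_central_series (nf1 f v C G) 1 \<longleftrightarrow> X \<in> {X. \<forall>i\<in>{1,2,3,4,5,6,7}. X $ i = 0}"
    by (auto simp: nf1_def ce_bracket_def vec8_eq_iff)
qed

lemma nf1_ucs2:
  "upper_central_series (nf1 1 v C G) (Suc 1) = {X. \<forall>i\<in>{1,2,3,4,5}. X $ i = 0}"
proof (intro set_eqI)
  fix X :: "real^8"
  have "X $ 1 = 0 \<and> X $ 2 = 0 \<and> X $ 3 = 0 \<and> X $ 4 = 0 \<and> X $ 5 = 0"
    if *: "\<And>Y. \<forall>i\<in>{1,2,3,4,5,6,7}. nf1 1 v C G X Y $ i = 0"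
  proof -
    have 1: "X $ 1 = 0" "X $ 2 = 0"
      using *[of "axis 5 1"] by (simp_all add: nf1_def ce_bracket_def axis_def)
    have 2: "X $ 5 + X $ 3 = 0" "X $ 5 - X $ 3 = 0" "(1 - G * C / 2) * X $ 4 = 0" "(1 + G * C / 2) * X $ 4 = 0"
      using *[of "axis 1 1"] *[of "axis 2 1"] 1
      by (simp_all add: nf1_def ce_bracket_def axis_def algebra_simps)
    \<comment> \<open>The factors \<open>1 - G * C / 2\<close> and \<open>1 + G * C / 2\<close>
      never vanish together, and their sum isolates \<open>X $ 4\<close>.\<close>
    have "2 * X $ 4 = (1 - G * C / 2) * X $ 4 + (1 + G * C / 2) * X $ 4" by (simp add: algebra_simps)
    then have "X $ 4 = 0" using 2(3,4) by simp
    then show ?thesis using 1 2(1,2) by simp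
  qed
  then have "(\<forall>Y. \<forall>i\<in>{1,2,3,4,5,6,7}. nf1 1 v C G X Y $ i = 0) \<Longrightarrow>
      (\<forall>i\<in>{1,2,3,4,5}. X $ i = 0)"
    by simp
  moreover have "(\<forall>i\<in>{1,2,3,4,5}. X $ i = 0) \<Longrightarrow> (\<forall>Y. \<forall>i\<in>{1,2,3,4,5,6,7}.
      nf1 1 v C G X Y $ i = 0)"
    by (auto simp: nf1_def ce_bracket_def)
  ultimately show "X \<in> upper_central_series (nf1 1 v C G) (Suc 1) \<longleftrightarrow> X \<in> {X.
      \<forall>i\<in>{1,2,3,4,5}. X $ i = 0}"
    unfolding upper_central_series.simps(2)[of _ 1] nf1_ucs1[OF disjI1[OF one_neq_zero]] mem_Collect_eq by blast
qed

text \<open>An inclusion suffices: dimension at least 6 already differs from the 5 of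
  \<open>nf2\<close>. For \<open>v = C = 0\<close> this term is the whole space.\<close>

lemma nf1_ucs3:
  "{X. \<forall>i\<in>{1,2}. X $ i = 0} \<subseteq> upper_central_series (nf1 1 v C G) (Suc (Suc 1))"
    unfolding upper_central_series.simps(2)[of _ "Suc 1"] nf1_ucs2
    by (auto simp: nf1_def ce_bracket_def)

text \<open>For \<open>f = 0\<close> the dimension of this term tells whether \<open>C\<close>
  vanishes, and that of the next term whether \<open>v\<close> does; together they separate
  \<open>G5\<close> to \<open>G8\<close>.\<close>

lemma nf10_ucs2:
  assumes "G \<noteq> 0"
  shows "upper_central_series (nf1 0 v C G) (Suc 1) = {X. \<forall>i\<in>(if C = 0 then {1,2,5} else {1,2,4,5}). X $ i = 0}"
proof (intro set_eqI)
  fix X :: "real^8"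
  have "X $ 1 = 0 \<and> X $ 2 = 0 \<and> (C \<noteq> 0 \<longrightarrow> X $ 4 = 0) \<and> X $ 5 = 0"
    if *: "\<And>Y. \<forall>i\<in>{1,2,3,4,5,6,7}. nf1 0 v C G X Y $ i = 0"
  proof -
    have 1: "X $ 1 = 0" "X $ 2 = 0"
      using *[of "axis 5 1"] by (simp_all add: nf1_def ce_bracket_def axis_def)
    then show ?thesis
      using *[of "axis 1 1"] *[of "axis 2 1"] assms
      by (auto simp: nf1_def ce_bracket_def axis_def algebra_simps)
  qed
  then have "(\<forall>Y. \<forall>i\<in>{1,2,3,4,5,6,7}. nf1 0 v C G X Y $ i = 0) \<Longrightarrow>
      (\<forall>i\<in>(if C = 0 then {1,2,5} else {1,2,4,5}). X $ i = 0)"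
    by simp
  moreover have "(\<forall>i\<in>(if C = 0 then {1,2,5} else {1,2,4,5}). X $ i = 0) \<Longrightarrow>
      (\<forall>Y. \<forall>i\<in>{1,2,3,4,5,6,7}. nf1 0 v C G X Y $ i = 0)"
    by (auto simp: nf1_def ce_bracket_def split: if_splits)
  ultimately show "X \<in> upper_central_series (nf1 0 v C G) (Suc 1) \<longleftrightarrow>
     X \<in> {X. \<forall>i\<in>(if C = 0 then {1,2,5} else {1,2,4,5}). X $ i = 0}"
    unfolding upper_central_series.simps(2)[of _ 1] nf1_ucs1[OF disjI2[OF assms]] mem_Collect_eq by blast
qed

lemma nf10_ucs3:
  assumes "G \<noteq> 0"
  shows "upper_central_series (nf1 0 v C G) (Suc (Suc 1)) = {X. \<forall>i\<in>(if v = 0 then {} else {1,2}). X $ i = 0}"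
proof (intro set_eqI)
  fix X :: "real^8"
  have "(v \<noteq> 0 \<longrightarrow> X $ 1 = 0 \<and> X $ 2 = 0)"
    if *: "\<And>Y. \<forall>i\<in>(if C = 0 then {1,2,5} else {1,2,4,5}). nf1 0 v C G X Y $ i = 0"
      using *[of "axis 1 1"] *[of "axis 2 1"] assms
      by (auto simp: nf1_def ce_bracket_def axis_def algebra_simps split: if_splits)
  then show "X \<in> upper_central_series (nf1 0 v C G) (Suc (Suc 1)) \<longleftrightarrow>
     X \<in> {X. \<forall>i\<in>(if v = 0 then {} else {1,2}). X $ i = 0}"
    unfolding upper_central_series.simps(2)[of _ "Suc 1"] nf10_ucs2[OF assms]
    by (auto simp: nf1_def ce_bracket_def)
qed

lemma nf2_ucs1:
  assumes "m \<noteq> 0 \<or> H \<noteq> 0"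
  shows "upper_central_series (nf2 m v H C h) 1 = {X. \<forall>i\<in>{1,2,3,4,5,6,7}. X $ i = 0}"
proof (intro set_eqI)
  fix X :: "real^8"
  have "X $ 1 = 0 \<and> X $ 2 = 0 \<and> X $ 3 = 0 \<and> X $ 4 = 0 \<and> X $ 5 = 0 \<and> X $ 6 = 0 \<and> X $ 7 = 0"
    if *: "\<And>Y. nf2 m v H C h X Y = 0"
  proof -
    have 1: "X $ 1 = 0" "X $ 2 = 0" "X $ 3 = 0"
      using *[of "axis 6 1"] *[of "axis 7 1"] *[of "axis 1 1"]
      by (simp_all add: nf2_def ce_bracket_def vec8_eq_iff axis_def)
    then show ?thesis
      using *[of "axis 1 1"] *[of "axis 2 1"] *[of "axis 3 1"] *[of "axis 4 1"] *[of "axis 5 1"] assms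
      by (auto simp add: nf2_def ce_bracket_def vec8_eq_iff axis_def)
  qed
  then show "X \<in> upper_central_series (nf2 m v H C h) 1 \<longleftrightarrow> X \<in> {X. \<forall>i\<in>{1,2,3,4,5,6,7}. X $ i = 0}"
    by (auto simp: nf2_def ce_bracket_def vec8_eq_iff)
qed

lemma nf2_ucs2:
  assumes "m \<noteq> 0 \<or> H \<noteq> 0"
  shows "upper_central_series (nf2 m v H C h) (Suc 1) = {X. \<forall>i\<in>{1,2,3,4,5}. X $ i = 0}"
proof (intro set_eqI)
  fix X :: "real^8"
  have "X $ 1 = 0 \<and> X $ 2 = 0 \<and> X $ 3 = 0 \<and> X $ 4 = 0 \<and> X $ 5 = 0"
    if *: "\<And>Y. \<forall>i\<in>{1,2,3,4,5,6,7}. nf2 m v H C h X Y $ i = 0"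
  proof -
    have 1: "X $ 1 = 0" "X $ 2 = 0" "X $ 3 = 0"
      using *[of "axis 3 1"] *[of "axis 1 1"] by (simp_all add: nf2_def ce_bracket_def axis_def)
    then show ?thesis
      using *[of "axis 1 1"] *[of "axis 2 1"] *[of "axis 3 1"] assms
      by (auto simp add: nf2_def ce_bracket_def axis_def)
  qed
  then have "(\<forall>Y. \<forall>i\<in>{1,2,3,4,5,6,7}. nf2 m v H C h X Y $ i = 0) \<Longrightarrow>
      (\<forall>i\<in>{1,2,3,4,5}. X $ i = 0)"
    by simp
  moreover have "(\<forall>i\<in>{1,2,3,4,5}. X $ i = 0) \<Longrightarrow> (\<forall>Y. \<forall>i\<in>{1,2,3,4,5,6,7}.
      nf2 m v H C h X Y $ i = 0)"
    by (auto simp: nf2_def ce_bracket_def)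
  ultimately show "X \<in> upper_central_series (nf2 m v H C h) (Suc 1) \<longleftrightarrow> X \<in> {X.
      \<forall>i\<in>{1,2,3,4,5}. X $ i = 0}"
    unfolding upper_central_series.simps(2)[of _ 1] nf2_ucs1[OF assms] mem_Collect_eq by blast
qed

lemma nf2_ucs3:
  assumes "m \<noteq> 0 \<or> H \<noteq> 0"
  shows "upper_central_series (nf2 m v H C h) (Suc (Suc 1)) = {X. \<forall>i\<in>{1,2,3}. X $ i = 0}"
proof (intro set_eqI)
  fix X :: "real^8"
  have "X $ 1 = 0 \<and> X $ 2 = 0 \<and> X $ 3 = 0"
    if *: "\<And>Y. \<forall>i\<in>{1,2,3,4,5}. nf2 m v H C h X Y $ i = 0"
    using *[of "axis 3 1"] *[of "axis 1 1"] by (simp_all add: nf2_def ce_bracket_def axis_def)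
  then show "X \<in> upper_central_series (nf2 m v H C h) (Suc (Suc 1)) \<longleftrightarrow> X \<in> {X.
      \<forall>i\<in>{1,2,3}. X $ i = 0}"
    unfolding upper_central_series.simps(2)[of _ "Suc 1"] nf2_ucs2[OF assms]
    by (auto simp: nf2_def ce_bracket_def)
qed

text \<open>The unknowns are the entries of the matrix of an isomorphism that are not forced to vanish by the upper
  central series.\<close>

lemma nf1_iso_equations:
  assumes "lie_isomorphic (nf1 1 v C G) (nf1 1 v' C' G')"
  obtains p q s t x3 x4 x5 y3 y4 y5 z3 z4 z5 a b c d k where
    "k \<noteq> 0"
    "a = p * z5 + p * x5 + (1 + G' * C' / 2) * s * y5"
    "c = s * z5 + (1 - G' * C' / 2) * p * y5 - s * x5"
    "b = q * z5 + q * x5 + (1 + G' * C' / 2) * t * y5"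
    "d = t * z5 + (1 - G' * C' / 2) * q * y5 - t * x5"
    "a = p * z3 + p * x3 + (1 + G' * C' / 2) * s * y3"
    "c = s * z3 + (1 - G' * C' / 2) * p * y3 - s * x3"
    "- b = q * z3 + q * x3 + (1 + G' * C' / 2) * t * y3"
    "- d = t * z3 + (1 - G' * C' / 2) * q * y3 - t * x3"
    "(1 - G * C / 2) * b = p * z4 + p * x4 + (1 + G' * C' / 2) * s * y4"
    "(1 - G * C / 2) * d = s * z4 + (1 - G' * C' / 2) * p * y4 - s * x4"
    "(1 + G * C / 2) * a = q * z4 + q * x4 + (1 + G' * C' / 2) * t * y4"
    "(1 + G * C / 2) * c = t * z4 + (1 - G' * C' / 2) * q * y4 - t * x4"
    "k = p * a + s * c" "0 = p * b + s * d" "0 = q * a + t * c" "k = q * b + t * d"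
    "G * k = G' * (x3 * y4 - y3 * x4)" "0 = G' * (x3 * y5 - y3 * x5)" "0 = G' * (x4 * y5 - y4 * x5)"
    "C * x3 + v * x5 = C' * (p * t - q * s)" "C * y3 + v * y5 = 0"
    "C * z3 + v * z5 = v' * (p * t - q * s)"
proof -
  let ?br = "nf1 1 v C G" and ?br' = "nf1 1 v' C' G'"
  obtain f where f: "linear f" "bij f" "\<And>X Y. f (?br X Y) = ?br' (f X) (f Y)"
    using assms unfolding lie_isomorphic_def by blast
  note z = upper_central_series_image[where br = ?br and br' = ?br' and f = f, OF f]
  define A where "A i = f (axis i 1)" for i
  have A8: "A 8 $ i = 0" if "i \<in> {1,2,3,4,5,6,7}" for i
    using z[of "axis 8 1" 1] that unfolding nf1_ucs1[OF disjI1[OF one_neq_zero]] A_def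
    by (auto simp: axis_def)
  have A67: "A 6 $ i = 0" "A 7 $ i = 0" if "i \<in> {1,2,3,4,5}" for i
    using z[of "axis 6 1" "Suc 1"] z[of "axis 7 1" "Suc 1"] that unfolding nf1_ucs2 A_def
    by (auto simp: axis_def)
  \<comment> \<open>The upper central series does not confine the third to fifth basis vectors well
    enough. They also lie in the centralizer of its second term, which every isomorphism
    preserves.\<close>
  have cent: "f X $ 1 = 0" "f X $ 2 = 0" if X: "X $ 1 = 0" "X $ 2 = 0" for X
  proof -
    have "?br' (f X) Y = 0" if "Y \<in> upper_central_series ?br' (Suc 1)" for Y
    proof -
      obtain Y' where Y': "Y = f Y'" using f(2) by (metis bij_is_surj surjD)
      then have "Y' \<in> upper_central_series ?br (Suc 1)" using that z by blast
      then have "?br X Y' = 0" using X unfolding nf1_ucs2 by (simp add: nf1_def ce_bracket_def vec8_eq_iff)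
      then show ?thesis using f(3)[of X Y'] Y' f(1) by (simp add: linear_0)
    qed
    from this[of "axis 6 1"] this[of "axis 7 1"] show "f X $ 1 = 0" "f X $ 2 = 0"
      unfolding nf1_ucs2 by (auto simp: nf1_def ce_bracket_def vec8_eq_iff axis_def)
  qed
  have A345: "A i $ 1 = 0" "A i $ 2 = 0" if "i \<in> {3,4,5}" for i
    using cent[of "axis i 1"] that by (auto simp: A_def axis_def)
  note zeros = A345 A67 A8
  have br: "?br (axis 1 1) (axis 5 1) = - axis 6 1" "?br (axis 2 1) (axis 5 1) = - axis 7 1"
    "?br (axis 1 1) (axis 3 1) = - axis 6 1" "?br (axis 2 1) (axis 3 1) = axis 7 1"
    "?br (axis 1 1) (axis 4 1) = - (1 - G * C / 2) *\<^sub>R axis 7 1"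
    "?br (axis 2 1) (axis 4 1) = - (1 + G * C / 2) *\<^sub>R axis 6 1"
    "?br (axis 1 1) (axis 6 1) = - axis 8 1" "?br (axis 1 1) (axis 7 1) = 0"
    "?br (axis 2 1) (axis 6 1) = 0" "?br (axis 2 1) (axis 7 1) = - axis 8 1"
    "?br (axis 3 1) (axis 4 1) = - G *\<^sub>R axis 8 1" "?br (axis 3 1) (axis 5 1) = 0"
    "?br (axis 4 1) (axis 5 1) = 0"
    "?br (axis 1 1) (axis 2 1) = - C *\<^sub>R axis 3 1 - v *\<^sub>R axis 5 1"
    by (simp_all add: nf1_def ce_bracket_def vec8_eq_iff axis_def)
  note lin = linear_neg[OF f(1)] linear_scale[OF f(1)] linear_diff[OF f(1)] linear_0[OF f(1)]
  note e = br[THEN arg_cong[of _ _ f], unfolded f(3) lin, folded A_def]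
  have A8n: "A 8 $ 8 \<noteq> 0"
  proof
    assume "A 8 $ 8 = 0"
    then have "A 8 = 0" using A8 by (simp add: vec8_eq_iff)
    then have "(axis 8 1 :: real^8) = 0" unfolding A_def using f(1,2) by (metis bij_is_inj injD linear_0)
    then show False by simp
  qed
  have z3: "A 3 $ 1 = 0" "A 3 $ 2 = 0" "A 4 $ 1 = 0" "A 4 $ 2 = 0" "A 5 $ 1 = 0" "A 5 $ 2 = 0"
    and z6: "A 6 $ 1 = 0" "A 6 $ 2 = 0" "A 6 $ 3 = 0" "A 6 $ 4 = 0" "A 6 $ 5 = 0"
      "A 7 $ 1 = 0" "A 7 $ 2 = 0" "A 7 $ 3 = 0" "A 7 $ 4 = 0" "A 7 $ 5 = 0"
    and z8: "A 8 $ 1 = 0" "A 8 $ 2 = 0" "A 8 $ 3 = 0" "A 8 $ 4 = 0" "A 8 $ 5 = 0" "A 8 $ 6 = 0" "A 8 $ 7 = 0"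
    by (simp_all add: A345 A67 A8)
  have c: "x = y \<Longrightarrow> x $ i = y $ i" for x y :: "real^8" and i by simp
  note s = nf1_def ce_bracket_def z3 z6 z8 algebra_simps
  show thesis
    \<comment> \<open>The witnesses stand in the order in which the unknowns occur in the equations.
      \<open>p, s\<close> and \<open>q, t\<close> are the first two coordinates of the images of
      basis vectors 1 and 2; \<open>x, y, z\<close> with index i are coordinates 3, 4, 5 of the
      image of vector i; \<open>a, c\<close> and \<open>b, d\<close> are coordinates 6, 7 for
      vectors 6 and 7.\<close>
    apply (rule that[of "A 8 $ 8" "A 6 $ 6" "A 1 $ 1" "A 5 $ 5" "A 5 $ 3" "A 1 $ 2" "A 5 $ 4" "A 6 $ 7" "A 7 $ 6" "A 2
        $ 1" "A 2 $ 2" "A 7 $ 7" "A 3 $ 5" "A 3 $ 3" "A 3 $ 4" "A 4 $ 5" "A 4 $ 3" "A 4 $ 4"])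
    subgoal by (fact A8n)
    subgoal using c[OF e(1), of 6] by (simp add: s)
    subgoal using c[OF e(1), of 7] by (simp add: s)
    subgoal using c[OF e(2), of 6] by (simp add: s)
    subgoal using c[OF e(2), of 7] by (simp add: s)
    subgoal using c[OF e(3), of 6] by (simp add: s)
    subgoal using c[OF e(3), of 7] by (simp add: s)
    subgoal using c[OF e(4), of 6] by (simp add: s)
    subgoal using c[OF e(4), of 7] by (simp add: s)
    subgoal using c[OF e(5), of 6] by (simp add: s)
    subgoal using c[OF e(5), of 7] by (simp add: s)
    subgoal using c[OF e(6), of 6] by (simp add: s)
    subgoal using c[OF e(6), of 7] by (simp add: s)
    subgoal using c[OF e(7), of 8] by (simp add: s)
    subgoal using c[OF e(8), of 8] by (simp add: s)
    subgoal using c[OF e(9), of 8] by (simp add: s)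
    subgoal using c[OF e(10), of 8] by (simp add: s)
    subgoal using c[OF e(11), of 8] by (simp add: s)
    subgoal using c[OF e(12), of 8] by (simp add: s)
    subgoal using c[OF e(13), of 8] by (simp add: s)
    subgoal using c[OF e(14), of 3] by (simp add: s)
    subgoal using c[OF e(14), of 4] by (simp add: s)
    subgoal using c[OF e(14), of 5] by (simp add: s)
    done
qed

section \<open>Invariants of the first family\<close>

lemma nf1_iso_G:
  assumes "lie_isomorphic (nf1 1 v C G) (nf1 1 v' C' G')" "G' = 0"
  shows "G = 0"
  using assms(1) by (rule nf1_iso_equations) (use assms(2) in auto)

text \<open>\<open>v\<^sup>2 - C\<^sup>2\<close> is the determinant of
  \<open>diag (v + C, v - C)\<close>. An isomorphism changes this matrix by a congruence and a
  scalar, so the determinant is multiplied by a square and vanishing of the matrix is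
  preserved.\<close>

lemma nf1_iso_det:
  assumes "lie_isomorphic (nf1 1 v C 0) (nf1 1 v' C' 0)"
  obtains l where "l > 0" "(v'\<^sup>2 - C'\<^sup>2) * l = v\<^sup>2 - C\<^sup>2" "v' = 0 \<and> C' = 0
      \<Longrightarrow> v = 0 \<and> C = 0"
  using assms
proof (rule nf1_iso_equations, goal_cases)
  case (1 p q s t x3 x4 x5 y3 y4 y5 z3 z4 z5 a b c d k)
  note k = 1(2) and e = 1(3-10) and w = 1(15-18) and u = 1(22-24)
  define D where "D = p * t - q * s"
  \<comment> \<open>By \<open>w\<close> the block of \<open>a, b, c, d\<close> is \<open>k\<close>
    times the inverse of the block of \<open>p, s, q, t\<close>.\<close>
  have aD: "a * D = k * t" "b * D = - k * s" "c * D = - k * q" "d * D = k * p"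
    using w unfolding D_def by algebra+
  have "k * k = D * (a * d - b * c)" using w unfolding D_def by algebra
  then have D: "D \<noteq> 0" using k by auto
  define P M where "P = v + C" and "M = v - C"
  have D2: "(z5 + x5) * D\<^sup>2 = k * (t\<^sup>2 + s\<^sup>2)" "y5 * D\<^sup>2 = - k * (p * s + q * t)" "(z5 - x5) *
      D\<^sup>2 = k * (p\<^sup>2 + q\<^sup>2)"
    "(z3 + x3) * D\<^sup>2 = k * (t\<^sup>2 - s\<^sup>2)" "y3 * D\<^sup>2 = k * (p * s - q * t)" "(z3 - x3) * D\<^sup>2
        = k * (q\<^sup>2 - p\<^sup>2)"
    using e aD unfolding D_def by algebra+
  have "(v' + C') * D = C * (z3 + x3) + v * (z5 + x5)" "(v' - C') * D = C * (z3 - x3) + v * (z5 - x5)"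
    using u unfolding D_def by algebra+
  \<comment> \<open>Together: the new matrix is \<open>k / D^3\<close> times the congruence of
    \<open>diag (P, M)\<close> by the matrix with rows \<open>(t, s)\<close> and
    \<open>(q, p)\<close>, whose determinant is \<open>D\<close>.\<close>
  then have *: "(v' + C') * D^3 = k * (P * t\<^sup>2 + M * s\<^sup>2)" "(v' - C') * D^3 = k * (P * q\<^sup>2 + M * p\<^sup>2)"
    "0 = k * (M * p * s + P * q * t)"
    using D2 u(2) unfolding P_def M_def by algebra+
  then have 3: "M * p * s + P * q * t = 0" using k by simp
  have "((v' + C') * D^3) * ((v' - C') * D^3) = k\<^sup>2 * (P * M * D\<^sup>2)"
    using *(1,2) 3 unfolding D_def by algebra
  then have "D\<^sup>2 * (((v')\<^sup>2 - C'\<^sup>2) * D^4) = D\<^sup>2 * (k\<^sup>2 * (P * M))" by algebra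
  then have 4: "((v')\<^sup>2 - C'\<^sup>2) * D^4 = k\<^sup>2 * (P * M)" using D by simp
  show ?thesis
  proof (rule that)
    show "D^4 / k\<^sup>2 > 0" using D k by simp
    show "((v')\<^sup>2 - C'\<^sup>2) * (D^4 / k\<^sup>2) = v\<^sup>2 - C\<^sup>2"
      using 4 k by (simp add: P_def M_def field_simps power2_eq_square)
    assume "v' = 0 \<and> C' = 0"
    then have "P * t\<^sup>2 + M * s\<^sup>2 = 0" "P * q\<^sup>2 + M * p\<^sup>2 = 0" using * k by simp_all
    then have "P * D\<^sup>2 = 0" "M * D\<^sup>2 = 0" using 3 unfolding D_def by algebra+
    then show "v = 0 \<and> C = 0" using D by (simp add: P_def M_def)
  qed
qed

text \<open>For nonzero \<open>G\<close> the freedom is no larger than that of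
  \<open>nf1_scale\<close> and \<open>nf1_negate_C\<close>: rescaling keeps both products, and only
  the sign of \<open>C * G\<close> can change.\<close>

lemma nf1_iso_products:
  assumes "lie_isomorphic (nf1 1 v C G) (nf1 1 v' C' G')" "G \<noteq> 0" "G' \<noteq> 0"
  shows "v * G = v' * G'" "(C * G)\<^sup>2 = (C' * G')\<^sup>2"
proof -
  have "v * G = v' * G' \<and> (C * G = C' * G' \<or> C * G = - (C' * G'))"
    using assms(1)
  proof (rule nf1_iso_equations, goal_cases)
    case (1 p q s t x3 x4 x5 y3 y4 y5 z3 z4 r a b c d k)
    note k = 1(1) and e = 1(2-5) and e3 = 1(6-9) and e4 = 1(10-13) and w = 1(14-17) and g = 1(18-20) and u = 1(21-23)
    define D n where "D = p * t - q * s" and "n = p\<^sup>2 + s\<^sup>2"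
    \<comment> \<open>\<open>(x3, y3)\<close> and \<open>(x4, y4)\<close> are independent while
      \<open>(x5, y5)\<close> is parallel to both, so \<open>x5\<close> and \<open>y5\<close>
      vanish; \<open>r\<close> is the remaining coordinate \<open>z5\<close>.\<close>
    have "x3 * y4 - y3 * x4 \<noteq> 0" "x3 * y5 = y3 * x5" "x4 * y5 = y4 * x5" using g k assms(2,3) by auto
    moreover from this(2,3) have "x5 * (x3 * y4 - y3 * x4) = 0" "y5 * (x3 * y4 - y3 * x4) = 0" by algebra+
    ultimately have 5: "x5 = 0" "y5 = 0" by simp_all
    have B: "a = p * r" "b = q * r" "c = s * r" "d = t * r" using e 5 by simp_all
    have kn: "k = r * n" using w(1) B unfolding n_def by algebra
    then have r: "r \<noteq> 0" and n: "n \<noteq> 0" using k by auto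
    have "r * (p * q + s * t) = 0" "r * (q\<^sup>2 + t\<^sup>2) = r * n" using w(2,4) B kn by algebra+
    \<comment> \<open>The images of the first two basis vectors are orthogonal of equal length in
      the first two coordinates, so that block is a similarity.\<close>
    then have O: "p * q + s * t = 0" "q\<^sup>2 + t\<^sup>2 = n" using r by simp_all
    have D2: "D\<^sup>2 = n\<^sup>2" using O unfolding D_def n_def by algebra
    then have D: "D \<noteq> 0" using n by auto
    have pD: "p * D = n * t" "q * D = - (n * s)" using O unfolding D_def n_def by algebra+
    have "D\<^sup>2 * p\<^sup>2 = D\<^sup>2 * t\<^sup>2" "D\<^sup>2 * q\<^sup>2 = D\<^sup>2 * s\<^sup>2" using pD D2 by algebra+
    then have sq: "p\<^sup>2 = t\<^sup>2" "q\<^sup>2 = s\<^sup>2" using D by simp_all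
    have Du: "C * x3 = C' * D" "C * y3 = 0" "C * z3 + v * r = v' * D" using u 5 unfolding D_def by simp_all
    have main: "v * G = v' * G'" if "G * D = G' * r" "C * z3 = 0"
    proof -
      have "D * (v * G) = D * (v' * G')" using that Du(3) by algebra
      then show ?thesis using D by simp
    qed
    show "v * G = v' * G' \<and> (C * G = C' * G' \<or> C * G = - (C' * G'))"
    proof (cases "C = 0")
      case True
      then have C': "C' = 0" using Du(1) D by simp
      have X: "(z3 + x3) * D = r * (p * t + q * s)" "(z3 - x3) * D = - r * (p * t + q * s)" "y3 * D = - 2 * p * q * r"
        "y4 * D = r * (p\<^sup>2 - q\<^sup>2)" "(z4 + x4) * D = r * (t * q - s * p)" "(z4 - x4) * D = - r * (q * t - p * s)"
        using e3 e4 B True C' unfolding D_def by algebra+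
      have "2 * (x3 * D) = 2 * (r * (p * t + q * s))" "2 * (x4 * D) = 2 * (r * (q * t - p * s))" using X by algebra+
      then have X34: "x3 * D = r * (p * t + q * s)" "x4 * D = r * (q * t - p * s)" by linarith+
      have "D * (D * (x3 * y4 - y3 * x4)) = r\<^sup>2 * ((p\<^sup>2 + q\<^sup>2) * D)"
        using X34 X(3,4) unfolding D_def by algebra
      also have "\<dots> = D * (r\<^sup>2 * n)" using sq(2) by (simp add: n_def)
      finally have "D * (x3 * y4 - y3 * x4) = r\<^sup>2 * n" using D unfolding mult_cancel_left by blast
      then have "(r * n) * (G * D) = (r * n) * (G' * r)" using g(1) kn by algebra
      then have "G * D = G' * r" using r n by simp
      then show ?thesis using main True C' by simp
    next
      case False
      then have y3: "y3 = 0" using Du(2) by simp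
      \<comment> \<open>These relations make the block diagonal if \<open>p\<close> is nonzero and
        antidiagonal otherwise; the two cases give the two signs of \<open>C * G\<close>.\<close>
      have Z: "p * (z3 + x3 - r) = 0" "s * (z3 - x3 - r) = 0" "q * (z3 + x3 + r) = 0" "t * (z3 - x3 + r) = 0"
        using e3 B y3 by algebra+
      have gx: "r * n * G = G' * (x3 * y4)" using g(1) kn y3 by algebra
      show ?thesis
      proof (cases "p = 0")
        case False
        then have "t \<noteq> 0" using sq by auto
        then have zx: "z3 = 0" "x3 = r" using Z(1,4) False by auto
        then have qs: "s = 0" "q = 0" using Z(2,3) r by auto
        have "2 * (r * p\<^sup>2) = 2 * (p * t * y4)" using e4(2,3) B qs sq by algebra
        then have "p * (p * r) = p * (t * y4)" by (auto simp: power2_eq_square mult.commute)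
        then have yt: "p * r = t * y4" using False by auto
        have "(r * n) * (G * D) = (r * n) * (G' * r)"
          using gx yt zx sq qs unfolding D_def n_def by algebra
        then have GD: "G * D = G' * r" using r n by simp
        have "D * (C * G) = D * (C' * G')" using Du(1) GD zx by algebra
        then show ?thesis using main GD zx D by simp
      next
        case True
        then have "t = 0" "s \<noteq> 0" "q \<noteq> 0" using sq n by (auto simp: n_def)
        then have zx: "z3 = 0" "x3 = - r" using Z(2,3) by auto
        have "2 * (r * (q * s)) = 2 * (s\<^sup>2 * y4)" using e4(1,4) B True \<open>t = 0\<close> sq by algebra
        then have "s * (q * r) = s * (s * y4)" by (auto simp: power2_eq_square mult.commute)
        then have yt: "q * r = s * y4" using \<open>s \<noteq> 0\<close> by auto
        have "(r * n) * (G * D) = (r * n) * (G' * r)"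
          using gx yt zx sq True \<open>t = 0\<close> unfolding D_def n_def by algebra
        then have GD: "G * D = G' * r" using r n by simp
        have "D * (C * G) = D * (- (C' * G'))" using Du(1) GD zx by algebra
        then have "C * G = - (C' * G')" using D unfolding mult_cancel_left by blast
        then show ?thesis using main GD zx by simp
      qed
    qed
  qed
  then show "v * G = v' * G'" "(C * G)\<^sup>2 = (C' * G')\<^sup>2" by auto
qed

section \<open>Matrix equations and invariants of the second family\<close>

lemma nf2_iso_equations:
  assumes "lie_isomorphic (nf2 m v H C h) (nf2 m' v' H' C' h')" "m \<noteq> 0 \<or> H \<noteq> 0" "m' \<noteq> 0 \<or> H' \<noteq> 0"
  obtains a3 a4 a5 a6 a7 b3 b4 b5 b6 b7 k6 k7 k8 p q r s t x1 x2 y1 y2 y3 y4 y5 z1 z2 z3 z4 z5 where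
    "k8 \<noteq> 0"
    "v * r = v' * (p * t - s * q)"
    "v * y3 = (p * x2 - x1 * q)"
    "v * z3 = (s * x2 - x1 * t)"
    "v * a3 + C * a7 = H' * (p * y2 - y1 * q) + H' * (s * z2 - z1 * t) + (- m') * (x1 * z2 - z1 * x2)"
    "v * b3 + C * b7 = C' * (p * t - s * q) + H' * (p * z2 - z1 * q) + H' * (s * y2 - y1 * t) + m' * (x1 * y2 - y1 * x2)"
    "y4 = (p * r)"
    "z4 = (s * r)"
    "a4 = H' * (p * y3) + H' * (s * z3) + (- m') * (x1 * z3 - z1 * r)"
    "b4 = H' * (p * z3) + H' * (s * y3) + m' * (x1 * y3 - y1 * r)"
    "y5 = (q * r)"
    "z5 = (t * r)"
    "a5 = H' * (q * y3) + H' * (t * z3) + (- m') * (x2 * z3 - z2 * r)"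
    "b5 = H' * (q * z3) + H' * (t * y3) + m' * (x2 * y3 - y2 * r)"
    "H * a6 = H' * (p * y4) + H' * (s * z4) + (- m') * (x1 * z4)"
    "H * b6 = H' * (p * z4) + H' * (s * y4) + m' * (x1 * y4)"
    "H * k6 = (p * a4) + (s * b4) + (- m') * (y1 * z4 - z1 * y4) + h' * (s * z4) + (h' * m' / 2) * (x1 * z4)"
    "H * a7 = H' * (p * y5) + H' * (s * z5) + (- m') * (x1 * z5)"
    "H * b7 = H' * (p * z5) + H' * (s * y5) + m' * (x1 * y5)"
    "H * k7 = (p * a5) + (s * b5) + (- m') * (y1 * z5 - z1 * y5) + h' * (s * z5) + (h' * m' / 2) * (x1 * z5)"
    "H * a7 = H' * (q * y4) + H' * (t * z4) + (- m') * (x2 * z4)"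
    "H * b7 = H' * (q * z4) + H' * (t * y4) + m' * (x2 * y4)"
    "H * k7 = (q * a4) + (t * b4) + (- m') * (y2 * z4 - z2 * y4) + h' * (t * z4) + (h' * m' / 2) * (x2 * z4)"
    "H * a6 = H' * (q * y5) + H' * (t * z5) + (- m') * (x2 * z5)"
    "H * b6 = H' * (q * z5) + H' * (t * y5) + m' * (x2 * y5)"
    "H * k6 + h * k8 = (q * a5) + (t * b5) + (- m') * (y2 * z5 - z2 * y5) + h' * (t * z5) + (h' * m' / 2) * (x2 * z5)"
    "m * a7 = (- m') * (r * z4)"
    "m * b7 = m' * (r * y4)"
    "m * k7 = (- m') * (y3 * z4 - z3 * y4) + (h' * m' / 2) * (r * z4)"
    "(- m) * a6 = (- m') * (r * z5)"
    "(- m) * b6 = m' * (r * y5)"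
    "(- m) * k6 + (h * m / 2) * k8 = (- m') * (y3 * z5 - z3 * y5) + (h' * m' / 2) * (r * z5)"
    "k8 = (p * a6) + (s * b6)"
    "0 = (p * a7) + (s * b7)"
    "0 = (q * a6) + (t * b6)"
    "k8 = (q * a7) + (t * b7)"
    "(- m) * k8 = (- m') * (y4 * z5 - z4 * y5)"
proof -
  let ?br = "nf2 m v H C h" and ?br' = "nf2 m' v' H' C' h'"
  obtain f where f: "linear f" "bij f" "\<And>X Y. f (?br X Y) = ?br' (f X) (f Y)"
    using assms unfolding lie_isomorphic_def by blast
  note z = upper_central_series_image[where br = ?br and br' = ?br' and f = f, OF f]
  define A where "A i = f (axis i 1)" for i
  have A8: "A 8 $ i = 0" if "i \<in> {1,2,3,4,5,6,7}" for i
    using z[of "axis 8 1" 1] that unfolding nf2_ucs1[OF assms(2)] nf2_ucs1[OF assms(3)] A_def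
    by (auto simp: axis_def)
  have A67: "A 6 $ i = 0" "A 7 $ i = 0" if "i \<in> {1,2,3,4,5}" for i
    using z[of "axis 6 1" "Suc 1"] z[of "axis 7 1" "Suc 1"] that
    unfolding nf2_ucs2[OF assms(2)] nf2_ucs2[OF assms(3)] A_def
    by (auto simp: axis_def)
  have A45: "A 4 $ i = 0" "A 5 $ i = 0" if "i \<in> {1,2,3}" for i
    using z[of "axis 4 1" "Suc (Suc 1)"] z[of "axis 5 1" "Suc (Suc 1)"] that
    unfolding nf2_ucs3[OF assms(2)] nf2_ucs3[OF assms(3)] A_def
    by (auto simp: axis_def)
  \<comment> \<open>Again by centralizers: the third basis vector commutes with the second term of
    the upper central series.\<close>
  have A3: "A 3 $ 1 = 0" "A 3 $ 2 = 0"
  proof -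
    have "?br' (A 3) Y = 0" if "Y \<in> upper_central_series ?br' (Suc 1)" for Y
    proof -
      obtain Y' where Y': "Y = f Y'" using f(2) by (metis bij_is_surj surjD)
      then have "Y' \<in> upper_central_series ?br (Suc 1)" using that z by blast
      then have "?br (axis 3 1) Y' = 0"
        unfolding nf2_ucs2[OF assms(2)] by (simp add: nf2_def ce_bracket_def vec8_eq_iff axis_def)
      then show ?thesis using f(3)[of "axis 3 1" Y'] Y' f(1) by (simp add: linear_0 A_def)
    qed
    from this[of "axis 6 1"] this[of "axis 7 1"] show "A 3 $ 1 = 0" "A 3 $ 2 = 0"
      unfolding nf2_ucs2[OF assms(3)] by (auto simp: nf2_def ce_bracket_def vec8_eq_iff axis_def)
  qed

  have br: "?br (axis 1 1) (axis 2 1) = - ((v) *\<^sub>R axis 3 1 + (C) *\<^sub>R axis 7 1)"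
    "?br (axis 1 1) (axis 3 1) = - (axis 4 1)"
    "?br (axis 2 1) (axis 3 1) = - (axis 5 1)"
    "?br (axis 1 1) (axis 4 1) = - ((H) *\<^sub>R axis 6 1)"
    "?br (axis 1 1) (axis 5 1) = - ((H) *\<^sub>R axis 7 1)"
    "?br (axis 2 1) (axis 4 1) = - ((H) *\<^sub>R axis 7 1)"
    "?br (axis 2 1) (axis 5 1) = - ((H) *\<^sub>R axis 6 1 + (h) *\<^sub>R axis 8 1)"
    "?br (axis 3 1) (axis 4 1) = - ((m) *\<^sub>R axis 7 1)"
    "?br (axis 3 1) (axis 5 1) = - ((- m) *\<^sub>R axis 6 1 + (h * m / 2) *\<^sub>R axis 8 1)"
    "?br (axis 1 1) (axis 6 1) = - (axis 8 1)"
    "?br (axis 1 1) (axis 7 1) = 0"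
    "?br (axis 2 1) (axis 6 1) = 0"
    "?br (axis 2 1) (axis 7 1) = - (axis 8 1)"
    "?br (axis 4 1) (axis 5 1) = - ((- m) *\<^sub>R axis 8 1)"
    by (simp_all add: nf2_def ce_bracket_def vec8_eq_iff axis_def)
  note lin = linear_neg[OF f(1)] linear_scale[OF f(1)] linear_add[OF f(1)] linear_0[OF f(1)]
  note e = br[THEN arg_cong[of _ _ f], unfolded f(3) lin, folded A_def]
  have A8n: "A 8 $ 8 \<noteq> 0"
  proof
    assume "A 8 $ 8 = 0"
    then have "A 8 = 0" using A8 by (simp add: vec8_eq_iff)
    then have "(axis 8 1 :: real^8) = 0" unfolding A_def using f(1,2) by (metis bij_is_inj injD linear_0)
    then show False by simp
  qed
  have zs: "A 4 $ 1 = 0" "A 4 $ 2 = 0" "A 4 $ 3 = 0" "A 5 $ 1 = 0" "A 5 $ 2 = 0" "A 5 $ 3 = 0" "A 6 $ 1 = 0" "A 6 $ 2 =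
      0" "A 6 $ 3 = 0" "A 6 $ 4 = 0" "A 6 $ 5 = 0" "A 7 $ 1 = 0" "A 7 $ 2 = 0" "A 7 $ 3 = 0" "A 7 $ 4 = 0" "A 7 $ 5 =
      0" "A 8 $ 1 = 0" "A 8 $ 2 = 0" "A 8 $ 3 = 0" "A 8 $ 4 = 0" "A 8 $ 5 = 0" "A 8 $ 6 = 0" "A 8 $ 7 = 0"
    by (simp_all add: A45 A67 A8)
  have c: "x = y \<Longrightarrow> x $ i = y $ i" for x y :: "real^8" and i by simp
  note s = nf2_def ce_bracket_def A3 zs algebra_simps
  show thesis
    \<comment> \<open>In the names \<open>x, y, z, a, b, k\<close> stand for coordinates 3 to 8 and
      the digit for the basis vector whose image is taken; \<open>p, s\<close> and
      \<open>q, t\<close> are coordinates 1, 2 for vectors 1 and 2, and \<open>r\<close> is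
      coordinate 3 for vector 3.\<close>
    apply (rule that[of "A 8 $ 8" "A 3 $ 3" "A 1 $ 1" "A 2 $ 2" "A 1 $ 2" "A 2 $ 1" "A 3 $ 4" "A 2 $ 3" "A 1 $ 3" "A 3
        $ 5" "A 3 $ 6" "A 7 $ 6" "A 2 $ 4" "A 1 $ 4" "A 2 $ 5" "A 1 $ 5" "A 3 $ 7" "A 7 $ 7" "A 4 $ 4" "A 4 $ 5" "A 4 $
        6" "A 4 $ 7" "A 5 $ 4" "A 5 $ 5" "A 5 $ 6" "A 5 $ 7" "A 6 $ 6" "A 6 $ 7" "A 6 $ 8" "A 7 $ 8"])
    subgoal by (fact A8n)
    subgoal using c[OF e(1), of 3] by (simp add: s)
    subgoal using c[OF e(1), of 4] by (simp add: s)
    subgoal using c[OF e(1), of 5] by (simp add: s)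
    subgoal using c[OF e(1), of 6] by (simp add: s)
    subgoal using c[OF e(1), of 7] by (simp add: s)
    subgoal using c[OF e(2), of 4] by (simp add: s)
    subgoal using c[OF e(2), of 5] by (simp add: s)
    subgoal using c[OF e(2), of 6] by (simp add: s)
    subgoal using c[OF e(2), of 7] by (simp add: s)
    subgoal using c[OF e(3), of 4] by (simp add: s)
    subgoal using c[OF e(3), of 5] by (simp add: s)
    subgoal using c[OF e(3), of 6] by (simp add: s)
    subgoal using c[OF e(3), of 7] by (simp add: s)
    subgoal using c[OF e(4), of 6] by (simp add: s)
    subgoal using c[OF e(4), of 7] by (simp add: s)
    subgoal using c[OF e(4), of 8] by (simp add: s)
    subgoal using c[OF e(5), of 6] by (simp add: s)
    subgoal using c[OF e(5), of 7] by (simp add: s)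
    subgoal using c[OF e(5), of 8] by (simp add: s)
    subgoal using c[OF e(6), of 6] by (simp add: s)
    subgoal using c[OF e(6), of 7] by (simp add: s)
    subgoal using c[OF e(6), of 8] by (simp add: s)
    subgoal using c[OF e(7), of 6] by (simp add: s)
    subgoal using c[OF e(7), of 7] by (simp add: s)
    subgoal using c[OF e(7), of 8] by (simp add: s)
    subgoal using c[OF e(8), of 6] by (simp add: s)
    subgoal using c[OF e(8), of 7] by (simp add: s)
    subgoal using c[OF e(8), of 8] by (simp add: s)
    subgoal using c[OF e(9), of 6] by (simp add: s)
    subgoal using c[OF e(9), of 7] by (simp add: s)
    subgoal using c[OF e(9), of 8] by (simp add: s)
    subgoal using c[OF e(10), of 8] by (simp add: s)
    subgoal using c[OF e(11), of 8] by (simp add: s)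
    subgoal using c[OF e(12), of 8] by (simp add: s)
    subgoal using c[OF e(13), of 8] by (simp add: s)
    subgoal using c[OF e(14), of 8] by (simp add: s)
    done
qed

lemma nf2_iso_m:
  assumes "lie_isomorphic (nf2 m v H C h) (nf2 m' v' H' C' h')" "m \<noteq> 0 \<or> H \<noteq> 0" "m' \<noteq> 0 \<or> H' \<noteq> 0"
    and "m' = 0"
  shows "m = 0"
  using assms(1-3)
proof (rule nf2_iso_equations, goal_cases)
  case 1
  \<comment> \<open>For \<open>m' = 0\<close> the last equation reads
    \<open>m * k8 = 0\<close>.\<close>
  then show ?case using assms(4) by auto
qed

text \<open>The equations force \<open>q = s = 0\<close> and \<open>p * p = t * t\<close>. Then
  \<open>v * r = v' * (p * t)\<close>, and the only other contribution to \<open>h * k8\<close>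
  carries the factor \<open>t * t - p * p\<close>.\<close>

lemma nf2_iso_v_h:
  assumes "lie_isomorphic (nf2 0 v 1 0 h) (nf2 0 v' 1 0 h')"
  shows "v' = 0 \<Longrightarrow> v = 0" "h' = 0 \<Longrightarrow> h = 0"
proof -
  have "(v' = 0 \<longrightarrow> v = 0) \<and> (h' = 0 \<longrightarrow> h = 0)"
    using assms
  proof (rule nf2_iso_equations, goal_cases)
    case (3 a3 a4 a5 a6 a7 b3 b4 b5 b6 b7 k6 k7 k8 p q r s t x1 x2 y1 y2 y3 y4 y5 z1 z2 z3 z4 z5)
    note k8 = 3(1) and v = 3(2) and y = 3(7-8,11-12) and a = 3(15-16,18-19,24-25) and k = 3(33-36) and c = 3(9-10,13-14,17,26)
    have r: "r \<noteq> 0" using y a(1,2) k(1) k8 by auto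
    have "r * (q * (q\<^sup>2 + 3 * t\<^sup>2)) = 0" using k(3) a(5,6) y by (simp add: algebra_simps power2_eq_square)
    then have "q = 0 \<or> q\<^sup>2 + 3 * t\<^sup>2 = 0" using r by simp
    then have q: "q = 0" by (smt (verit) zero_le_power2 power2_eq_iff zero_eq_power2)
    have t: "t \<noteq> 0" using q k(4) k8 a(3,4) y by auto
    have "r * (2 * p * s * t) = 0" using k(2) a(3,4) y q by (simp add: algebra_simps)
    then have "p = 0 \<or> s = 0" using r t by simp
    moreover have "p \<noteq> 0" using a(3,4) y q k(4) k8 by auto
    ultimately have s: "s = 0" by simp
    have "r * (p * p) = r * (t * t)" using a(1,5) y q s by simp
    then have pt: "p * p = t * t" using r by simp
    have "v * r = v' * (p * t)" using v q by simp
    then have "v' = 0 \<longrightarrow> v = 0" using r by auto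
    moreover have "h * k8 = h' * (t * t * r) + (t * t - p * p) * y3"
      using c y q s by (simp add: algebra_simps)
    then have "h' = 0 \<longrightarrow> h = 0" using k8 pt by auto
    ultimately show ?thesis by simp
  qed auto
  then show "v' = 0 \<Longrightarrow> v = 0" "h' = 0 \<Longrightarrow> h = 0" by auto
qed

lemma nf2_iso_H:
  assumes "lie_isomorphic (nf2 1 0 H C h) (nf2 1 0 0 C' h')"
  shows "H = 0" "C' = 0 \<Longrightarrow> C = 0"
proof -
  have "H = 0 \<and> (C' = 0 \<longrightarrow> C = 0)"
    using assms
  proof (rule nf2_iso_equations, goal_cases)
    case (3 a3 a4 a5 a6 a7 b3 b4 b5 b6 b7 k6 k7 k8 p q r s t x1 x2 y1 y2 y3 y4 y5 z1 z2 z3 z4 z5)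
    note k8 = 3(1) and y = 3(7-8,11-12) and a = 3(15-16,18-19,21-22,24-25) and m = 3(27-28,30-31) and k = 3(33,37) and c = 3(5-6)
    have kd: "k8 = r * r * (p * t - s * q)" using k(2) y by (simp add: algebra_simps)
    then have r: "r \<noteq> 0" and d: "p * t - s * q \<noteq> 0" using k8 by auto
    \<comment> \<open>The pairs of basis vectors (1,5) and (2,4) have the same bracket; equating the
      two images gives these relations.\<close>
    have "r * (x1 * t) = r * (x2 * s)" "r * (x1 * q) = r * (x2 * p)"
      using a(3-6) y by (auto simp: algebra_simps)
    then have x: "x1 * t = x2 * s" "x1 * q = x2 * p" using r by simp_all
    have "x1 * (p * t - s * q) = 0" "x2 * (p * t - s * q) = 0" using x by algebra+
    then have x1: "x1 = 0" and x2: "x2 = 0" using d by simp_all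
    have "H * k8 = 0" using a(1,2) x1 k(1) by auto
    moreover have "C = 0" if "C' = 0"
    proof -
      have "C * (r * r * s) = 0" "C * (r * r * p) = 0"
        using c m y x1 x2 that by (auto simp: algebra_simps)
      moreover have "p \<noteq> 0 \<or> s \<noteq> 0" using d by auto
      ultimately show ?thesis using r by auto
    qed
    ultimately show ?thesis using k8 by simp
  qed auto
  then show "H = 0" "C' = 0 \<Longrightarrow> C = 0" by auto
qed

text \<open>Only the rescalings with \<open>b = a\<close> or \<open>b = - a\<close> used in
  \<open>nf2_G11\<close> remain possible. Hence for a common nonzero \<open>h\<close> one has
  \<open>p = 1\<close> and \<open>t\<close> is 1 or -1, and the absolute value of \<open>C\<close>
  is invariant.\<close>

lemma nf2_iso_C_h:
  assumes "lie_isomorphic (nf2 1 0 1 C h) (nf2 1 0 1 C' h')"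
  obtains p t where "t \<noteq> 0" "p * p = t * t" "C' = t * C" "h' = p * h"
  using assms
proof (rule nf2_iso_equations, goal_cases)
  case (3 a3 a4 a5 a6 a7 b3 b4 b5 b6 b7 k6 k7 k8 p q r s t x1 x2 y1 y2 y3 y4 y5 z1 z2 z3 z4 z5)
  note k8 = 3(2) and y = 3(8-9,12-13) and c = 3(6-7,10-11,14-15) and e1 = 3(16) and e2 = 3(17) and e3 = 3(19) and e4 =
      3(20) and e5 = 3(22) and e6 = 3(23) and e7 = 3(25) and e8 = 3(26) and m = 3(28-29,31-32) and k = 3(34,38) and g = 3(18,27,21,30,33)
  have kd: "k8 = r * r * (p * t - s * q)" using k(2) y by (simp add: algebra_simps)
  then have r: "r \<noteq> 0" and d: "p * t - s * q \<noteq> 0" using k8 by auto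
  have "r * (x1 * t) = r * (x2 * s)" "r * (x1 * q) = r * (x2 * p)"
    using e3 e5 e4 e6 unfolding y by algebra+
  then have x: "x1 * t = x2 * s" "x1 * q = x2 * p" using r by simp_all
  have "x1 * (p * t - s * q) = 0" "x2 * (p * t - s * q) = 0" using x by algebra+
  then have x1: "x1 = 0" and x2: "x2 = 0" using d by simp_all
  have "r * (r * t) = r * (p * p + s * s)" "r * (- r * q) = r * (2 * p * s)" "r * (r * p) = r * (p * t + s * q)"
    "r * (r * t) = r * (q * q + t * t)" "r * (- r * q) = r * (2 * q * t)"
    using e1 e2 e4 e7 e8 m x1 x2 unfolding y by algebra+
  then have f: "r * t = p * p + s * s" "- r * q = 2 * p * s" "r * p = p * t + s * q"
    "r * t = q * q + t * t" "- r * q = 2 * q * t"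
    using r unfolding mult_cancel_left by auto
  have t: "t \<noteq> 0" using f(1) d by (auto simp: add_nonneg_eq_0_iff)
  have "q * (p * p + s * s + 2 * (t * t)) = t * (r * q) + 2 * q * (t * t)" using f(1) by (simp add: algebra_simps)
  also have "\<dots> = 0" using f(5) by algebra
  finally have q: "q = 0" using t by (auto simp: add_nonneg_eq_0_iff)
  then have p: "p \<noteq> 0" using d by auto
  then have s: "s = 0" using f(2) q by simp
  have pt: "p * p = t * t" using f(1,4) q s by simp
  have rt: "r = t" using f(3) s p by simp
  have K: "k8 = t * t * (p * t)" using kd q s rt by simp
  have c1: "p * y2 = t * z1" using c(1) q s x1 x2 m(1) y by simp
  then have "t * (p * z1) = t * (t * y2)" using pt by algebra
  then have z1: "p * z1 = t * y2" using t by simp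
  have k6: "k6 = t * t * y3 + 2 * (t * t * y2)" "k6 + h * k8 = t * t * y3 - 2 * (t * t * y2) + h' * t^3"
    "- k6 + h / 2 * k8 = - (t * t * y3) + h' / 2 * t^3"
    using g(1,2,5) c(3,6) q s x1 x2 pt z1 unfolding y rt by algebra+
  have "t ^ 3 * (h * p) = t^3 * h'" using k6 K by algebra
  then have hp: "h' = p * h" using t by auto
  have "t * p * z2 = t * (t * y1)" using g(3,4) c(5) q s x1 x2 pt unfolding y rt by algebra
  then have "p * z2 = t * y1" using t by simp
  then have "p * t * (t * C) = p * t * C'" using c(2) m(2) q s x1 x2 unfolding y rt by algebra
  then have "C' = t * C" using p t by simp
  then show ?thesis using that t pt hp by blast
qed auto

section \<open>Pairwise non-isomorphism of the list\<close>

lemma G3_iso: "g \<in> {0, 1} \<Longrightarrow> lie_isomorphic (nf1 1 g 1 0) (algebra_bracket (G3 g))"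
  using nf1_G3_0 nf1_G3_1[of 1] by (auto simp del: algebra_bracket.simps)

lemma G4_iso:
  assumes "a \<noteq> 0" "b \<ge> 0"
  shows "lie_isomorphic (nf1 1 (b * (2 / a)) (2 / a) 1) (algebra_bracket (G4 a b))"
  using nf1_G4[of "2 / a" "b * (2 / a)"] assms by (simp del: algebra_bracket.simps)

lemma G9_iso: "lie_isomorphic (nf2 1 0 0 (- g) 0) (algebra_bracket (G9 g))"
proof (rule lie_isomorphicI)
  let ?w = "\<lambda>X::real^8. vector [X$1, X$2, X$3, X$4, X$5, - X$6, - X$7, - X$8] :: real^8"
  show "linear ?w" by (intro linearI) (simp_all add: vec8_eq_iff algebra_simps)
  show "X = 0" if "?w X = 0" for X using that by (auto simp: vec8_eq_iff)
  show "?w (nf2 1 0 0 (- g) 0 X Y) = algebra_bracket (G9 g) (?w X) (?w Y)" for X Y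
    by (simp add: vec8_eq_iff nf2_def ce_bracket_def algebra_simps)
qed

text \<open>Parameters of a normal form: \<open>Inl\<close> for \<open>nf1\<close>, \<open>Inr\<close> for \<open>nf2\<close>.\<close>

fun normal_form :: "algebra_name \<Rightarrow> (real \<times> real \<times> real \<times> real) + (real \<times> real
    \<times> real \<times> real \<times> real)" where
  "normal_form (G1 g) = Inl (1, 0, 0, g)"
| "normal_form (G2 a) = Inl (1, 1, 0, a)"
| "normal_form (G3 g) = Inl (1, g, 1, 0)"
| "normal_form (G4 a b) = Inl (1, b * (2 / a), 2 / a, 1)"
| "normal_form G5 = Inl (0, 0, 1, 1)"
| "normal_form G6 = Inl (0, 1, 1, 1)"
| "normal_form G7 = Inl (0, 0, 0, 1)"
| "normal_form G8 = Inl (0, 1, 0, 1)"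
| "normal_form (G9 g) = Inr (1, 0, 0, - g, 0)"
| "normal_form (G10 g) = Inr (0, 0, 1, 0, g)"
| "normal_form (G11 a b) = Inr (1, 0, 1, a, - 2 * b)"
| "normal_form (G12 g) = Inr (0, 1, 1, 0, g)"

fun normal_form_bracket where
  "normal_form_bracket (Inl (f, v, C, G)) = nf1 f v C G"
| "normal_form_bracket (Inr (m, v, H, C, h)) = nf2 m v H C h"

lemma normal_form_iso:
  assumes "admissible a"
  shows "lie_isomorphic (normal_form_bracket (normal_form a)) (algebra_bracket a)"
proof (cases a)
  case (G4 x y)
  then have "x \<noteq> 0" "y \<ge> 0" using assms by auto
  then show ?thesis using G4_iso[of x y] G4 by (simp del: algebra_bracket.simps)
qed (use assms nf1_G5_G6[of 1 1 0] nf1_G5_G6[of 1 1 1] lie_isomorphic_refl G3_iso G9_iso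
  in \<open>auto simp: G1_eq G2_eq G7_eq G8_eq G10_eq G11_eq G12_eq simp del: algebra_bracket.simps\<close>)

lemma nf1_dims:
  "dim (upper_central_series (nf1 1 v C G) (Suc 1)) = 3"
  "dim (upper_central_series (nf1 1 v C G) (Suc (Suc 1))) \<ge> 6"
  "dim (upper_central_series (nf1 0 v C 1) (Suc 1)) = (if C = 0 then 5 else 4)"
  "dim (upper_central_series (nf1 0 v C 1) (Suc (Suc 1))) = (if v = 0 then 8 else 6)"
  using dim_subset[OF nf1_ucs3[of v C G]]
  by (simp_all only: nf1_ucs2 nf10_ucs2[OF one_neq_zero] nf10_ucs3[OF one_neq_zero] dim_coordinate_subspace)
     (simp_all add: card_insert_if)

lemma nf2_dims:
  assumes "m \<noteq> 0 \<or> H \<noteq> 0"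
  shows "dim (upper_central_series (nf2 m v H C h) (Suc 1)) = 3"
   "dim (upper_central_series (nf2 m v H C h) (Suc (Suc 1))) = 5"
  unfolding nf2_ucs2[OF assms] nf2_ucs3[OF assms] dim_coordinate_subspace
  by (simp_all add: card_insert_if)

text \<open>The third term of the upper central series has dimension at least 6 against 5 if
  \<open>f = 1\<close>; if \<open>f = 0\<close> the second has dimension 4 or 5 against 3.\<close>

lemma nf1_nf2_not_iso:
  assumes "m \<noteq> 0 \<or> H \<noteq> 0"
  shows "\<not> lie_isomorphic (nf1 1 v C G) (nf2 m v' H C' h)" "\<not> lie_isomorphic (nf1 0 v C 1) (nf2 m v' H C' h)"
  using dim_upper_central_series[of "nf1 1 v C G" "nf2 m v' H C' h" "Suc (Suc 1)"]
    dim_upper_central_series[of "nf1 0 v C 1" "nf2 m v' H C' h" "Suc 1"]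
    nf1_dims(1,2)[of v C G] nf1_dims(3,4)[of v C] nf2_dims[OF assms]
  by (auto split: if_splits)

lemma nf10_nf1_not_iso: "\<not> lie_isomorphic (nf1 0 v C 1) (nf1 1 v' C' G)"
  using dim_upper_central_series[of "nf1 0 v C 1" "nf1 1 v' C' G" "Suc 1"]
    nf1_dims(3,4)[of v C] nf1_dims(1)[of v' C' G]
  by (auto split: if_splits)

lemma nf10_iso:
  assumes "lie_isomorphic (nf1 0 v C 1) (nf1 0 v' C' 1)"
  shows "(C = 0 \<longleftrightarrow> C' = 0) \<and> (v = 0 \<longleftrightarrow> v' = 0)"
  using dim_upper_central_series[OF assms, of "Suc 1"] dim_upper_central_series[OF assms, of "Suc (Suc 1)"]
    nf1_dims(3,4)[of v C] nf1_dims(3,4)[of v' C']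
  by (auto split: if_splits)

lemma nf1_iso:
  assumes "lie_isomorphic (nf1 1 v C G) (nf1 1 v' C' G')"
  shows "(G = 0 \<longleftrightarrow> G' = 0) \<and> (G \<noteq> 0 \<longrightarrow> v * G = v' * G' \<and> (C *
      G)\<^sup>2 = (C' * G')\<^sup>2) \<and>
    (G = 0 \<longrightarrow> sgn (v\<^sup>2 - C\<^sup>2) = sgn (v'\<^sup>2 - C'\<^sup>2) \<and> (v = 0 \<and> C = 0
        \<longleftrightarrow> v' = 0 \<and> C' = 0))"
proof (intro conjI impI)
  show g: "G = 0 \<longleftrightarrow> G' = 0" using nf1_iso_G assms lie_isomorphic_sym by metis
  show "v * G = v' * G'" "(C * G)\<^sup>2 = (C' * G')\<^sup>2" if "G \<noteq> 0"
    using nf1_iso_products[OF assms] that g by auto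
  assume "G = 0"
  then have i: "lie_isomorphic (nf1 1 v C 0) (nf1 1 v' C' 0)" using g assms by simp
  then show "v = 0 \<and> C = 0 \<longleftrightarrow> v' = 0 \<and> C' = 0"
    using nf1_iso_det lie_isomorphic_sym[OF i] by metis
  show "sgn (v\<^sup>2 - C\<^sup>2) = sgn (v'\<^sup>2 - C'\<^sup>2)"
    using nf1_iso_det[OF i] by (metis mult.right_neutral sgn_mult sgn_pos)
qed

lemma nf2_iso:
  assumes "lie_isomorphic (nf2 m v H C h) (nf2 m' v' H' C' h')" "m \<noteq> 0 \<or> H \<noteq> 0" "m' \<noteq> 0 \<or> H' \<noteq> 0"
  shows "m = 0 \<longleftrightarrow> m' = 0"
  using nf2_iso_m[OF assms] nf2_iso_m[OF lie_isomorphic_sym[OF assms(1)] assms(3,2)] by auto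

lemma nf2_iso_0:
  assumes "lie_isomorphic (nf2 0 v 1 0 h) (nf2 0 v' 1 0 h')"
  shows "(v = 0 \<longleftrightarrow> v' = 0) \<and> (h = 0 \<longleftrightarrow> h' = 0)"
  using nf2_iso_v_h[OF assms] nf2_iso_v_h[OF lie_isomorphic_sym[OF assms]] by auto

lemma nf2_iso_00:
  assumes "lie_isomorphic (nf2 1 0 0 C h) (nf2 1 0 0 C' h')"
  shows "C = 0 \<longleftrightarrow> C' = 0"
  using nf2_iso_H[OF assms] nf2_iso_H[OF lie_isomorphic_sym[OF assms]] by auto

lemma nf2_iso_11:
  assumes "lie_isomorphic (nf2 1 0 1 C h) (nf2 1 0 1 C' h')"
  shows "(C = 0 \<longleftrightarrow> C' = 0) \<and> (h = 0 \<longleftrightarrow> h' = 0) \<and> (h = h' \<and> h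
      \<noteq> 0 \<longrightarrow> \<bar>C\<bar> = \<bar>C'\<bar>)"
proof -
  obtain p t where "t \<noteq> 0" "p * p = t * t" "C' = t * C" "h' = p * h"
    using nf2_iso_C_h[OF assms] .
  moreover from this have "p = t \<or> p = - t" by algebra
  ultimately show ?thesis by (auto simp: abs_mult)
qed

lemma normal_form_cases:
  assumes "admissible a"
  obtains (nf1) v C G where "normal_form a = Inl (1, v, C, G)"
    "a = G1 G \<and> v = 0 \<and> C = 0 \<and> G \<in> {0, 1} \<or> a = G2 G \<and> v = 1 \<and> C = 0 \<or>
     a = G3 v \<and> v \<in> {0, 1} \<and> C = 1 \<and> G = 0 \<or>
     a = G4 (2 / C) (v / C) \<and> G = 1 \<and> (v * C > 0 \<or> v = 0 \<and> C > 0)"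
  | (nf10) v C where "normal_form a = Inl (0, v, C, 1)"
    "a = (if C = 0 then if v = 0 then G7 else G8 else if v = 0 then G5 else G6)"
  | (nf2) m v H C h where "normal_form a = Inr (m, v, H, C, h)" "m \<noteq> 0 \<or> H \<noteq> 0"
    "a = G9 (- C) \<and> m = 1 \<and> v = 0 \<and> H = 0 \<and> C \<in> {0, - 1} \<and> h = 0 \<or>
     a = (if v = 0 then G10 h else G12 h) \<and> m = 0 \<and> v \<in> {0, 1} \<and> H = 1 \<and> C = 0 \<and> h \<in> {0, 1} \<or>
     a = G11 C (- h / 2) \<and> m = 1 \<and> v = 0 \<and> H = 1 \<and> ((C, h) \<in> {(0, 0), (1, 0), (0, - 2)} \<or> C > 0 \<and> h = - 2)"
proof (cases a)
  case (G4 x y)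
  then have x: "x \<noteq> 0" and xy: "y > 0 \<or> y = 0 \<and> x > 0" using assms by auto
  have "(2 / x) * (2 / x) > 0" using x by (auto simp: zero_less_mult_iff linorder_neq_iff)
  then have "y * (2 / x) * (2 / x) > 0 \<or> y * (2 / x) = 0 \<and> 2 / x > 0"
    using xy mult_pos_pos[of y "(2 / x) * (2 / x)"] unfolding mult.assoc by auto
  then show ?thesis using G4 x that(1)[of "y * (2 / x)" "2 / x" 1] by simp
next
  case (G1 x)
  then show ?thesis using assms that(1)[of 0 0 x] by auto
next
  case (G2 x)
  then show ?thesis using assms that(1)[of 1 0 x] by auto
next
  case (G3 x)
  then show ?thesis using assms that(1)[of x 1 0] by auto
next
  case G5
  then show ?thesis using assms that(2)[of 0 1] by auto
next
  case G6
  then show ?thesis using assms that(2)[of 1 1] by auto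
next
  case G7
  then show ?thesis using assms that(2)[of 0 0] by auto
next
  case G8
  then show ?thesis using assms that(2)[of 1 0] by auto
next
  case (G9 x)
  then show ?thesis using assms that(3)[of 1 0 0 "- x" 0] by auto
next
  case (G10 x)
  then show ?thesis using assms that(3)[of 0 0 1 0 x] by auto
next
  case (G11 x y)
  then show ?thesis using assms that(3)[of 1 0 1 x "- 2 * y"] by auto
next
  case (G12 x)
  then show ?thesis using assms that(3)[of 0 1 1 0 x] by auto
qed

lemma algebra_bracket_iso_unique:
  assumes ab: "admissible a" "admissible b"
    and iso: "lie_isomorphic (algebra_bracket a) (algebra_bracket b)"
  shows "a = b"
proof -
  have 1: "lie_isomorphic (normal_form_bracket (normal_form a)) (normal_form_bracket (normal_form b))"
    using iso lie_isomorphic_trans[OF normal_form_iso[OF ab(1)]]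
      lie_isomorphic_sym[OF normal_form_iso[OF ab(2)]] lie_isomorphic_trans by blast
  then have 2: "lie_isomorphic (normal_form_bracket (normal_form b)) (normal_form_bracket (normal_form a))"
    by (rule lie_isomorphic_sym)
  show ?thesis
    using ab(1)
  proof (cases rule: normal_form_cases)
    case a: (nf1 v C G)
    show ?thesis using ab(2)
    proof (cases rule: normal_form_cases)
      case b: (nf1 v' C' G')
      note i = nf1_iso[OF 1[unfolded a(1) b(1) normal_form_bracket.simps]]
      show ?thesis
      proof (cases "a = G4 (2 / C) (v / C) \<and> b = G4 (2 / C') (v' / C')")
        case True
        then have *: "G = 1" "G' = 1" "v * C > 0 \<or> v = 0 \<and> C > 0" "v' * C' > 0 \<or> v' = 0 \<and> C' > 0"
          using a(2) b(2) by auto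
        then have **: "v = v'" "C = C' \<or> C = - C'" using i by (auto simp: power2_eq_iff)
        \<comment> \<open>The parameter range of \<open>G4\<close> fixes the sign of
          \<open>C\<close> by that of \<open>v\<close>, or makes \<open>C\<close> positive if
          \<open>v = 0\<close>; so \<open>C = - C'\<close> is impossible.\<close>
        then have "C = C'" using *(3,4) by (auto simp: zero_less_mult_iff)
        then show ?thesis using True ** by simp
      qed (use a(2) b(2) i in \<open>elim disjE conjE; force\<close>)
    next
      case (nf10 v' C')
      then show ?thesis using 2 a(1) nf10_nf1_not_iso by simp
    next
      case (nf2 m v' H C' h)
      then show ?thesis using 1 a(1) nf1_nf2_not_iso(1) by simp
    qed
  next
    case a: (nf10 v C)
    show ?thesis using ab(2)
    proof (cases rule: normal_form_cases)
      case (nf1 v' C' G')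
      then show ?thesis using 1 a(1) nf10_nf1_not_iso by simp
    next
      case b: (nf10 v' C')
      note i = nf10_iso[OF 1[unfolded a(1) b(1) normal_form_bracket.simps]]
      show ?thesis using i a(2) b(2) by simp
    next
      case (nf2 m v' H C' h)
      then show ?thesis using 1 a(1) nf1_nf2_not_iso(2) by simp
    qed
  next
    case a: (nf2 m v H C h)
    show ?thesis using ab(2)
    proof (cases rule: normal_form_cases)
      case (nf1 v' C' G')
      then show ?thesis using 2 a(1,2) nf1_nf2_not_iso(1) by simp
    next
      case (nf10 v' C')
      then show ?thesis using 2 a(1,2) nf1_nf2_not_iso(2) by simp
    next
      case b: (nf2 m' v' H' C' h')
      note i = 1[unfolded a(1) b(1) normal_form_bracket.simps] 2[unfolded a(1) b(1) normal_form_bracket.simps]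
      have m: "m = 0 \<longleftrightarrow> m' = 0" by (rule nf2_iso[OF i(1) a(2) b(2)])
      show ?thesis
      proof (cases "m = 0")
        case True
        then have "H = 1" "H' = 1" "C = 0" "C' = 0" "m' = 0" using a(3) b(3) m by auto
        then show ?thesis using nf2_iso_0[of v h v' h'] i(1) True a(3) b(3) by auto
      next
        case False
        then have n: "m = 1" "m' = 1" "v = 0" "v' = 0" "H = 0 \<or> H = 1" "H' = 0 \<or> H' = 1"
          using a(3) b(3) m by auto
        note j = i[unfolded n(1-4)]
        have H: "H = H'" using n(5,6) nf2_iso_H(1)[of H C h C' h'] nf2_iso_H(1)[of H' C' h' C h] j by auto
        show ?thesis
        proof (cases "H = 0")
          case True
          then show ?thesis using nf2_iso_00[of C h C' h'] j(1) H a(3) b(3) n by auto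
        next
          case False
          then have "H = 1" using n by simp
          then show ?thesis using nf2_iso_11[of C h C' h'] j(1) H a(3) b(3) n by auto
        qed
      qed
    qed
  qed
qed

section \<open>Complex structures on the algebras of the list\<close>

lemma admissible_complex:
  assumes "admissible a"
  shows "\<exists>J. complex_structure (algebra_bracket a) J"
  using assms
proof (cases rule: normal_form_cases)
  case (nf1 v C G)
  then have "lie_isomorphic (algebra_bracket a) (nf1 1 v C G)"
    using lie_isomorphic_sym[OF normal_form_iso[OF assms]] by simp
  then show ?thesis using complex_structure_transport nf1_complex by blast
next
  case (nf10 v C)
  then have "lie_isomorphic (algebra_bracket a) (nf1 0 v C 1)"
    using lie_isomorphic_sym[OF normal_form_iso[OF assms]] by simp
  then show ?thesis using complex_structure_transport nf1_complex by blast
next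
  case (nf2 m v H C h)
  show ?thesis
  proof (cases "H = 0")
    case True
    then have "a = G9 (- C)" using nf2(3) by auto
    then show ?thesis using G9_complex[of "- C"] by (simp only:)
  next
    case False
    then have "H = 1" "m * v = 0" using nf2(3) by auto
    then have "lie_isomorphic (algebra_bracket a) (nf2c m v C (h / 2))"
      using lie_isomorphic_trans[OF lie_isomorphic_sym[OF normal_form_iso[OF assms]]]
        lie_isomorphic_sym[OF nf2c_iso_nf2[of m v C "h / 2"]] nf2(1) by simp
    then show ?thesis using complex_structure_transport nf2c_complex by blast
  qed
qed

section \<open>Nilpotent operators attached to a complex structure\<close>

lemma nilpotent_scalar:
  fixes u :: "nat \<Rightarrow> complex"
  assumes "\<And>n. u (Suc n) = c * u n" "u N = 0" "u 0 \<noteq> 0"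
  shows "c = 0"
proof -
  have "u n = c ^ n * u 0" for n by (induction n) (simp_all add: assms(1))
  from this[of N] show ?thesis using assms(2,3) by simp
qed

text \<open>By Cayley-Hamilton every orbit satisfies a two-term recursion with trace
  \<open>t\<close> and determinant \<open>e\<close>. For nonzero \<open>e\<close> it runs backwards
  from the vanishing tail to the start; for \<open>e = 0\<close> and nonzero \<open>t\<close> orbits
  are geometric after one step, so the matrix is zero. The index \<open>i\<close> labels orbits, and
  every starting vector occurs.\<close>

lemma nilpotent_2x2:
  fixes u v :: "'i \<Rightarrow> nat \<Rightarrow> complex"
  assumes u: "\<And>i n. u i (Suc n) = a * u i n + b * v i n"
    and v: "\<And>i n. v i (Suc n) = c * u i n + d * v i n"
    and N: "\<And>i n. n \<ge> N i \<Longrightarrow> u i n = 0 \<and> v i n = 0"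
    and s: "\<And>x y. \<exists>i. u i 0 = x \<and> v i 0 = y"
  shows "a + d = 0" "a * d = b * c"
proof -
  define t e where "t = a + d" and "e = a * d - b * c"
  have u2: "u i (Suc (Suc n)) = t * u i (Suc n) - e * u i n" for i n
    by (simp add: u v t_def e_def algebra_simps)
  have v2: "v i (Suc (Suc n)) = t * v i (Suc n) - e * v i n" for i n
    by (simp add: u v t_def e_def algebra_simps)
  have e0: "e = 0"
  proof (rule ccontr)
    assume e: "e \<noteq> 0"
    obtain i where i: "u i 0 = 1" using s by metis
    have "u i (N i - n) = 0 \<and> u i (Suc (N i - n)) = 0" for n
    proof (induction n)
      case (Suc n)
      show ?case
      proof (cases "n < N i")
        case True
        then have *: "Suc (N i - Suc n) = N i - n" by simp
        then have "u i (N i - Suc n) = 0" using Suc u2[of i "N i - Suc n"] e by simp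
        then show ?thesis using * Suc by simp
      qed (use Suc in simp)
    qed (use N[of i "N i"] N[of i "Suc (N i)"] in simp)
    from this[of "N i"] show False using i by simp
  qed
  have t0: "t = 0"
  proof (rule ccontr)
    assume t: "t \<noteq> 0"
    have u1: "u i (Suc n) = t ^ n * u i (Suc 0)" for i n
      by (induction n) (simp_all add: u2 e0)
    have v1: "v i (Suc n) = t ^ n * v i (Suc 0)" for i n
      by (induction n) (simp_all add: v2 e0)
    have "u i (Suc 0) = 0" "v i (Suc 0) = 0" for i
      using u1[of i "N i"] v1[of i "N i"] N[of i "Suc (N i)"] t by auto
    then have z: "a * u i 0 + b * v i 0 = 0" "c * u i 0 + d * v i 0 = 0" for i by (simp_all add: u v)
    obtain i j where "u i 0 = 1" "v i 0 = 0" "u j 0 = 0" "v j 0 = 1" using s by metis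
    then have "a = 0" "d = 0" using z[of i] z[of j] by auto
    then show False using t by (simp add: t_def)
  qed
  show "a + d = 0" "a * d = b * c" using t0 e0 by (simp_all add: t_def e_def)
qed

lemma separating_functional:
  fixes S :: "'a::euclidean_space set"
  assumes "subspace S" "v \<notin> S"
  obtains f :: "'a \<Rightarrow> real" where "linear f" "\<And>x. x \<in> S \<Longrightarrow> f x = 0" "f v = 1"
proof -
  obtain y z where y: "y \<in> span S" and z: "\<And>w. w \<in> span S \<Longrightarrow> orthogonal z w" and v: "v = y + z"
    using orthogonal_subspace_decomp_exists[of S v] by metis
  have S: "span S = S" using assms(1) by (simp add: span_eq_iff)
  have zz: "z \<bullet> z \<noteq> 0" using v y assms(2) S by auto
  show thesis
  proof (rule that)
    show "linear (\<lambda>x. (x \<bullet> z) / (z \<bullet> z))"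
      by (intro linearI) (simp_all add: inner_add_left add_divide_distrib)
    show "x \<bullet> z / (z \<bullet> z) = 0" if "x \<in> S" for x
      using z[of x] that S by (simp add: orthogonal_def inner_commute)
    show "v \<bullet> z / (z \<bullet> z) = 1" using zz z[OF y] v by (simp add: inner_add_left inner_add_right orthogonal_def inner_commute)
  qed
qed

locale lie_complex =
  fixes br :: "'a::euclidean_space \<Rightarrow> 'a \<Rightarrow> 'a" and J :: "'a \<Rightarrow> 'a" and z :: 'a
  assumes lie: "lie_algebra br" and nil: "lie_nilpotent br" and complex: "complex_structure br J"
    and center: "lie_center br = span {z}" and z_nonzero: "z \<noteq> 0" and dim8: "DIM('a) = 8"
begin

lemma bilinear_br: "bilinear br" and br_self [simp]: "br X X = 0"
  and jacobi: "br X (br Y Z) + br Y (br Z X) + br Z (br X Y) = 0"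
  using lie unfolding lie_algebra_def by auto

lemmas br_lin = bilinear_ladd[OF bilinear_br] bilinear_radd[OF bilinear_br]
  bilinear_lmul[OF bilinear_br] bilinear_rmul[OF bilinear_br] bilinear_lneg[OF bilinear_br]
  bilinear_rneg[OF bilinear_br] bilinear_lsub[OF bilinear_br] bilinear_rsub[OF bilinear_br]
  bilinear_lzero[OF bilinear_br] bilinear_rzero[OF bilinear_br]

lemma br_anti: "br Y X = - br X Y"
proof -
  have "br (X + Y) (X + Y) = br X Y + br Y X" unfolding br_lin by simp
  then show ?thesis by (simp add: eq_neg_iff_add_eq_0 add.commute)
qed

lemma linear_J: "linear J" and JJ [simp]: "J (J X) = - X"
  using complex unfolding complex_structure_def by auto

lemmas J_lin = linear_add[OF linear_J] linear_scale[OF linear_J] linear_neg[OF linear_J]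
  linear_diff[OF linear_J] linear_0[OF linear_J]

lemma integrable: "br (J X) (J Y) = br X Y + J (br (J X) Y) + J (br X (J Y))"
  using complex unfolding complex_structure_def by (metis eq_iff_diff_eq_0)

abbreviation "L \<equiv> lower_central_series br"

lemma subspace_L: "subspace (L k)" by (cases k) auto

lemma br_L: "Y \<in> L k \<Longrightarrow> br X Y \<in> L (Suc k)" by (auto intro: span_base)

lemma L_zero: obtains n where "L n = {0}" using nil unfolding lie_nilpotent_def by blast

lemma br_z [simp]: "br z X = 0" "br X z = 0"
proof -
  have "z \<in> lie_center br" using center by (simp add: span_base)
  then show "br z X = 0" by (simp add: lie_center_def)
  then show "br X z = 0" using br_anti[of X z] by simp
qed

lemma central: "(\<And>Y. br X Y = 0) \<Longrightarrow> \<exists>c. X = c *\<^sub>R z"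
  using center by (auto simp: lie_center_def span_singleton)

text \<open>Both operators act on (1,0)-forms through coefficients of the structure equations; by nilpotency the
  traces and determinants of these actions vanish.\<close>

definition M :: "'a \<Rightarrow> 'a \<Rightarrow> 'a" where "M X Y = br X Y - br (J X) (J Y)"
definition N :: "'a \<Rightarrow> 'a \<Rightarrow> 'a" where "N X Y = br X Y + J (br (J X) Y)"

text \<open>\<open>J\<close> need not preserve the lower central series, but integrability turns
  \<open>J (M X Y)\<close> into \<open>br (J X) Y + br X (J Y)\<close>. So the induction carries
  along both the iterate and its image under \<open>J\<close>.\<close>

lemma M_nilpotent: "\<exists>n. \<forall>m\<ge>n. \<forall>Y. (M X ^^ m) Y = 0"
proof -
  obtain n where n: "L n = {0}" by (rule L_zero)
  have *: "(M X ^^ k) Y \<in> L k \<and> J ((M X ^^ k) Y) \<in> L k" for k Y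
  proof (induction k)
    case (Suc k)
    let ?Y = "(M X ^^ k) Y"
    have J: "J (M X ?Y) = br (J X) ?Y + br X (J ?Y)"
      using integrable[of X ?Y] by (simp add: M_def J_lin)
    have "br X ?Y - br (J X) (J ?Y) \<in> L (Suc k)"
      using Suc by (intro subspace_diff[OF subspace_L] br_L) auto
    then have "M X ?Y \<in> L (Suc k)" by (subst M_def)
    moreover have "J (M X ?Y) \<in> L (Suc k)"
      unfolding J using Suc by (intro subspace_add[OF subspace_L] br_L) auto
    ultimately show ?case by simp
  qed auto
  have "(M X ^^ m) Y = 0" if "m \<ge> n" for m Y
  proof -
    have "(M X ^^ m) Y = (M X ^^ n) ((M X ^^ (m - n)) Y)"
      using that by (simp flip: funpow_add comp_apply[of "M X ^^ n"])
    then show ?thesis using *[of n] n by simp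
  qed
  then show ?thesis by blast
qed

lemma N_J: "N X (J Y) = J (N X Y)"
  using integrable[of X "J Y"] by (simp add: N_def J_lin br_lin)

text \<open>As \<open>N X\<close> commutes with \<open>J\<close>, it maps
  \<open>L k + J (L k)\<close> into the next such space, although it does not respect
  \<open>L k\<close> itself.\<close>

lemma N_nilpotent: "\<exists>n. \<forall>m\<ge>n. \<forall>Y. (N X ^^ m) Y = 0"
proof -
  obtain n where n: "L n = {0}" by (rule L_zero)
  have *: "\<exists>a\<in>L k. \<exists>b\<in>L k. (N X ^^ k) Y = a + J b" for k Y
  proof (induction k)
    case 0
    have "Y = Y + J 0" by (simp add: J_lin)
    then show ?case by (metis UNIV_I funpow_0 lower_central_series.simps(1))
  next
    case (Suc k)
    then obtain a b where ab: "a \<in> L k" "b \<in> L k" "(N X ^^ k) Y = a + J b" by blast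
    have "(N X ^^ Suc k) Y = N X a + J (N X b)"
      using ab by (simp add: N_J[symmetric]) (simp add: N_def br_lin J_lin)
    also have "\<dots> = (br X a - br (J X) b) + J (br (J X) a + br X b)"
      by (simp add: N_def J_lin)
    finally show ?case using ab(1,2)
      by (intro bexI[of _ "br X a - br (J X) b"] bexI[of _ "br (J X) a + br X b"])
        (auto simp del: lower_central_series.simps intro!: subspace_diff[OF subspace_L] subspace_add[OF subspace_L] br_L)
  qed
  have "(N X ^^ m) Y = 0" if "m \<ge> n" for m Y
  proof -
    have "(N X ^^ m) Y = (N X ^^ n) ((N X ^^ (m - n)) Y)"
      using that by (simp flip: funpow_add comp_apply[of "N X ^^ n"])
    then show ?thesis using *[of n] n by (auto simp: J_lin)
  qed
  then show ?thesis by blast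
qed

text \<open>Integrability for the pair \<open>(z, X)\<close> says that \<open>D\<close> commutes with \<open>J\<close>.\<close>

definition D :: "'a \<Rightarrow> 'a" where "D X = br (J z) X"

lemma D_J: "D (J X) = J (D X)"
  using integrable[of z X] by (simp add: D_def J_lin)

lemma D_lin: "D (X + Y) = D X + D Y" "D (c *\<^sub>R X) = c *\<^sub>R D X" "D 0 = 0" "D (- X) = - D X" "D (X - Y) = D X - D Y"
  by (simp_all add: D_def br_lin)

lemma D_z [simp]: "D z = 0" "D (J z) = 0"
  by (simp_all add: D_def)

lemma D_derivation: "D (br X Y) = br (D X) Y + br X (D Y)"
proof -
  have "br X (br Y (J z)) = - br X (D Y)" "br Y (br (J z) X) = - br (D X) Y"
    using br_anti[of Y "J z"] br_anti[of "D X" Y] by (simp_all add: D_def br_lin)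
  then show ?thesis using jacobi[of "J z" X Y] by (simp add: D_def algebra_simps)
qed

lemma D_nilpotent: "\<exists>n. \<forall>Y. (D ^^ n) Y = 0"
proof -
  obtain n where n: "L n = {0}" by (rule L_zero)
  have "(D ^^ k) Y \<in> L k" for k Y
    by (induction k) (auto simp: D_def simp del: lower_central_series.simps(2) intro: br_L)
  from this[of n] show ?thesis using n by auto
qed

lemma D_nonzero: "\<exists>X. D X \<noteq> 0"
proof (rule ccontr)
  assume "\<nexists>X. D X \<noteq> 0"
  then obtain c where c: "J z = c *\<^sub>R z" using central[of "J z"] by (auto simp: D_def)
  then have "J (J z) = (c * c) *\<^sub>R z" by (metis J_lin(2) scaleR_scaleR)
  then have "(c * c) *\<^sub>R z = - z" by simp
  then have "(c * c + 1) *\<^sub>R z = 0" unfolding scaleR_left_distrib by simp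
  moreover have "c * c + 1 \<noteq> 0" by (metis add_eq_0_iff not_square_less_zero neg_0_less_iff_less zero_less_one)
  ultimately show False using z_nonzero by simp
qed

text \<open>Otherwise a complex multiple \<open>X'\<close> of \<open>X\<close> satisfies
  \<open>D X' = z\<close>, and then \<open>br (J X')\<close> maps \<open>J z\<close> to
  \<open>- J z\<close>, which is impossible for a nilpotent operator.\<close>

lemma D_range:
  assumes "D X = a *\<^sub>R z + b *\<^sub>R J z"
  shows "D X = 0"
proof (rule ccontr)
  assume *: "D X \<noteq> 0"
  define c where "c = a * a + b * b"
  have c: "c \<noteq> 0" using * assms by (auto simp: c_def add_nonneg_eq_0_iff)
  \<comment> \<open>\<open>X\<close> divided by the complex number with real part \<open>a\<close>
    and imaginary part \<open>b\<close>.\<close>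
  define X' where "X' = (1 / c) *\<^sub>R (a *\<^sub>R X - b *\<^sub>R J X)"
  have "D (a *\<^sub>R X - b *\<^sub>R J X) = c *\<^sub>R z"
    by (simp add: D_lin D_J assms J_lin c_def algebra_simps)
  then have "D X' = z" unfolding X'_def by (simp only: D_lin(2)) (simp add: c)
  then have "br (J X') (J z) = - J z" using D_J[of X'] br_anti[of "J X'" "J z"] by (simp add: D_def)
  then have "(br (J X') ^^ n) (J z) = (-1) ^ n *\<^sub>R J z" for n
    by (induction n) (simp_all add: br_lin)
  moreover have "(br (J X') ^^ n) Y \<in> L n" for n Y
    by (induction n) (auto simp del: lower_central_series.simps(2) intro: br_L)
  moreover obtain n where "L n = {0}" by (rule L_zero)
  ultimately have "(-1 :: real) ^ n *\<^sub>R J z = 0" by (metis singletonD)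
  then have "J z = 0" by simp
  then show False using JJ[of z] z_nonzero by (simp add: J_lin)
qed

end

declare lower_central_series.simps(2) [simp del]

context lie_complex
begin

section \<open>Adapted coframes and their structure equations\<close>

definition scl :: "complex \<Rightarrow> 'a \<Rightarrow> 'a" where "scl c X = Re c *\<^sub>R X + Im c *\<^sub>R J X"

definition form :: "('a \<Rightarrow> complex) \<Rightarrow> bool" where
  "form w \<longleftrightarrow> linear w \<and> (\<forall>X. w (J X) = \<i> * w X)"

lemma form_lin:
  assumes "form w"
  shows "w (X + Y) = w X + w Y" "w (c *\<^sub>R X) = of_real c * w X" "w (- X) = - w X" "w (X - Y) = w X - w Y" "w 0 = 0"
    "w (J X) = \<i> * w X" "w (scl s X) = s * w X"
proof -
  have l: "linear w" and j: "w (J X) = \<i> * w X" for X using assms by (auto simp: form_def)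
  show 1: "w (X + Y) = w X + w Y" "w (c *\<^sub>R X) = of_real c * w X" "w (- X) = - w X" "w (X - Y) = w X - w Y" "w 0 = 0"
    for X Y c
    using l by (simp_all add: linear_add linear_scale linear_neg linear_diff linear_0 scaleR_conv_of_real)
  show "w (J X) = \<i> * w X" by (rule j)
  show "w (scl s X) = s * w X"
    unfolding scl_def 1 j by (subst (3) complex_eq) (simp add: algebra_simps)
qed

lemma form_add: "form v \<Longrightarrow> form w \<Longrightarrow> form (\<lambda>X. v X + w X)"
  and form_mult: "form w \<Longrightarrow> form (\<lambda>X. c * w X)"
  by (auto simp: form_def algebra_simps intro!: linearI simp: linear_add linear_scale)

lemma form_D: "form w \<Longrightarrow> form (\<lambda>X. w (D X))"
  unfolding form_def by (auto simp: D_J D_lin linear_add linear_scale intro!: linearI)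

lemma form_Dn: "form w \<Longrightarrow> form (\<lambda>X. w ((D ^^ n) X))"
  by (induction n arbitrary: w) (auto dest: form_D)

lemma separating_form:
  assumes "subspace S" "\<And>X. X \<in> S \<Longrightarrow> J X \<in> S" "v \<notin> S"
  obtains w where "form w" "\<And>X. X \<in> S \<Longrightarrow> w X = 0" "w v = 1"
proof -
  obtain f where f: "linear f" "\<And>X. X \<in> S \<Longrightarrow> f X = (0::real)" "f v = 1"
    using separating_functional[OF assms(1,3)] by metis
  \<comment> \<open>The unique complex linear form with real part \<open>f\<close>.\<close>
  define w where "w X = Complex (f X) (- f (J X))" for X
  have w: "form w"
    unfolding form_def w_def using f(1)
    by (auto intro!: linearI simp: complex_eq_iff linear_add linear_scale J_lin linear_neg)
  have "w v \<noteq> 0" using f(3) by (simp add: w_def complex_eq_iff)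
  show thesis
  proof (rule that)
    show "form (\<lambda>X. (1 / w v) * w X)" by (rule form_mult[OF w])
    show "(1 / w v) * w X = 0" if "X \<in> S" for X
      using f(2)[OF that] f(2)[OF assms(2)[OF that]] by (simp add: w_def Complex_eq)
    show "(1 / w v) * w v = 1" using \<open>w v \<noteq> 0\<close> by simp
  qed
qed

text \<open>Since \<open>w4 (J z) = 1\<close>, the parts \<open>Re (w4 X)\<close> and
  \<open>- Im (w4 X)\<close> are the coefficients of \<open>J z\<close> and \<open>z\<close> in
  \<open>X\<close>. Joint surjectivity replaces linear independence; in dimension 8 it makes the
  four forms coordinates.\<close>

definition coframe where
  "coframe w1 w2 w3 w4 \<longleftrightarrow> form w1 \<and> form w2 \<and> form w3 \<and> form w4 \<and>
     w1 z = 0 \<and> w2 z = 0 \<and> w3 z = 0 \<and> w4 z = - \<i> \<and> (\<forall>X. w4 (D X) = 0) \<and>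
     (\<forall>a b c d. \<exists>X. w1 X = a \<and> w2 X = b \<and> w3 X = c \<and> w4 X = d)"

lemma coframe_inj:
  assumes "coframe w1 w2 w3 w4" "w1 X = 0" "w2 X = 0" "w3 X = 0" "w4 X = 0"
  shows "X = 0"
proof -
  let ?f = "\<lambda>X. (w1 X, w2 X, w3 X, w4 X)"
  have l: "linear w1" "linear w2" "linear w3" "linear w4" using assms(1) by (auto simp: coframe_def form_def)
  then have f: "linear ?f" by (auto intro!: linearI simp: linear_add linear_scale)
  have "surj ?f" unfolding surj_def using assms(1) unfolding coframe_def by (metis prod.collapse)
  moreover have "DIM(complex \<times> complex \<times> complex \<times> complex) = DIM('a)" by (simp add: dim8)
  ultimately have "inj ?f" using linear_surjective_imp_injective[OF f] by simp
  moreover have "?f X = ?f 0" using assms l by (simp add: linear_0)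
  ultimately show ?thesis by (rule injD)
qed

lemma subspace_range_D: "subspace (range D)"
proof (rule subspaceI)
  show "0 \<in> range D" using D_lin(3) by (intro range_eqI[of _ _ 0]) simp
  show "x + y \<in> range D" if "x \<in> range D" "y \<in> range D" for x y
    using that by (auto simp flip: D_lin(1))
  show "c *\<^sub>R x \<in> range D" if "x \<in> range D" for c x
    using that by (auto simp flip: D_lin(2))
qed

lemma fourth_form:
  obtains w4 where "form w4" "w4 z = - \<i>" "\<And>X. w4 (D X) = 0"
proof -
  have "J X \<in> range D" if "X \<in> range D" for X using that by (auto simp flip: D_J)
  moreover have "z \<notin> range D"
  proof
    assume "z \<in> range D"
    then obtain X where "z = D X" by auto
    then show False using D_range[of X 1 0] z_nonzero by simp
  qed
  ultimately obtain w where w: "form w" "\<And>X. X \<in> range D \<Longrightarrow> w X = 0" "w z = 1"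
    using separating_form[OF subspace_range_D] by metis
  show thesis using that[of "\<lambda>X. - \<i> * w X"] form_mult[OF w(1), of "- \<i>"] w(2,3) by simp
qed

lemma plus_J:
  assumes "subspace S"
  defines "P \<equiv> {a + J b | a b. a \<in> S \<and> b \<in> S}"
  shows "subspace P" "x \<in> P \<Longrightarrow> J x \<in> P" "x \<in> S \<Longrightarrow> x \<in> P"
proof -
  have "P = {x + y | x y. x \<in> S \<and> y \<in> J ` S}" unfolding P_def by blast
  then show "subspace P"
    using subspace_sums[OF assms(1) linear_subspace_image[OF linear_J assms(1)]] by simp
  show "J x \<in> P" if x: "x \<in> P"
  proof -
    obtain a b where *: "x = a + J b" "a \<in> S" "b \<in> S" using x unfolding P_def by blast
    then have "J x = (- b) + J a" by (simp add: J_lin)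
    then show ?thesis unfolding P_def using * subspace_neg[OF assms(1)] by blast
  qed
  show "x \<in> P" if "x \<in> S"
  proof -
    have "x = x + J 0" by (simp add: J_lin)
    then show ?thesis unfolding P_def using that subspace_0[OF assms(1)] by blast
  qed
qed

lemma form_on_range_D:
  assumes "D X \<noteq> 0"
  obtains w where "form w" "w z = 0" "w (D X) = 1"
proof -
  let ?S = "{a + J b | a b. a \<in> span {z} \<and> b \<in> span {z}}"
  note S = plus_J[OF subspace_span[of "{z}"]]
  have "D X \<notin> ?S" using D_range[of X] assms by (auto simp: span_singleton J_lin)
  then obtain w where w: "form w" "\<And>X. X \<in> ?S \<Longrightarrow> w X = 0" "w (D X) = 1"
    using S(1,2) by - (rule separating_form, blast+)
  have "z \<in> ?S" by (rule S(3)) (simp add: span_base)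
  then show thesis using that w by blast
qed

lemma coframe_rank2:
  assumes "D (D X) \<noteq> 0"
  obtains w1 w2 w3 w4 where "coframe w1 w2 w3 w4"
    "\<And>X. w3 (D X) = w2 X" "\<And>X. w2 (D X) = w1 X" "\<And>X. w1 (D X) = 0"
proof -
  define n where "n = (LEAST n. \<forall>Y. (D ^^ n) Y = 0)"
  have n: "(D ^^ n) Y = 0" for Y using LeastI_ex[OF D_nilpotent] by (simp add: n_def)
  have D0: "(D ^^ k) 0 = 0" for k by (induction k) (simp_all add: D_lin)
  have "n > 2"
  proof (rule ccontr)
    assume "\<not> n > 2"
    then have "(D ^^ 2) X = (D ^^ (2 - n)) ((D ^^ n) X)"
      by (metis add_diff_inverse_nat add.commute comp_apply funpow_add)
    then show False using assms n D0 by (simp add: numeral_2_eq_2)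
  qed
  then obtain k where k: "n = Suc (Suc (Suc k))" by (metis less_iff_Suc_add add_2_eq_Suc Suc_eq_plus1 add.commute add_Suc_right)
  have "\<not> (\<forall>Y. (D ^^ Suc (Suc k)) Y = 0)" using not_less_Least[of "Suc (Suc k)" "\<lambda>n. \<forall>Y. (D ^^ n) Y = 0"] k
    by (simp add: n_def[symmetric])
  then obtain Y where Y: "D ((D ^^ Suc k) Y) \<noteq> 0" by auto
  obtain w where w: "form w" "w z = 0" "w (D ((D ^^ Suc k) Y)) = 1" using form_on_range_D[OF Y] by metis
  obtain w4 where w4: "form w4" "w4 z = - \<i>" "\<And>X. w4 (D X) = 0" by (metis fourth_form)
  define w1 w2 w3 where "w1 X = w ((D ^^ Suc (Suc k)) X)" and "w2 X = w ((D ^^ Suc k) X)" and "w3 X = w ((D ^^ k) X)" for X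
  have f: "form w1" "form w2" "form w3" unfolding w1_def w2_def w3_def by (rule form_Dn[OF w(1)])+
  have d: "w3 (D X) = w2 X" "w2 (D X) = w1 X" "w1 (D X) = 0" for X
    using n[of X] w(1) unfolding w1_def w2_def w3_def k by (simp_all add: funpow_swap1 form_lin)
  have "(D ^^ m) z = (if m = 0 then z else 0)" for m by (induction m) (auto simp: D_lin)
  then have zz: "w1 z = 0" "w2 z = 0" "w3 z = 0" using w(1,2) by (auto simp: w1_def w2_def w3_def form_lin simp del: funpow.simps)
  have Y1: "w1 Y = 1" using w(3) by (simp add: w1_def)
  have "\<exists>X. w1 X = a \<and> w2 X = b \<and> w3 X = c \<and> w4 X = e" for a b c e
  proof -
    define b' where "b' = b - a * w2 Y"
    define c' where "c' = c - a * w3 Y - b' * w2 Y"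
    define e' where "e' = (e - a * w4 Y) * \<i>"
    let ?X = "scl a Y + scl b' (D Y) + scl c' (D (D Y)) + scl e' z"
    have "w1 ?X = a" "w2 ?X = b" "w3 ?X = c" "w4 ?X = e"
      using f w4 by (simp_all add: form_lin zz d Y1 b'_def c'_def e'_def mult.assoc)
    then show ?thesis by blast
  qed
  then have "coframe w1 w2 w3 w4" using f w4 zz by (simp add: coframe_def)
  then show thesis using that d by blast
qed

text \<open>The last nonzero term of the lower central series is central, hence the line of
  \<open>z\<close>. Consequently closed forms vanish at \<open>z\<close> and are combinations of
  \<open>w1, w2, w3\<close>.\<close>

lemma z_in_derived: "z \<in> span {br X Y | X Y. True}"
proof -
  obtain n where n: "L n = {0}" by (rule L_zero)
  define k where "k = (LEAST k. L (Suc k) = {0})"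
  obtain X where X: "D X \<noteq> 0" using D_nonzero by blast
  have "br (J z) X \<in> L (Suc 0)" by (intro br_L) simp
  then have L1: "L (Suc 0) \<noteq> {0}" using X by (auto simp: D_def)
  have "n \<noteq> 0"
  proof
    assume "n = 0"
    then have "D X \<in> L n" by simp
    then show False using n X by blast
  qed
  then have "L (Suc (n - 1)) = {0}" using n by simp
  then have k: "L (Suc k) = {0}" unfolding k_def by (rule LeastI)
  then have "k \<noteq> 0" using L1 by (intro notI) simp
  then obtain m where m: "k = Suc m" using not0_implies_Suc by blast
  then have "L (Suc m) \<noteq> {0}" using not_less_Least[of m "\<lambda>k. L (Suc k) = {0}"] by (simp add: k_def[symmetric])
  moreover have "0 \<in> L (Suc m)" using subspace_L by (rule subspace_0)
  ultimately obtain y where y: "y \<in> L (Suc m)" "y \<noteq> 0" by blast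
  have "br X y = 0" for X using br_L[OF y(1), of X] k m by (simp)
  then have "br y X = 0" for X using br_anti[of y X] by simp
  then obtain c where c: "y = c *\<^sub>R z" using central by blast
  have "y \<in> span {br X Y | X Y. True}" using y(1) span_mono[of "{br X Y |X Y. Y \<in> L m}" "{br X Y | X Y. True}"]
    by (auto simp: lower_central_series.simps(2))
  then have "(1 / c) *\<^sub>R y \<in> span {br X Y | X Y. True}" by (rule span_scale)
  then show ?thesis using c y(2) by simp
qed

text \<open>Otherwise \<open>L k + J (L k)\<close> would be the whole space for all \<open>k\<close>, by induction.\<close>

lemma derived_plus_J_proper: "\<exists>v. \<nexists>a b. a \<in> L 1 \<and> b \<in> L 1 \<and> v = a + J b"
proof (rule ccontr)
  assume "\<nexists>v. \<nexists>a b. a \<in> L 1 \<and> b \<in> L 1 \<and> v = a + J b"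
  then have all: "\<exists>a b. a \<in> L 1 \<and> b \<in> L 1 \<and> v = a + J b" for v by blast
  let ?P = "\<lambda>k. {a + J b | a b. a \<in> L k \<and> b \<in> L k}"
  note P = plus_J(1)[OF subspace_L] and PJ = plus_J(2)[OF subspace_L] and LP = plus_J(3)[OF subspace_L]
  have U: "?P (Suc k) = UNIV" for k
  proof (induction k)
    case 0
    have "v \<in> ?P (Suc 0)" for v using all[of v] unfolding One_nat_def by blast
    then show ?case by blast
  next
    case (Suc k)
    have "br x y \<in> ?P (Suc (Suc k))" for x y
    proof -
      obtain a b where x: "x = a + J b" "a \<in> L (Suc k)" "b \<in> L (Suc k)" using Suc by blast
      obtain c d where y: "y = c + J d" "c \<in> L (Suc k)" "d \<in> L (Suc k)" using Suc by blast
      have *: "br u v \<in> ?P (Suc (Suc k))" if "u \<in> L (Suc k) \<or> v \<in> L (Suc k)" for u v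
      proof (cases "v \<in> L (Suc k)")
        case True
        then show ?thesis by (intro LP br_L)
      next
        case False
        then have "br v u \<in> ?P (Suc (Suc k))" using that by (intro LP br_L) auto
        from subspace_neg[OF P this] show ?thesis unfolding br_anti[of u v] .
      qed
      \<comment> \<open>\<open>br (J b) (J d)\<close> is the one term without an argument in
        \<open>L (Suc k)\<close>; integrability rewrites it by terms that have one.\<close>
      have e: "br x y = br a c + br a (J d) + br (J b) c + (br b d + J (br (J b) d) + J (br b (J d)))"
        unfolding x y br_lin integrable by simp
      show ?thesis unfolding e by (intro subspace_add[OF P] PJ *) (use x y in simp_all)
    qed
    then have "{br X Y |X Y. Y \<in> L 0} \<subseteq> ?P (Suc (Suc k))" by blast
    from span_minimal[OF this P] have L1: "L 1 \<subseteq> ?P (Suc (Suc k))"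
      unfolding One_nat_def lower_central_series.simps(2)[of br 0] .
    have "v \<in> ?P (Suc (Suc k))" for v
    proof -
      obtain a b where v: "v = a + J b" and a: "a \<in> L 1" and b: "b \<in> L 1" using all[of v] by blast
      from subspace_add[OF P subsetD[OF L1 a] PJ[OF subsetD[OF L1 b]]] show ?thesis unfolding v .
    qed
    then show ?case by blast
  qed
  obtain n where "L n = {0}" by (rule L_zero)
  have "L (Suc n) = {0}"
  proof -
    have "br X Y = 0" if "Y \<in> L n" for X Y using that \<open>L n = {0}\<close> by (simp add: br_lin)
    then have "{br X Y |X Y. Y \<in> L n} \<subseteq> {0}" by auto
    then have "L (Suc n) \<subseteq> {0}"
      unfolding lower_central_series.simps(2) by (rule span_minimal) (rule subspace_single_0)
    then show ?thesis using subspace_0[OF subspace_L] by blast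
  qed
  then have "{a + J b | a b. a \<in> {0} \<and> b \<in> {0}} = UNIV" using U[of n] by simp
  then have "z \<in> {a + J b | a b. a \<in> {0} \<and> b \<in> {0}}" by blast
  then show False using z_nonzero by (simp add: J_lin)
qed

lemma closed_form:
  obtains w where "form w" "\<And>X Y. w (br X Y) = 0" "w z = 0" "\<exists>X. w X \<noteq> 0"
proof -
  obtain v where v: "\<nexists>a b. a \<in> L 1 \<and> b \<in> L 1 \<and> v = a + J b" using derived_plus_J_proper by blast
  let ?S = "{a + J b | a b. a \<in> L 1 \<and> b \<in> L 1}"
  note S = plus_J[OF subspace_L[of 1]]
  have "v \<notin> ?S" using v by blast
  then obtain w where w: "form w" "\<And>X. X \<in> ?S \<Longrightarrow> w X = 0" "w v = 1"
    using S(1,2) by - (rule separating_form, blast+)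
  have L: "w x = 0" if "x \<in> L 1" for x by (rule w(2)[OF S(3)[OF that]])
  have "z \<in> L 1" using z_in_derived by (simp add: lower_central_series.simps(2))
  then have "w z = 0" by (rule L)
  moreover have "w (br X Y) = 0" for X Y using br_L[of Y 0 X] by (intro L) simp
  ultimately show thesis using that[of w] w(1,3) by (metis zero_neq_one)
qed

text \<open>\<open>P\<close> and \<open>Q\<close> are the coefficients of type (2,0) and (1,1).
  Integrability is the absence of a term in \<open>cnj c * cnj d\<close>.\<close>

lemma form_br_scl:
  assumes w: "form w"
  defines "P \<equiv> \<lambda>u v. - \<i> / 2 * (w (br (J u) v) + w (br u (J v)))"
    and "Q \<equiv> \<lambda>u v. (w (br u v) + \<i> * w (br u (J v))) / 2"
  shows "w (br (scl c u) (scl d v)) = P u v * (c * d) + Q u v * (c * cnj d) - Q v u * (d * cnj c)"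
    "P u u = 0" "P v u = - P u v"
proof -
  have e: "w (br (J u) (J v)) = w (br u v) + \<i> * w (br (J u) v) + \<i> * w (br u (J v))" for u v
    unfolding integrable form_lin[OF w] ..
  have a: "w (br v u) = - w (br u v)" for u v using br_anti[of v u] form_lin(3)[OF w] by simp
  obtain c1 c2 d1 d2 where cd: "c = Complex c1 c2" "d = Complex d1 d2" by (metis complex_surj)
  show "w (br (scl c u) (scl d v)) = P u v * (c * d) + Q u v * (c * cnj d) - Q v u * (d * cnj c)"
    unfolding P_def Q_def scl_def br_lin form_lin[OF w] e a[of v u] a[of v "J u"] cd
    by (simp add: complex_eq_iff field_simps)
  show "P u u = 0" "P v u = - P u v"
    unfolding P_def a[of u "J u"] a[of v "J u"] a[of "J v" u] by (simp_all add: algebra_simps)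
qed

text \<open>The general 2-form of type (2,0) + (1,1) in three (1,0)-forms.\<close>

definition Q12 where
  "Q12 A12 A13 A23 B11 B12 B13 B21 B22 B23 B31 B32 B33 x1 x2 x3 y1 y2 y3 =
     A12 * (x1 * y2 - x2 * y1) + A13 * (x1 * y3 - x3 * y1) + A23 * (x2 * y3 - x3 * y2)
     + B11 * (x1 * cnj y1 - y1 * cnj x1) + B12 * (x1 * cnj y2 - y1 * cnj x2) + B13 * (x1 * cnj y3 - y1 * cnj x3)
     + B21 * (x2 * cnj y1 - y2 * cnj x1) + B22 * (x2 * cnj y2 - y2 * cnj x2) + B23 * (x2 * cnj y3 - y2 * cnj x3)
     + B31 * (x3 * cnj y1 - y3 * cnj x1) + B32 * (x3 * cnj y2 - y3 * cnj x2) + B33 * (x3 * cnj y3 - y3 * cnj x3)"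

lemma coframe_vectors:
  assumes "coframe w1 w2 w3 w4"
  obtains E where "\<And>a b c d. w1 (E a b c d) = a" "\<And>a b c d. w2 (E a b c d) = b"
    "\<And>a b c d. w3 (E a b c d) = c" "\<And>a b c d. w4 (E a b c d) = d"
proof -
  have "\<exists>E. \<forall>a b c d. w1 (E a b c d) = a \<and> w2 (E a b c d) = b \<and> w3 (E a b c d) = c \<and> w4 (E a b c d) = d"
    using assms unfolding coframe_def by metis
  then show thesis using that by blast
qed

text \<open>\<open>z\<close> is central and brackets with \<open>J z\<close> are values of
  \<open>D\<close>, so \<open>w4\<close> enters only through its real part and \<open>D\<close>;
  everything else is a 2-form in the first three forms.\<close>

lemma expand:
  fixes w w1 w2 w3 w4 :: "'a \<Rightarrow> complex"
  assumes "coframe w1 w2 w3 w4" and w: "form w"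
  obtains A12 A13 A23 B11 B12 B13 B21 B22 B23 B31 B32 B33 where
    "\<And>X Y. w (br X Y) = Re (w4 X) * w (D Y) - Re (w4 Y) * w (D X)
      + Q12 A12 A13 A23 B11 B12 B13 B21 B22 B23 B31 B32 B33 (w1 X) (w2 X) (w3 X) (w1 Y) (w2 Y) (w3 Y)"
proof -
  have f: "form w1" "form w2" "form w3" "form w4" and zz: "w1 z = 0" "w2 z = 0" "w3 z = 0" "w4 z = - \<i>"
    and s: "\<And>a b c d. \<exists>X. w1 X = a \<and> w2 X = b \<and> w3 X = c \<and> w4 X = d"
    using assms(1) by (auto simp: coframe_def)
  obtain e1 where e1: "w1 e1 = 1" "w2 e1 = 0" "w3 e1 = 0" "w4 e1 = 0" using s by metis
  obtain e2 where e2: "w1 e2 = 0" "w2 e2 = 1" "w3 e2 = 0" "w4 e2 = 0" using s by metis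
  obtain e3 where e3: "w1 e3 = 0" "w2 e3 = 0" "w3 e3 = 1" "w4 e3 = 0" using s by metis
  have X: "X = scl (w1 X) e1 + scl (w2 X) e2 + scl (w3 X) e3 + (Re (w4 X) *\<^sub>R J z - Im (w4 X) *\<^sub>R z)" for X
  proof -
    let ?Y = "scl (w1 X) e1 + scl (w2 X) e2 + scl (w3 X) e3 + (Re (w4 X) *\<^sub>R J z - Im (w4 X) *\<^sub>R z)"
    have "w1 (X - ?Y) = 0" "w2 (X - ?Y) = 0" "w3 (X - ?Y) = 0" "w4 (X - ?Y) = 0"
      using f by (simp_all add: form_lin zz e1 e2 e3 complex_eq_iff)
    then have "X - ?Y = 0" by (rule coframe_inj[OF assms(1)])
    then show ?thesis by simp
  qed
  define V where "V X = scl (w1 X) e1 + scl (w2 X) e2 + scl (w3 X) e3" for X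
  have DV: "D (V X) = D X" for X
    by (subst (2) X) (simp add: D_lin V_def)
  have b: "br X Y = br (V X) (V Y) + Re (w4 X) *\<^sub>R D Y - Re (w4 Y) *\<^sub>R D X" for X Y
  proof -
    have "br X Y = br (V X + (Re (w4 X) *\<^sub>R J z - Im (w4 X) *\<^sub>R z)) (V Y + (Re (w4 Y) *\<^sub>R J z - Im (w4 Y) *\<^sub>R z))"
      using X[of X] X[of Y] by (simp add: V_def)
    also have "\<dots> = br (V X) (V Y) + Re (w4 X) *\<^sub>R D (V Y) + Re (w4 Y) *\<^sub>R br (V X) (J z)"
      unfolding br_lin by (simp add: D_def)
    also have "br (V X) (J z) = - D (V X)" using br_anti[of "V X" "J z"] by (simp add: D_def)
    finally show ?thesis by (simp add: DV)
  qed
  define P where "P u v = - \<i> / 2 * (w (br (J u) v) + w (br u (J v)))" for u v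
  define Q where "Q u v = (w (br u v) + \<i> * w (br u (J v))) / 2" for u v
  note p = form_br_scl[OF w, folded P_def Q_def]
  have "w (br (V X) (V Y)) = Q12 (P e1 e2) (P e1 e3) (P e2 e3) (Q e1 e1) (Q e1 e2) (Q e1 e3) (Q e2 e1) (Q e2 e2) (Q e2
      e3) (Q e3 e1) (Q e3 e2) (Q e3 e3) (w1 X) (w2 X) (w3 X) (w1 Y) (w2 Y) (w3 Y)" for X Y
    unfolding V_def br_lin form_lin[OF w] p(1)
    unfolding p(2) p(3)[of e2 e1] p(3)[of e3 e1] p(3)[of e3 e2]
    by (simp add: Q12_def algebra_simps)
  then have "w (br X Y) = Re (w4 X) * w (D Y) - Re (w4 Y) * w (D X) + Q12 (P e1 e2) (P e1 e3) (P e2 e3) (Q e1 e1) (Q e1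
      e2) (Q e1 e3) (Q e2 e1) (Q e2 e2) (Q e2 e3) (Q e3 e1) (Q e3 e2) (Q e3 e3) (w1 X) (w2 X) (w3 X) (w1 Y) (w2 Y) (w3 Y)" for X Y
    by (subst b) (simp add: form_lin[OF w])
  then show thesis by (rule that)
qed

text \<open>The 2-forms of type \<open>(2,0) + (1,1)\<close> annihilated by \<open>D\<close>, when \<open>D\<close>
    maps \<open>\<omega>\<^sup>3\<close> to \<open>\<omega>\<^sup>1\<close> to \<open>0\<close>
  and kills \<open>\<omega>\<^sup>2\<close>.\<close>

definition Q7 where
  "Q7 A B C E F G H x1 x2 x3 y1 y2 y3 = A * (x1 * y2 - x2 * y1) + B * (x1 * y3 - x3 * y1) + C * (x1 * cnj y1 - y1 * cnj x1)
     + E * (x1 * cnj y2 - y1 * cnj x2) + F * (x2 * cnj y1 - y2 * cnj x1) + G * (x2 * cnj y2 - y2 * cnj x2)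
     + H * (x1 * cnj y3 - y1 * cnj x3 - x3 * cnj y1 + y3 * cnj x1)"

text \<open>The hypothesis \<open>inv\<close>, combined with the derivation property, says that the
  part of the differential without \<open>w4\<close> is annihilated by \<open>D\<close>.\<close>

lemma expand_rank1:
  fixes w w1 w2 w3 w4 :: "'a \<Rightarrow> complex"
  assumes c: "coframe w1 w2 w3 w4" and w: "form w"
    and d: "\<And>X. w1 (D X) = 0" "\<And>X. w2 (D X) = 0" "\<And>X. w3 (D X) = w1 X"
    and inv: "\<And>X Y. w (D (br X Y)) = Re (w4 X) * w (D (D Y)) - Re (w4 Y) * w (D (D X))"
  obtains A B C E F G H where
    "\<And>X Y. w (br X Y) = Re (w4 X) * w (D Y) - Re (w4 Y) * w (D X) + Q7 A B C E F G H (w1 X) (w2 X) (w3 X) (w1 Y) (w2 Y) (w3 Y)"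
proof -
  obtain A12 A13 A23 B11 B12 B13 B21 B22 B23 B31 B32 B33 where
    *: "\<And>X Y. w (br X Y) = Re (w4 X) * w (D Y) - Re (w4 Y) * w (D X)
      + Q12 A12 A13 A23 B11 B12 B13 B21 B22 B23 B31 B32 B33 (w1 X) (w2 X) (w3 X) (w1 Y) (w2 Y) (w3 Y)"
    using expand[OF c w] by blast
  have w4D: "w4 (D X) = 0" for X using c by (simp add: coframe_def)
  obtain E where E: "\<And>a b c d. w1 (E a b c d) = a" "\<And>a b c d. w2 (E a b c d) = b"
    "\<And>a b c d. w3 (E a b c d) = c" "\<And>a b c d. w4 (E a b c d) = d" using coframe_vectors[OF c] by blast
  have i: "w (br (D X) Y) + w (br X (D Y)) = Re (w4 X) * w (D (D Y)) - Re (w4 Y) * w (D (D X))" for X Y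
    using inv[of X Y] by (simp add: D_derivation form_lin[OF w])
  note calc = * d w4D E Q12_def
  have "(B13 + B31) * (- 2 * \<i>) = 0"
    using i[of "E 1 0 0 0" "E \<i> 0 0 0"] by (simp add: calc algebra_simps)
  then have "B13 + B31 = 0" by simp
  moreover have "B33 = 0"
    using i[of "E 1 0 0 0" "E 0 0 \<i> 0"] by (simp add: calc)
  moreover have "A23 = 0 \<and> B23 = 0 \<and> B32 = 0"
    using i[of "E 1 0 0 0" "E 0 1 0 0"]
      i[of "E 1 0 0 0" "E 0 \<i> 0 0"]
      i[of "E \<i> 0 0 0" "E 0 1 0 0"]
    by (simp add: calc complex_eq_iff)
  moreover from calculation(1) have "B31 = - B13" by (simp add: add_eq_0_iff)
  ultimately have "w (br X Y) = Re (w4 X) * w (D Y) - Re (w4 Y) * w (D X) + Q7 A12 A13 B11 B12 B21 B22 B13 (w1 X) (w2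
      X) (w3 X) (w1 Y) (w2 Y) (w3 Y)" for X Y
    unfolding * Q7_def Q12_def by (simp add: algebra_simps)
  then show thesis by (rule that)
qed

text \<open>The same for \<open>D\<close> mapping \<open>\<omega>\<^sup>3\<close> to \<open>\<omega>\<^sup>2\<close> to
    \<open>\<omega>\<^sup>1\<close> to \<open>0\<close>.\<close>

definition Q4 where
  "Q4 A B C E x1 x2 x3 y1 y2 y3 = A * (x1 * y2 - x2 * y1) + B * (x1 * cnj y1 - y1 * cnj x1)
     + C * (x1 * cnj y2 - y1 * cnj x2 - x2 * cnj y1 + y2 * cnj x1)
     + E * (x1 * cnj y3 - y1 * cnj x3 - x2 * cnj y2 + y2 * cnj x2 + x3 * cnj y1 - y3 * cnj x1)"

lemma expand_rank2:
  fixes w w1 w2 w3 w4 :: "'a \<Rightarrow> complex"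
  assumes c: "coframe w1 w2 w3 w4" and w: "form w"
    and d: "\<And>X. w1 (D X) = 0" "\<And>X. w2 (D X) = w1 X" "\<And>X. w3 (D X) = w2 X"
    and inv: "\<And>X Y. w (D (br X Y)) = Re (w4 X) * w (D (D Y)) - Re (w4 Y) * w (D (D X))"
  obtains A B C E where
    "\<And>X Y. w (br X Y) = Re (w4 X) * w (D Y) - Re (w4 Y) * w (D X) + Q4 A B C E (w1 X) (w2 X) (w3 X) (w1 Y) (w2 Y) (w3 Y)"
proof -
  obtain A12 A13 A23 B11 B12 B13 B21 B22 B23 B31 B32 B33 where
    *: "\<And>X Y. w (br X Y) = Re (w4 X) * w (D Y) - Re (w4 Y) * w (D X)
      + Q12 A12 A13 A23 B11 B12 B13 B21 B22 B23 B31 B32 B33 (w1 X) (w2 X) (w3 X) (w1 Y) (w2 Y) (w3 Y)"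
    using expand[OF c w] by blast
  have w4D: "w4 (D X) = 0" for X using c by (simp add: coframe_def)
  obtain E where E: "\<And>a b c d. w1 (E a b c d) = a" "\<And>a b c d. w2 (E a b c d) = b"
    "\<And>a b c d. w3 (E a b c d) = c" "\<And>a b c d. w4 (E a b c d) = d" using coframe_vectors[OF c] by blast
  have i: "w (br (D X) Y) + w (br X (D Y)) = Re (w4 X) * w (D (D Y)) - Re (w4 Y) * w (D (D X))" for X Y
    using inv[of X Y] by (simp add: D_derivation form_lin[OF w])
  note calc = * d w4D E Q12_def
  have 1: "B12 + B21 = 0"
    using i[of "E 1 0 0 0" "E \<i> 0 0 0"] by (simp add: calc complex_eq_iff)
  have 2: "A13 = 0 \<and> B13 + B22 = 0 \<and> B22 + B31 = 0"
    using i[of "E 1 0 0 0" "E 0 1 0 0"]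
      i[of "E 1 0 0 0" "E 0 \<i> 0 0"]
      i[of "E \<i> 0 0 0" "E 0 1 0 0"]
    by (simp add: calc complex_eq_iff)
  have 3: "A23 = 0 \<and> B23 = 0 \<and> B32 = 0"
    using i[of "E 1 0 0 0" "E 0 0 1 0"]
      i[of "E 1 0 0 0" "E 0 0 \<i> 0"]
      i[of "E \<i> 0 0 0" "E 0 0 1 0"]
    by (simp add: calc complex_eq_iff)
  have 4: "B33 = 0"
    using i[of "E 0 1 0 0" "E 0 0 \<i> 0"] by (simp add: calc)
  have 5: "B21 = - B12" "B22 = - B13" "B31 = B13" using 1 2 by (auto simp: add_eq_0_iff)
  have "w (br X Y) = Re (w4 X) * w (D Y) - Re (w4 Y) * w (D X) + Q4 A12 B11 B12 B13 (w1 X) (w2 X) (w3 X) (w1 Y) (w2 Y) (w3 Y)" for X Y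
    unfolding * Q4_def Q12_def using 2 3 4 by (simp add: 5 algebra_simps)
  then show thesis by (rule that)
qed

lemma coframe_span:
  assumes c: "coframe w1 w2 w3 w4" and w: "form w" "w z = 0"
  obtains p q r where "\<And>X. w X = p * w1 X + q * w2 X + r * w3 X"
proof -
  have f: "form w1" "form w2" "form w3" "form w4" and zz: "w1 z = 0" "w2 z = 0" "w3 z = 0" "w4 z = - \<i>"
    and s: "\<And>a b c d. \<exists>X. w1 X = a \<and> w2 X = b \<and> w3 X = c \<and> w4 X = d"
    using c by (auto simp: coframe_def)
  obtain e1 where e1: "w1 e1 = 1" "w2 e1 = 0" "w3 e1 = 0" "w4 e1 = 0" using s by metis
  obtain e2 where e2: "w1 e2 = 0" "w2 e2 = 1" "w3 e2 = 0" "w4 e2 = 0" using s by metis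
  obtain e3 where e3: "w1 e3 = 0" "w2 e3 = 0" "w3 e3 = 1" "w4 e3 = 0" using s by metis
  have "w X = w e1 * w1 X + w e2 * w2 X + w e3 * w3 X" for X
  proof -
    let ?Y = "scl (w1 X) e1 + scl (w2 X) e2 + scl (w3 X) e3 + scl (w4 X * \<i>) z"
    have "w1 (X - ?Y) = 0" "w2 (X - ?Y) = 0" "w3 (X - ?Y) = 0" "w4 (X - ?Y) = 0"
      using f by (simp_all add: form_lin zz e1 e2 e3 mult.assoc)
    then have "X - ?Y = 0" by (rule coframe_inj[OF c])
    then have "w X = w ?Y" by simp
    then show ?thesis using w by (simp add: form_lin)
  qed
  then show thesis by (rule that)
qed

text \<open>\<open>w1\<close> is \<open>w3\<close> composed with \<open>D\<close>. A third form
  exists by counting dimensions, and subtracting a multiple of \<open>w3\<close> makes it vanish on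
  the range of \<open>D\<close>.\<close>

lemma coframe_rank1:
  assumes DD: "\<And>X. D (D X) = 0"
  obtains w1 w2 w3 w4 where "coframe w1 w2 w3 w4"
    "\<And>X. w1 (D X) = 0" "\<And>X. w2 (D X) = 0" "\<And>X. w3 (D X) = w1 X"
proof -
  obtain Y where Y: "D Y \<noteq> 0" using D_nonzero by blast
  obtain w3 where w3: "form w3" "w3 z = 0" "w3 (D Y) = 1" using form_on_range_D[OF Y] by metis
  obtain w4 where w4: "form w4" "w4 z = - \<i>" "\<And>X. w4 (D X) = 0" by (metis fourth_form)
  define w1 where "w1 X = w3 (D X)" for X
  have w1: "form w1" unfolding w1_def by (rule form_D[OF w3(1)])
  \<comment> \<open>A \<open>J\<close>-stable set with span of dimension at most 6, so a nonzero
    form \<open>u\<close> vanishing on it exists.\<close>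
  let ?B = "{Y, J Y, D Y, J (D Y), z, J z}"
  have "dim (span ?B) \<le> card ?B" by (rule dim_le_card) simp_all
  also have "\<dots> \<le> 6" using card_length[of "[Y, J Y, D Y, J (D Y), z, J z]"] by simp
  finally have "dim (span ?B) \<le> 6" .
  then have "span ?B \<noteq> UNIV" using dim8 by (intro notI) (simp only: dim_UNIV)
  then obtain v where v: "v \<notin> span ?B" by blast
  have "J X \<in> span ?B" if "X \<in> span ?B" for X
  proof -
    have "J X \<in> span (J ` ?B)" using that linear_span_image[OF linear_J, of ?B] by blast
    moreover have "span (J ` ?B) \<subseteq> span ?B"
      by (intro span_minimal subspace_span) (auto intro: span_base span_neg)
    ultimately show ?thesis by blast
  qed
  then obtain u where u: "form u" "\<And>X. X \<in> span ?B \<Longrightarrow> u X = 0" "u v = 1"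
    using separating_form[OF subspace_span _ v] by metis
  have uB: "u Y = 0" "u (D Y) = 0" "u z = 0" by (auto intro!: u(2) span_base)
  have w1v: "w1 Y = 1" "w1 (D X) = 0" "w1 z = 0" for X using w3 by (simp_all add: w1_def DD form_lin)
  have "\<exists>X. w1 X = a \<and> u X = b \<and> w3 X = c \<and> w4 X = d" for a b c d
  proof -
    define a' where "a' = a - b * w1 v"
    define c' where "c' = c - a' * w3 Y - b * w3 v"
    define d' where "d' = (d - a' * w4 Y - b * w4 v) * \<i>"
    let ?X = "scl a' Y + scl b v + scl c' (D Y) + scl d' z"
    have "w1 ?X = a" "u ?X = b" "w3 ?X = c" "w4 ?X = d"
      using w1 w3 w4 u(1) by (simp_all add: form_lin u uB w1v a'_def c'_def d'_def mult.assoc)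
    then show ?thesis by blast
  qed
  then have c: "coframe w1 u w3 w4" using w1 u(1) w3 w4 uB by (simp add: coframe_def w1_def form_lin)
  \<comment> \<open>Applying \<open>D\<close> once more gives zero, which forces
    \<open>q = r = 0\<close>; the remaining \<open>p\<close> is removed by passing to
    \<open>w2\<close>.\<close>
  obtain p q r where pqr: "\<And>X. u (D X) = p * w1 X + q * u X + r * w3 X"
    using coframe_span[OF c form_D[OF u(1)]] u(1) by (auto simp: form_lin)
  have w1D: "w1 (D X) = 0" for X using w3(1) by (simp add: w1_def DD form_lin)
  have "q * (p * w1 X + q * u X + r * w3 X) + r * w1 X = 0" for X
    using pqr[of "D X"] u(1) by (simp add: DD form_lin w1D pqr w1_def[symmetric])
  then have *: "q * (p * a + q * b + r * c) + r * a = 0" for a b c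
    using c unfolding coframe_def by metis
  have "q = 0" using *[of 0 1 0] by simp
  moreover from this have "r = 0" using *[of 1 0 0] by simp
  ultimately have uD: "u (D X) = p * w1 X" for X using pqr by simp
  define w2 where "w2 X = u X - p * w3 X" for X
  have "w2 = (\<lambda>X. u X + - p * w3 X)" by (simp add: fun_eq_iff w2_def)
  then have "form w2" using form_add[OF u(1) form_mult[OF w3(1), of "- p"]] by (simp only:)
  moreover have "\<exists>X. w1 X = a \<and> w2 X = b \<and> w3 X = e \<and> w4 X = d" for a b e d
  proof -
    obtain X where "w1 X = a" "u X = b + p * e" "w3 X = e" "w4 X = d" using c unfolding coframe_def by metis
    then show ?thesis by (intro exI[of _ X]) (simp add: w2_def)
  qed
  ultimately have "coframe w1 w2 w3 w4" using c by (simp add: coframe_def w2_def)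
  moreover have "w2 (D X) = 0" for X by (simp add: w2_def uD w1_def)
  ultimately show thesis using that w1D by (metis w1_def)
qed

end

text \<open>In \<open>std1\<close> and \<open>std2\<close> the (1,0)-forms are \<open>w1\<close>, \<open>w2\<close>,
    \<open>w3\<close> and \<open>s + \<i> t\<close>, and the equations
  give their differentials up to sign.\<close>

definition std2 where
  "std2 br w1 w2 w3 s t m n B C b k e \<longleftrightarrow>
     linear w1 \<and> linear w2 \<and> linear w3 \<and> linear s \<and> linear t \<and>
     (\<forall>X. w1 X = 0 \<and> w2 X = 0 \<and> w3 X = 0 \<and> s X = 0 \<and> t X = 0 \<longrightarrow> X = 0) \<and>
     (\<forall>X Y. w1 (br X Y) = 0 \<and>
       s (br X Y) = n * Im (w1 X * cnj (w1 Y)) \<and>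
       w2 (br X Y) = complex_of_real (s X) * w1 Y - complex_of_real (s Y) * w1 X \<and>
       w3 (br X Y) = complex_of_real m * (complex_of_real (s X) * w2 Y - complex_of_real (s Y) * w2 X) - cnj C * (w1 X * w2 Y - w2 X * w1 Y)
         + B * (w1 X * cnj (w1 Y) - w1 Y * cnj (w1 X))
         + C * (w1 X * cnj (w2 Y) - w1 Y * cnj (w2 X) - w2 X * cnj (w1 Y) + w2 Y * cnj (w1 X)) \<and>
       t (br X Y) = b * Im (w1 X * cnj (w1 Y)) + k * (Re (w1 X * cnj (w2 Y)) - Re (w1 Y * cnj (w2 X)))
         + e * (Im (w1 X * cnj (w3 Y)) - Im (w1 Y * cnj (w3 X)) - m * Im (w2 X * cnj (w2 Y))))"

abbreviation has_std2_0 where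
  "has_std2_0 br \<equiv> \<exists>w1 w2 w3 s t n B C b k e. e \<noteq> 0 \<and> C \<noteq> 0 \<and> std2 br w1 w2 w3 s t 0 n B C b k e"

abbreviation has_std2_1 where
  "has_std2_1 br \<equiv> \<exists>w1 w2 w3 s t B C b k e. e \<noteq> 0 \<and> std2 br w1 w2 w3 s t 1 0 B C b k e"

context lie_complex
begin

lemma coframe_central:
  assumes c: "coframe w1 w2 w3 w4" and X: "\<And>Y. w1 (br X Y) = 0" "\<And>Y. w2 (br X Y) = 0" "\<And>Y. w3 (br X Y) =
      0" "\<And>Y. w4 (br X Y) = 0"
  shows "w1 X = 0" "w2 X = 0" "w3 X = 0"
proof -
  have "br X Y = 0" for Y using coframe_inj[OF c] X by blast
  then obtain r where r: "X = r *\<^sub>R z" using central by blast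
  then show "w1 X = 0" "w2 X = 0" "w3 X = 0" using c unfolding coframe_def by (simp_all add: form_lin)
qed

text \<open>On a 2-form of type (2,0) + (1,1), \<open>M\<close> keeps twice the (2,0)-part and
  \<open>N\<close> twice the (1,1)-terms linear in \<open>Y\<close> and antilinear in
  \<open>X\<close>. This is how single coefficients become matrix entries of nilpotent
  operators.\<close>

lemma form_N: "form w \<Longrightarrow> w (N X Y) = w (br X Y) + \<i> * w (br (J X) Y)"
  and form_M: "form w \<Longrightarrow> w (M X Y) = w (br X Y) - w (br (J X) (J Y))"
  by (simp_all add: N_def M_def form_lin)

lemma form_nilpotent_scalar:
  assumes T: "\<exists>n. \<forall>m\<ge>n. \<forall>Y. (T ^^ m) Y = 0"
    and w: "form w" and S: "\<And>Y. Y \<in> S \<Longrightarrow> T Y \<in> S" "\<And>Y. Y \<in> S \<Longrightarrow> w (T Y) = c * w Y"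
    and Y: "Y \<in> S" "w Y \<noteq> 0"
  shows "c = 0"
proof -
  obtain n where n: "\<And>m Y. m \<ge> n \<Longrightarrow> (T ^^ m) Y = 0" using T by metis
  have i: "(T ^^ m) Y \<in> S" for m by (induction m) (use S Y in auto)
  show ?thesis
    by (rule nilpotent_scalar[of "\<lambda>m. w ((T ^^ m) Y)" c n]) (use S(2)[OF i] n[of n] Y form_lin(5)[OF w] in auto)
qed

lemma form_nilpotent_2x2:
  assumes T: "\<exists>n. \<forall>m\<ge>n. \<forall>Y. (T ^^ m) Y = 0"
    and w: "form w" "form w'" and S: "\<And>Y. Y \<in> S \<Longrightarrow> T Y \<in> S"
    "\<And>Y. Y \<in> S \<Longrightarrow> w (T Y) = a * w Y + b * w' Y" "\<And>Y. Y \<in> S \<Longrightarrow> w' (T Y) = c * w Y + d * w' Y"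
    and s: "\<And>x y. \<exists>Y\<in>S. w Y = x \<and> w' Y = y"
  shows "a + d = 0" "a * d = b * c"
proof -
  obtain n where n: "\<And>m Y. m \<ge> n \<Longrightarrow> (T ^^ m) Y = 0" using T by metis
  obtain V where V: "\<And>x y. V x y \<in> S" "\<And>x y. w (V x y) = x" "\<And>x y. w' (V x y) = y" using s by metis
  have i: "(T ^^ m) (V x y) \<in> S" for m x y by (induction m) (use S V in auto)
  define u v where "u p m = w ((T ^^ m) (V (fst p) (snd p)))" and "v p m = w' ((T ^^ m) (V (fst p) (snd p)))" for p m
  have "u p (Suc m) = a * u p m + b * v p m" "v p (Suc m) = c * u p m + d * v p m" for p m
    using S(2,3)[OF i] by (simp_all add: u_def v_def)
  moreover have "u p m = 0 \<and> v p m = 0" if "m \<ge> n" for p m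
    using n[OF that] w by (simp add: u_def v_def form_lin)
  moreover have "\<exists>p. u p 0 = x \<and> v p 0 = y" for x y
    by (rule exI[of _ "(x, y)"]) (simp add: u_def v_def V)
  ultimately show "a + d = 0" "a * d = b * c"
    using nilpotent_2x2[of u a b v c d "\<lambda>_. n"] by blast+
qed

lemmas N_scalar = form_nilpotent_scalar[OF N_nilpotent] and M_scalar = form_nilpotent_scalar[OF M_nilpotent]
  and N_2x2 = form_nilpotent_2x2[OF N_nilpotent] and M_2x2 = form_nilpotent_2x2[OF M_nilpotent]

lemma coframe_shift4:
  fixes w w1 w2 w3 w4 :: "'a \<Rightarrow> complex"
  assumes c: "coframe w1 w2 w3 w4" and "form w" "w z = 0" "\<And>X. w (D X) = 0"
    "w = (\<lambda>X. p * w1 X + q * w2 X + r * w3 X)"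
  shows "coframe w1 w2 w3 (\<lambda>X. w4 X + w X)"
  unfolding coframe_def
proof (intro conjI allI)
  have f: "form w4" using c by (simp add: coframe_def)
  show "form (\<lambda>X. w4 X + w X)" by (rule form_add[OF f assms(2)])
  fix a b e d
  obtain X where "w1 X = a" "w2 X = b" "w3 X = e" "w4 X = d - (p * a + q * b + r * e)"
    using c unfolding coframe_def by metis
  then show "\<exists>X. w1 X = a \<and> w2 X = b \<and> w3 X = e \<and> w4 X + w X = d"
    by (intro exI[of _ X]) (simp add: assms(5))
qed (use c assms in \<open>auto simp: coframe_def\<close>)

section \<open>The case of a single Jordan block of size three\<close>

lemma rank2_step1:
  fixes w1 w2 w3 w4 :: "'a \<Rightarrow> complex"
  assumes c: "coframe w1 w2 w3 w4"
    and d: "\<And>X. w1 (D X) = 0" "\<And>X. w2 (D X) = w1 X" "\<And>X. w3 (D X) = w2 X"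
  shows "w1 (br X Y) = 0"
    "\<exists>b. \<forall>X Y. w2 (br X Y) = Re (w4 X) * w1 Y - Re (w4 Y) * w1 X + b * (w1 X * cnj (w1 Y) - w1 Y * cnj (w1 X))"
proof -
  have f: "form w1" "form w2" "form w3" "form w4" and w4D: "\<And>X. w4 (D X) = 0" using c by (auto simp: coframe_def)
  obtain E where E: "\<And>a b c d. w1 (E a b c d) = a" "\<And>a b c d. w2 (E a b c d) = b"
    "\<And>a b c d. w3 (E a b c d) = c" "\<And>a b c d. w4 (E a b c d) = d" using coframe_vectors[OF c] by blast
  obtain w where w: "form w" "\<And>X Y. w (br X Y) = 0" "w z = 0" "\<exists>X. w X \<noteq> 0" using closed_form by metis
  obtain p q r where pqr: "\<And>X. w X = p * w1 X + q * w2 X + r * w3 X" using coframe_span[OF c w(1,3)] by blast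
  \<comment> \<open>\<open>D X\<close> is a bracket, so the closed form vanishes on it; this leaves
    a multiple of \<open>w1\<close>.\<close>
  have "q * w1 X + r * w2 X = 0" for X using w(2)[of "J z" X] pqr[of "D X"] d by (simp add: D_def)
  from this[of "E 1 0 0 0"] this[of "E 0 1 0 0"] have "q = 0" "r = 0" by (simp_all add: E)
  then have "p \<noteq> 0" "p * w1 (br X Y) = 0" for X Y using w(2)[of X Y] w(4) by (auto simp: pqr)
  then have closed: "w1 (br X Y) = 0" for X Y by simp
  then show "w1 (br X Y) = 0" .
  obtain a b cc e where w2: "\<And>X Y. w2 (br X Y) = Re (w4 X) * w2 (D Y) - Re (w4 Y) * w2 (D X)
      + Q4 a b cc e (w1 X) (w2 X) (w3 X) (w1 Y) (w2 Y) (w3 Y)"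
    using expand_rank2[OF c f(2) d, simplified d closed] by (simp add: d) blast
  obtain a4 b4 c4 e4 where w4: "\<And>X Y. w4 (br X Y) = Re (w4 X) * w4 (D Y) - Re (w4 Y) * w4 (D X)
      + Q4 a4 b4 c4 e4 (w1 X) (w2 X) (w3 X) (w1 Y) (w2 Y) (w3 Y)"
    using expand_rank2[OF c f(4) d, simplified w4D] by (simp add: w4D) blast
  let ?S = "{Y. w1 Y = 0}"
  note calc = form_N form_M f closed form_lin(6) w2 w4 d w4D E Q4_def
  have SN: "N X Y \<in> ?S" "M X Y \<in> ?S" for X Y by (simp_all add: form_N form_M f(1) closed)
  \<comment> \<open>Since \<open>w1\<close> is closed, its kernel is stable, and there
    \<open>2 * e\<close> is an eigenvalue of a nilpotent operator.\<close>
  have "2 * e = 0"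
  proof (rule N_scalar[OF f(2), where X = "E 0 1 0 0" and S = ?S and Y = "E 0 1 0 0"])
    show "w2 (N (E 0 1 0 0) Y) = 2 * e * w2 Y" if "Y \<in> ?S" for Y
      using that by (simp add: calc algebra_simps)
  qed (use SN E in auto)
  then have e: "e = 0" by simp
  \<comment> \<open>The (2,0)-part of \<open>Re (w4 Y) * w1 X\<close> couples \<open>w2\<close> to
    \<open>w4\<close>, so the pair has to be treated together; the trace is
    \<open>2 * a\<close>.\<close>
  have "w2 (M (E 1 0 0 0) Y) = 2 * a * w2 Y + - 1 * w4 Y" if "Y \<in> ?S" for Y
    using that e by (simp add: calc algebra_simps complex_eq_iff)
  moreover have "w4 (M (E 1 0 0 0) Y) = 2 * a4 * w2 Y + 0 * w4 Y" if "Y \<in> ?S" for Y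
    using that e by (simp add: calc algebra_simps)
  moreover have "\<exists>Y\<in>?S. w2 Y = x \<and> w4 Y = y" for x y
    by (rule bexI[of _ "E 0 x 0 y"]) (simp_all add: E)
  ultimately have "2 * a + 0 = 0" by (rule M_2x2(1)[OF f(2,4) SN(2)])
  then have a: "a = 0" by simp
  have "2 * cc = 0"
  proof (rule N_scalar[OF f(2), where X = "E 1 0 0 0" and S = ?S and Y = "E 0 1 0 0"])
    show "w2 (N (E 1 0 0 0) Y) = 2 * cc * w2 Y" if "Y \<in> ?S" for Y
      using that e a by (simp add: calc algebra_simps)
  qed (use SN E in auto)
  then have "cc = 0" by simp
  then show "\<exists>b. \<forall>X Y. w2 (br X Y) = Re (w4 X) * w1 Y - Re (w4 Y) * w1 X + b * (w1 X * cnj (w1 Y) - w1 Y * cnj (w1 X))"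
    using a e by (intro exI[of _ b]) (simp add: w2 d Q4_def)
qed

lemma form_jacobi:
  assumes "form w"
  shows "w (br X (br Y Z)) + w (br Y (br Z X)) + w (br Z (br X Y)) = 0"
  using jacobi[of X Y Z] assms by (metis form_lin(1,5))

lemma rank2_std2:
  assumes "D (D X0) \<noteq> 0"
  shows "has_std2_1 br"
proof -
  obtain w1 w2 w3 w0 where c0: "coframe w1 w2 w3 w0"
    and d: "\<And>X. w1 (D X) = 0" "\<And>X. w2 (D X) = w1 X" "\<And>X. w3 (D X) = w2 X"
    using coframe_rank2[OF assms] by metis
  have closed: "w1 (br X Y) = 0" for X Y by (rule rank2_step1(1)[OF c0 d])
  obtain b where b: "\<And>X Y. w2 (br X Y) = Re (w0 X) * w1 Y - Re (w0 Y) * w1 X + b * (w1 X * cnj (w1 Y) - w1 Y * cnj (w1 X))"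
    using rank2_step1(2)[OF c0 d] by blast
  \<comment> \<open>\<open>Re (w4 X)\<close> changes by
    \<open>- (cnj b * w1 X + b * cnj (w1 X))\<close>. Wedged with \<open>w1\<close>, the second
    summand cancels the \<open>b\<close>-term and the first drops out.\<close>
  define w4 where "w4 X = w0 X + - 2 * cnj b * w1 X" for X
  have f: "form w1" "form w2" "form w3" and z1: "w1 z = 0" using c0 by (auto simp: coframe_def)
  have c: "coframe w1 w2 w3 w4"
    unfolding w4_def
    by (rule coframe_shift4[OF c0 form_mult[OF f(1)], where p = "- 2 * cnj b" and q = 0 and r = 0]) (simp_all add: z1 d)
  then have f4: "form w4" and w4D: "\<And>X. w4 (D X) = 0" by (auto simp: coframe_def)
  have w2: "w2 (br X Y) = Re (w4 X) * w1 Y - Re (w4 Y) * w1 X" for X Y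
    unfolding b w4_def by (simp add: complex_eq_iff algebra_simps)
  obtain E where E: "\<And>a b c d. w1 (E a b c d) = a" "\<And>a b c d. w2 (E a b c d) = b"
    "\<And>a b c d. w3 (E a b c d) = c" "\<And>a b c d. w4 (E a b c d) = d" using coframe_vectors[OF c] by blast
  obtain a4 b4 c4 e4 where w4: "\<And>X Y. w4 (br X Y) = Q4 a4 b4 c4 e4 (w1 X) (w2 X) (w3 X) (w1 Y) (w2 Y) (w3 Y)"
    using expand_rank2[OF c f4 d, simplified w4D] by (simp add: w4D) blast
  obtain A B C E' where w3: "\<And>X Y. w3 (br X Y) = Re (w4 X) * w2 Y - Re (w4 Y) * w2 X
      + Q4 A B C E' (w1 X) (w2 X) (w3 X) (w1 Y) (w2 Y) (w3 Y)"
    using expand_rank2[OF c f(3) d, simplified d, OF w2] by blast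
  note J2 = form_jacobi[OF f(2), of "E 1 0 0 0" "E \<i> 0 0 0"]
    and J3 = form_jacobi[OF f(3), of "E 1 0 0 0" "E \<i> 0 0 0"]
    and K3 = form_jacobi[OF f(3)]
    and J4 = form_jacobi[OF f4, of "E 1 0 0 0" "E \<i> 0 0 0"]
  have 4: "a4 = 0 \<and> Re c4 = 0 \<and> Im e4 = 0"
    using J2[of "E 0 1 0 0"] J2[of "E 0 \<i> 0 0"] J2[of "E 0 0 1 0"] J2[of "E 0 0 \<i> 0"]
    by (simp add: w2 w4 Q4_def E closed complex_eq_iff)
  have E': "E' = 0"
    using K3[of "E 1 0 0 0" "E 0 1 0 0" "E 0 \<i> 0 0"] K3[of "E \<i> 0 0 0" "E 0 1 0 0" "E 0 \<i> 0 0"]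
    using 4 by (auto simp: closed w2 w3 w4 Q4_def E complex_eq_iff)
  have b4: "Im b4 = 0"
    using J3[of "E 0 1 0 0"] J3[of "E 0 \<i> 0 0"]
    using 4 E' by (auto simp: closed w2 w3 w4 Q4_def E complex_eq_iff)
  have A: "e4 * (A + cnj C) = 0"
    using J4[of "E 0 1 0 0"] J4[of "E 0 \<i> 0 0"]
    using 4 E' b4 by (simp add: closed w2 w3 w4 Q4_def E complex_eq_iff algebra_simps)
  \<comment> \<open>Otherwise the vector dual to \<open>w3\<close> would be central.\<close>
  have e4: "e4 \<noteq> 0"
  proof
    assume e: "e4 = 0"
    have "w3 (E 0 0 1 0) = 0"
      by (rule coframe_central(3)[OF c]) (simp_all add: closed w2 w3 w4 E Q4_def E' e)
    then show False by (simp add: E)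
  qed
  then have A: "A = - cnj C" using A by (simp add: add_eq_0_iff)
  have "std2 br w1 w2 w3 (\<lambda>X. Re (w4 X)) (\<lambda>X. Im (w4 X)) 1 0 B C (2 * Re b4) (2 * Im c4) (2 * Re e4)"
    unfolding std2_def
  proof (intro conjI allI impI)
    show "linear w1" "linear w2" "linear w3" using f by (auto simp: form_def)
    show "linear (\<lambda>X. Re (w4 X))" "linear (\<lambda>X. Im (w4 X))"
      using f4 by (auto intro!: linearI simp: form_lin)
    show "X = 0" if "w1 X = 0 \<and> w2 X = 0 \<and> w3 X = 0 \<and> Re (w4 X) = 0 \<and> Im (w4 X) = 0" for X
      by (rule coframe_inj[OF c]) (use that in \<open>auto simp: complex_eq_iff\<close>)
  qed (use 4 b4 in \<open>simp_all add: closed w2 w3 w4 Q4_def E' A algebra_simps\<close>)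
  moreover have "Re e4 \<noteq> 0" using e4 4 by (auto simp: complex_eq_iff)
  ultimately show ?thesis by (intro exI[of _ w1] exI[of _ w2] exI[of _ w3] exI conjI) auto
qed

end

section \<open>The case of Jordan blocks of sizes two and one\<close>

definition std1 where
  "std1 br w1 w2 w3 s t n C A B E F b f G h \<longleftrightarrow>
     linear w1 \<and> linear w2 \<and> linear w3 \<and> linear s \<and> linear t \<and>
     (\<forall>X. w1 X = 0 \<and> w2 X = 0 \<and> w3 X = 0 \<and> s X = 0 \<and> t X = 0 \<longrightarrow> X = 0) \<and>
     complex_of_real h * (A - cnj E) = \<i> * complex_of_real G * cnj C \<and>
     (\<forall>X Y. w1 (br X Y) = 0 \<and>
       s (br X Y) = n * Im (w1 X * cnj (w1 Y)) \<and>
       w2 (br X Y) = C * (w1 X * cnj (w1 Y) - w1 Y * cnj (w1 X)) \<and>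
       w3 (br X Y) = complex_of_real (s X) * w1 Y - complex_of_real (s Y) * w1 X + A * (w1 X * w2 Y - w2 X * w1 Y)
         + B * (w1 X * cnj (w1 Y) - w1 Y * cnj (w1 X)) + E * (w1 X * cnj (w2 Y) - w1 Y * cnj (w2 X))
         + F * (w2 X * cnj (w1 Y) - w2 Y * cnj (w1 X)) \<and>
       t (br X Y) = b * Im (w1 X * cnj (w1 Y)) + Im (f * (w1 X * cnj (w2 Y) - w1 Y * cnj (w2 X)))
         + G * Im (w2 X * cnj (w2 Y)) + h * Re (w1 X * cnj (w3 Y) - w1 Y * cnj (w3 X)))"

abbreviation has_std1 where
  "has_std1 br \<equiv> \<exists>w1 w2 w3 s t n C A B E F b f G h. h \<noteq> 0 \<and> (F \<noteq> 0 \<or> G \<noteq>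
      0) \<and> std1 br w1 w2 w3 s t n C A B E F b f G h"

context lie_complex
begin

text \<open>Here \<open>D\<close> also kills \<open>w2\<close>, so the closed form may involve
  \<open>w2\<close>. In that case it replaces \<open>w2\<close>, and each coefficient left in the
  differential of \<open>w1\<close> is the eigenvalue of a nilpotent operator, or the modulus of one
  up to conjugation.\<close>

lemma rank1_closed:
  fixes w1 w2 w3 w4 :: "'a \<Rightarrow> complex"
  assumes c: "coframe w1 w2 w3 w4"
    and d: "\<And>X. w1 (D X) = 0" "\<And>X. w2 (D X) = 0" "\<And>X. w3 (D X) = w1 X"
  shows "w1 (br X Y) = 0"
proof -
  obtain w where w: "form w" "\<And>X Y. w (br X Y) = 0" "w z = 0" "\<exists>X. w X \<noteq> 0" using closed_form by metis
  obtain p q r where pqr: "\<And>X. w X = p * w1 X + q * w2 X + r * w3 X" using coframe_span[OF c w(1,3)] by blast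
  obtain E where E: "\<And>a b c d. w1 (E a b c d) = a" "\<And>a b c d. w2 (E a b c d) = b"
    "\<And>a b c d. w3 (E a b c d) = c" "\<And>a b c d. w4 (E a b c d) = d" using coframe_vectors[OF c] by blast
  have "r * w1 X = 0" for X using w(2)[of "J z" X] pqr[of "D X"] d by (simp add: D_def)
  from this[of "E 1 0 0 0"] have r: "r = 0" by (simp add: E)
  show ?thesis
  proof (cases "q = 0")
    case True
    then have "p \<noteq> 0" "p * w1 (br X Y) = 0" using w(2)[of X Y] w(4) r by (auto simp: pqr)
    then show ?thesis by simp
  next
    case False
    have f: "form w1" "form w3" "form w4" and zz: "w1 z = 0" "w3 z = 0" "w4 z = - \<i>" and w4D: "\<And>X. w4 (D X) = 0"
      using c by (auto simp: coframe_def)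
    have c: "coframe w1 w w3 w4"
      unfolding coframe_def
    proof (intro conjI allI)
      fix a b e d
      show "\<exists>X. w1 X = a \<and> w X = b \<and> w3 X = e \<and> w4 X = d"
        by (rule exI[of _ "E a ((b - p * a) / q) e d"]) (use False in \<open>simp add: pqr r E\<close>)
    qed (use f w zz w4D in auto)
    obtain E where E: "\<And>a b c d. w1 (E a b c d) = a" "\<And>a b c d. w (E a b c d) = b"
      "\<And>a b c d. w3 (E a b c d) = c" "\<And>a b c d. w4 (E a b c d) = d" using coframe_vectors[OF c] by blast
    have wD: "w (D X) = 0" for X using w(2) by (simp add: D_def)
    obtain A B C E0 F G H where w1: "\<And>X Y. w1 (br X Y) = Q7 A B C E0 F G H (w1 X) (w X) (w3 X) (w1 Y) (w Y) (w3 Y)"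
      using expand_rank1[OF c f(1) d(1) wD d(3), simplified d] by simp blast
    \<comment> \<open>\<open>expand_rank1\<close> for \<open>w3\<close> would presuppose that
      \<open>w1\<close> is closed. Instead, the differential of \<open>w1\<close> is compared with
      the action of \<open>D\<close> on the general twelve-term one.\<close>
    obtain A12 A13 A23 B11 B12 B13 B21 B22 B23 B31 B32 B33 where
      w3: "\<And>X Y. w3 (br X Y) = Re (w4 X) * w3 (D Y) - Re (w4 Y) * w3 (D X)
      + Q12 A12 A13 A23 B11 B12 B13 B21 B22 B23 B31 B32 B33 (w1 X) (w X) (w3 X) (w1 Y) (w Y) (w3 Y)"
      using expand[OF c f(2)] by blast
    have i: "w3 (br (D X) Y) + w3 (br X (D Y)) = w1 (br X Y)" for X Y
      using d(3)[of "br X Y"] by (simp add: D_derivation form_lin[OF f(2)])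
    have BGH: "B = 0 \<and> G = 0 \<and> H = 0"
      using i[of "E 1 0 0 0" "E 0 0 1 0"] i[of "E 1 0 0 0" "E 0 0 \<i> 0"] i[of "E \<i> 0 0 0" "E 0 0 1 0"]
        i[of "E 0 1 0 0" "E 0 \<i> 0 0"]
      by (simp add: w1 w3 d wD w4D E Q7_def Q12_def complex_eq_iff)
    let ?S = "{Y. w Y = 0}"
    have SN: "N X Y \<in> ?S" "M X Y \<in> ?S" for X Y by (simp_all add: form_N form_M w)
    note calc = form_N form_M f w(1,2) form_lin(6) w1 E Q7_def BGH
    have "- 2 * C = 0"
    proof (rule N_scalar[OF f(1), where X = "E 1 0 0 0" and S = ?S and Y = "E 1 0 0 0"])
      show "w1 (N (E 1 0 0 0) Y) = - 2 * C * w1 Y" if "Y \<in> ?S" for Y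
        using that by (simp add: calc algebra_simps)
    qed (use SN E in auto)
    moreover have "- 2 * E0 = 0"
    proof (rule N_scalar[OF f(1), where X = "E 0 1 0 0" and S = ?S and Y = "E 1 0 0 0"])
      show "w1 (N (E 0 1 0 0) Y) = - 2 * E0 * w1 Y" if "Y \<in> ?S" for Y
        using that by (simp add: calc algebra_simps)
    qed (use SN E in auto)
    moreover have "- 2 * A = 0"
    proof (rule M_scalar[OF f(1), where X = "E 0 1 0 0" and S = ?S and Y = "E 1 0 0 0"])
      show "w1 (M (E 0 1 0 0) Y) = - 2 * A * w1 Y" if "Y \<in> ?S" for Y
        using that by (simp add: calc algebra_simps)
    qed (use SN E in auto)
    ultimately have 0: "C = 0" "E0 = 0" "A = 0" by simp_all
    \<comment> \<open>The bracket with this vector sends \<open>w1\<close> to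
      \<open>F * cnj (w1 Y)\<close>, which is antilinear; only its square is scalar, so even powers
      are used.\<close>
    have "F * cnj F = 0"
    proof -
      let ?T = "br (E 0 1 0 0)"
      obtain n where n: "L n = {0}" by (rule L_zero)
      have "(?T ^^ k) Y \<in> L k" for k Y by (induction k) (auto intro: br_L)
      from this[of n] have T0: "(?T ^^ n) Y = 0" for Y using n by simp
      have "(?T ^^ (2 * n)) Y = (?T ^^ n) ((?T ^^ n) Y)" for Y by (simp add: mult_2 funpow_add)
      then have z: "(?T ^^ (2 * n)) Y = 0" for Y by (simp add: T0)
      define u where "u k = w1 ((?T ^^ (2 * k)) (E 1 0 0 0))" for k
      have w0: "w ((?T ^^ k) (E 1 0 0 0)) = 0" for k by (induction k) (simp_all add: E w(2))
      have s1: "w1 (?T Y) = F * cnj (w1 Y)" if "w Y = 0" for Y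
        using that by (simp add: w1 E Q7_def BGH 0)
      have "u (Suc k) = F * cnj F * u k" for k
        by (simp add: u_def s1 w0 w(2))
      moreover have "u n = 0" using z f(1) by (simp add: u_def form_lin)
      moreover have "u 0 \<noteq> 0" by (simp add: u_def E)
      ultimately show ?thesis by (rule nilpotent_scalar)
    qed
    then have "F = 0" by simp
    then show ?thesis by (simp add: w1 Q7_def 0 BGH)
  qed
qed

text \<open>The digit of a coefficient names the differentiated form, the letters follow the
  arguments of \<open>Q7\<close>.\<close>

definition frame1 where
  "frame1 w1 w2 w3 w4 a2 b2 c2 e2 f2 g2 h2 a3 b3 c3 e3 f3 g3 h3 a4 b4 c4 e4 f4 g4 h4 \<longleftrightarrow>
     coframe w1 w2 w3 w4 \<and> (\<forall>X. w1 (D X) = 0) \<and> (\<forall>X. w2 (D X) = 0) \<and> (\<forall>X. w3 (D X) = w1 X) \<and>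
     (\<forall>X Y. w1 (br X Y) = 0) \<and>
     (\<forall>X Y. w2 (br X Y) = Q7 a2 b2 c2 e2 f2 g2 h2 (w1 X) (w2 X) (w3 X) (w1 Y) (w2 Y) (w3 Y)) \<and>
     (\<forall>X Y. w3 (br X Y) = complex_of_real (Re (w4 X)) * w1 Y - complex_of_real (Re (w4 Y)) * w1 X + Q7 a3 b3 c3
         e3 f3 g3 h3 (w1 X) (w2 X) (w3 X) (w1 Y) (w2 Y) (w3 Y)) \<and>
     (\<forall>X Y. w4 (br X Y) = Q7 a4 b4 c4 e4 f4 g4 h4 (w1 X) (w2 X) (w3 X) (w1 Y) (w2 Y) (w3 Y))"

lemma frame1D:
  assumes "frame1 w1 w2 w3 w4 a2 b2 c2 e2 f2 g2 h2 a3 b3 c3 e3 f3 g3 h3 a4 b4 c4 e4 f4 g4 h4"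
  shows "coframe w1 w2 w3 w4" "w1 (D X) = 0" "w2 (D X) = 0" "w3 (D X) = w1 X" "w1 (br X Y) = 0"
    "w2 (br X Y) = Q7 a2 b2 c2 e2 f2 g2 h2 (w1 X) (w2 X) (w3 X) (w1 Y) (w2 Y) (w3 Y)"
    "w3 (br X Y) = complex_of_real (Re (w4 X)) * w1 Y - complex_of_real (Re (w4 Y)) * w1 X + Q7 a3 b3 c3 e3 f3 g3 h3
        (w1 X) (w2 X) (w3 X) (w1 Y) (w2 Y) (w3 Y)"
    "w4 (br X Y) = Q7 a4 b4 c4 e4 f4 g4 h4 (w1 X) (w2 X) (w3 X) (w1 Y) (w2 Y) (w3 Y)"
  using assms unfolding frame1_def by blast+

lemma frame1_exists:
  assumes "\<And>X. D (D X) = 0"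
  obtains w1 w2 w3 w4 a2 b2 c2 e2 f2 g2 h2 a3 b3 c3 e3 f3 g3 h3 a4 b4 c4 e4 f4 g4 h4 where
    "frame1 w1 w2 w3 w4 a2 b2 c2 e2 f2 g2 h2 a3 b3 c3 e3 f3 g3 h3 a4 b4 c4 e4 f4 g4 h4"
proof -
  obtain w1 w2 w3 w4 where c: "coframe w1 w2 w3 w4"
    and d: "\<And>X. w1 (D X) = 0" "\<And>X. w2 (D X) = 0" "\<And>X. w3 (D X) = w1 X"
    using coframe_rank1[OF assms] by metis
  have w1: "w1 (br X Y) = 0" for X Y by (rule rank1_closed[OF c d])
  have f: "form w1" "form w2" "form w3" "form w4" and w4D: "w4 (D X) = 0" for X using c by (auto simp: coframe_def)
  obtain a2 b2 c2 e2 f2 g2 h2 where 2: "\<And>X Y. w2 (br X Y) = Q7 a2 b2 c2 e2 f2 g2 h2 (w1 X) (w2 X) (w3 X) (w1 Y) (w2 Y) (w3 Y)"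
    using expand_rank1[OF c f(2) d, simplified d] by simp blast
  obtain a3 b3 c3 e3 f3 g3 h3 where 3: "\<And>X Y. w3 (br X Y) = Re (w4 X) * w1 Y - Re (w4 Y) * w1 X + Q7 a3 b3 c3 e3
      f3 g3 h3 (w1 X) (w2 X) (w3 X) (w1 Y) (w2 Y) (w3 Y)"
    using expand_rank1[OF c f(3) d, simplified d w1] by simp blast
  obtain a4 b4 c4 e4 f4 g4 h4 where 4: "\<And>X Y. w4 (br X Y) = Q7 a4 b4 c4 e4 f4 g4 h4 (w1 X) (w2 X) (w3 X) (w1 Y) (w2 Y) (w3 Y)"
    using expand_rank1[OF c f(4) d, simplified w4D] by simp blast
  have "frame1 w1 w2 w3 w4 a2 b2 c2 e2 f2 g2 h2 a3 b3 c3 e3 f3 g3 h3 a4 b4 c4 e4 f4 g4 h4"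
    unfolding frame1_def by (intro conjI allI c d w1 2 3 4)
  then show thesis by (rule that)
qed

text \<open>\<open>w2\<close> vanishes on the range of \<open>D\<close>, so the relation between
  \<open>w3\<close> and \<open>D\<close> survives. The shift serves to remove \<open>h3\<close> when
  \<open>h2\<close> is nonzero and \<open>b3\<close> when \<open>b2\<close> is nonzero.\<close>

lemma frame1_shift3:
  assumes "frame1 w1 w2 w3 w4 a2 b2 c2 e2 f2 g2 h2 a3 b3 c3 e3 f3 g3 h3 a4 b4 c4 e4 f4 g4 h4"
  shows "frame1 w1 w2 (\<lambda>X. w3 X - k * w2 X) w4 (a2 + k * b2) b2 c2 (e2 + cnj k * h2) (f2 - k * h2) g2 h2
    (a3 + k * b3 - k * (a2 + k * b2)) (b3 - k * b2) (c3 - k * c2) (e3 + cnj k * h3 - k * (e2 + cnj k * h2))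
    (f3 - k * h3 - k * (f2 - k * h2)) (g3 - k * g2) (h3 - k * h2)
    (a4 + k * b4) b4 c4 (e4 + cnj k * h4) (f4 - k * h4) g4 h4"
proof -
  have c: "coframe w1 w2 w3 w4" using assms by (simp add: frame1_def)
  have "(\<lambda>X. w3 X - k * w2 X) = (\<lambda>X. w3 X + - k * w2 X)" by (simp add: fun_eq_iff)
  then have f: "form (\<lambda>X. w3 X - k * w2 X)"
    using c form_add[OF _ form_mult, of w3 w2 "- k"] by (simp add: coframe_def)
  have "\<exists>X. w1 X = a \<and> w2 X = b \<and> w3 X - k * w2 X = e \<and> w4 X = d" for a b e d
  proof -
    obtain X where "w1 X = a" "w2 X = b" "w3 X = e + k * b" "w4 X = d" using c unfolding coframe_def by metis
    then show ?thesis by (intro exI[of _ X]) simp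
  qed
  then have "coframe w1 w2 (\<lambda>X. w3 X - k * w2 X) w4" using c f by (simp add: coframe_def)
  then show ?thesis
    by (unfold frame1_def, intro conjI allI) (simp_all add: frame1D[OF assms] Q7_def algebra_simps)
qed

text \<open>\<open>Re (w4 X)\<close> occurs in the differential of \<open>w3\<close>; the factors 2
  cancel the one half in the real part. The free numbers serve to remove \<open>c3\<close> and
  \<open>e3\<close>.\<close>

lemma frame1_shift4:
  assumes "frame1 w1 w2 w3 w4 a2 b2 c2 e2 f2 g2 h2 a3 b3 c3 e3 f3 g3 h3 a4 b4 c4 e4 f4 g4 h4"
  shows "frame1 w1 w2 w3 (\<lambda>X. w4 X + (2 * l * w2 X + 2 * k * w1 X)) a2 b2 c2 e2 f2 g2 h2
    (a3 + l) b3 (c3 + cnj k) (e3 + cnj l) f3 g3 h3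
    (a4 + 2 * l * a2) (b4 + 2 * l * b2) (c4 + 2 * l * c2) (e4 + 2 * l * e2) (f4 + 2 * l * f2) (g4 + 2 * l * g2) (h4 + 2 * l * h2)"
proof -
  have c: "coframe w1 w2 w3 w4" and d: "\<And>X. w1 (D X) = 0" "\<And>X. w2 (D X) = 0"
    using assms by (simp_all add: frame1_def)
  have f: "form w1" "form w2" "w1 z = 0" "w2 z = 0" using c by (auto simp: coframe_def)
  have "coframe w1 w2 w3 (\<lambda>X. w4 X + (2 * l * w2 X + 2 * k * w1 X))"
    by (rule coframe_shift4[OF c form_add[OF form_mult[OF f(2)] form_mult[OF f(1)]], where p = "2 * k" and q = "2 * l" and r = 0])
      (simp_all add: f d add.commute)
  then show ?thesis
    by (unfold frame1_def, intro conjI allI) (simp_all add: frame1D[OF assms] Q7_def complex_eq_iff algebra_simps)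
qed

text \<open>On the kernel of \<open>w1\<close>, the operator \<open>N\<close> along the first vector
  acts on \<open>w2, w3\<close> with rows \<open>(- 2 * f2, 2 * h2)\<close> and
  \<open>(- 2 * f3, 2 * h3)\<close>; trace and determinant give the second and third claims. The
  conditions on \<open>b2\<close> and \<open>h2\<close> are what makes the actions of
  \<open>M\<close> involved close up.\<close>

lemma frame1_coefficients:
  assumes F: "frame1 w1 w2 w3 w4 a2 b2 c2 e2 f2 g2 h2 a3 b3 c3 e3 f3 g3 h3 a4 b4 c4 e4 f4 g4 h4"
  shows "g2 = 0" "f2 = h3" "f2 * h3 = h2 * f3" "b2 = 0 \<Longrightarrow> a2 = 0"
    "b2 = 0 \<Longrightarrow> h2 = 0 \<Longrightarrow> b3 = 0" "b2 = 0 \<Longrightarrow> h2 = 0 \<Longrightarrow> b4 = 0"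
proof -
  have c: "coframe w1 w2 w3 w4" by (rule frame1D(1)[OF F])
  have f: "form w1" "form w2" "form w3" "form w4" using c by (auto simp: coframe_def)
  obtain E where E: "\<And>a b c d. w1 (E a b c d) = a" "\<And>a b c d. w2 (E a b c d) = b"
    "\<And>a b c d. w3 (E a b c d) = c" "\<And>a b c d. w4 (E a b c d) = d" using coframe_vectors[OF c] by blast
  let ?S = "{Y. w1 Y = 0}"
  note calc = form_N form_M f frame1D(2-)[OF F] form_lin(6) E Q7_def
  have SN: "N X Y \<in> ?S" "M X Y \<in> ?S" for X Y by (simp_all add: calc)
  have "- 2 * g2 = 0"
  proof (rule N_scalar[OF f(2), where X = "E 0 1 0 0" and S = ?S and Y = "E 0 1 0 0"])
    show "w2 (N (E 0 1 0 0) Y) = - 2 * g2 * w2 Y" if "Y \<in> ?S" for Y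
      using that by (simp add: calc algebra_simps)
  qed (use SN E in auto)
  then show g2: "g2 = 0" by simp
  have 1: "w2 (N (E 1 0 0 0) Y) = - 2 * f2 * w2 Y + 2 * h2 * w3 Y" if "Y \<in> ?S" for Y
    using that by (simp add: calc algebra_simps)
  have 2: "w3 (N (E 1 0 0 0) Y) = - 2 * f3 * w2 Y + 2 * h3 * w3 Y" if "Y \<in> ?S" for Y
    using that by (simp add: calc algebra_simps)
  have 3: "\<exists>Y\<in>?S. w2 Y = x \<and> w3 Y = y" for x y
    by (rule bexI[of _ "E 0 x y 0"]) (simp_all add: E)
  have "- 2 * f2 + 2 * h3 = 0" by (rule N_2x2(1)[OF f(2,3) SN(1) 1 2 3])
  then show "f2 = h3" by simp
  have "- 2 * f2 * (2 * h3) = 2 * h2 * (- 2 * f3)" by (rule N_2x2(2)[OF f(2,3) SN(1) 1 2 3])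
  then show "f2 * h3 = h2 * f3" by simp
  show a2: "a2 = 0" if b2: "b2 = 0"
  proof -
    have "2 * a2 = 0"
    proof (rule M_scalar[OF f(2), where X = "E 1 0 0 0" and S = ?S and Y = "E 0 1 0 0"])
      show "w2 (M (E 1 0 0 0) Y) = 2 * a2 * w2 Y" if "Y \<in> ?S" for Y
        using that b2 g2 by (simp add: calc algebra_simps)
    qed (use SN E in auto)
    then show ?thesis by simp
  qed
  have "b3 = 0 \<and> b4 = 0" if b2: "b2 = 0" "h2 = 0"
  proof -
    let ?S = "{Y. w1 Y = 0 \<and> w2 Y = 0}"
    have 1: "w3 (M (E 1 0 0 0) Y) = 2 * b3 * w3 Y + (- 1) * w4 Y" if "Y \<in> ?S" for Y
      using that by (simp add: calc complex_eq_iff algebra_simps)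
    have 2: "w4 (M (E 1 0 0 0) Y) = 2 * b4 * w3 Y + 0 * w4 Y" if "Y \<in> ?S" for Y
      using that by (simp add: calc algebra_simps)
    have 3: "\<exists>Y\<in>?S. w3 Y = x \<and> w4 Y = y" for x y
      by (rule bexI[of _ "E 0 0 x y"]) (simp_all add: E)
    have S: "M (E 1 0 0 0) Y \<in> ?S" if "Y \<in> ?S" for Y using that b2 a2[OF b2(1)] g2 by (simp add: calc)
    have "2 * b3 + 0 = 0" by (rule M_2x2(1)[OF f(3,4) S 1 2 3])
    moreover have "2 * b3 * 0 = (- 1) * (2 * b4)" by (rule M_2x2(2)[OF f(3,4) S 1 2 3])
    ultimately show ?thesis by simp
  qed
  then show "b2 = 0 \<Longrightarrow> h2 = 0 \<Longrightarrow> b3 = 0" "b2 = 0 \<Longrightarrow> h2 = 0 \<Longrightarrow> b4 = 0" by blast+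
qed

lemma frame1_h2_nonzero:
  assumes F: "frame1 w1 w2 w3 w4 a2 b2 c2 e2 0 0 h2 a3 b3 c3 e3 0 g3 0 a4 b4 c4 e4 f4 g4 h4"
    and h2: "h2 \<noteq> 0"
  shows "g3 = 0" "a2 = 0" "e2 = 0" "b3 = 0" "a3 = cnj e3"
proof -
  have c: "coframe w1 w2 w3 w4" by (rule frame1D(1)[OF F])
  have f: "form w1" "form w2" "form w3" "form w4" using c by (auto simp: coframe_def)
  obtain E where E: "\<And>a b c d. w1 (E a b c d) = a" "\<And>a b c d. w2 (E a b c d) = b"
    "\<And>a b c d. w3 (E a b c d) = c" "\<And>a b c d. w4 (E a b c d) = d" using coframe_vectors[OF c] by blast
  note calc = frame1D(2-)[OF F] E Q7_def
  note J2 = form_jacobi[OF f(2), of "E 1 0 0 0" "E \<i> 0 0 0"]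
    and K2 = form_jacobi[OF f(2)]
  have "h2 * g3 = 0"
    using K2[of "E 0 1 0 0" "E 0 \<i> 0 0" "E 1 0 0 0"] K2[of "E 0 1 0 0" "E 0 \<i> 0 0" "E \<i> 0 0 0"]
    by (simp add: calc complex_eq_iff algebra_simps)
  then show "g3 = 0" using h2 by simp
  have *: "- e2 * cnj e2 - h2 * cnj e3 + h2 * a3 = 0"
    "- e2 * cnj a2 - h2 * cnj a3 + h2 * e3 = 0"
    "- a2 * h2 - e2 * cnj h2 + h2 * b3 = 0"
    "- e2 * cnj b2 - h2 * cnj b3 = 0"
    using J2[of "E 0 1 0 0"] J2[of "E 0 \<i> 0 0"] J2[of "E 0 0 1 0"] J2[of "E 0 0 \<i> 0"]
    by (simp_all add: calc complex_eq_iff algebra_simps)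
  \<comment> \<open>If not, the conjugate of the first relation and the second give
    \<open>a2 * h2 + e2 * cnj h2 = 0\<close>. Then the third and fourth yield \<open>b3 = 0\<close>
    and \<open>b2 = 0\<close>, hence \<open>a2 = 0\<close>, and the third fails.\<close>
  have e2: "e2 = 0"
  proof (rule ccontr)
    assume e2: "e2 \<noteq> 0"
    have "cnj (- e2 * cnj e2 - h2 * cnj e3 + h2 * a3) = 0" using *(1) by simp
    then have "- e2 * cnj e2 - cnj h2 * e3 + cnj h2 * cnj a3 = 0" by (simp add: algebra_simps)
    then have "e2 * (cnj h2 * cnj a2 + h2 * cnj e2) = 0" using *(2) by algebra
    then have "cnj h2 * cnj a2 + h2 * cnj e2 = 0" using e2 by simp
    then have "cnj (cnj h2 * cnj a2 + h2 * cnj e2) = 0" by simp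
    then have "a2 * h2 + e2 * cnj h2 = 0" by (simp add: algebra_simps)
    then have "h2 * b3 = 0" using *(3) by algebra
    then have b3: "b3 = 0" using h2 by simp
    then have "b2 = 0" using *(4) e2 by simp
    then have "a2 = 0" by (rule frame1_coefficients(4)[OF F])
    then show False using *(3) b3 e2 h2 by simp
  qed
  then show b3: "b3 = 0" using *(4) h2 by simp
  then show "a2 = 0" using *(3) e2 h2 by simp
  have "h2 * (a3 - cnj e3) = 0" using *(1) e2 by (simp add: algebra_simps)
  then show "a3 = cnj e3" using h2 by simp
  show "e2 = 0" by (rule e2)
qed

text \<open>The roles of \<open>w2\<close> and \<open>w3\<close> are exchanged: \<open>w3\<close>
  becomes the second form and \<open>f4 * w2\<close> the third. The factor \<open>f4\<close> turns
  the Jacobi relation for \<open>b2\<close> into the coefficient \<open>- cnj C\<close> required by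
  \<open>std2\<close>.\<close>

lemma frame1_std2:
  assumes F: "frame1 w1 w2 w3 w4 0 b2 c2 0 0 0 h2 0 0 0 0 0 0 0 a4 b4 c4 e4 f4 g4 h4"
    and h2: "h2 \<noteq> 0"
  shows "has_std2_0 br"
proof -
  have c: "coframe w1 w2 w3 w4" by (rule frame1D(1)[OF F])
  have f: "form w1" "form w2" "form w3" "form w4" using c by (auto simp: coframe_def)
  obtain E where E: "\<And>a b c d. w1 (E a b c d) = a" "\<And>a b c d. w2 (E a b c d) = b"
    "\<And>a b c d. w3 (E a b c d) = c" "\<And>a b c d. w4 (E a b c d) = d" using coframe_vectors[OF c] by blast
  note calc = frame1D(2-)[OF F] E Q7_def
  note J3 = form_jacobi[OF f(3), of "E 1 0 0 0" "E \<i> 0 0 0"]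
    and K3 = form_jacobi[OF f(3)]
    and J4 = form_jacobi[OF f(4), of "E 1 0 0 0" "E \<i> 0 0 0"]
    and K4 = form_jacobi[OF f(4)]
  have 4: "a4 = 0 \<and> b4 = 0 \<and> cnj e4 = f4 \<and> Im g4 = 0 \<and> Re h4 = 0"
    using J3[of "E 0 1 0 0"] J3[of "E 0 \<i> 0 0"] J3[of "E 0 0 1 0"] J3[of "E 0 0 \<i> 0"]
      K3[of "E 1 0 0 0" "E 0 1 0 0" "E 0 \<i> 0 0"] K3[of "E \<i> 0 0 0" "E 0 1 0 0" "E 0 \<i> 0 0"]
    by (simp add: calc complex_eq_iff algebra_simps)
  have "Re h2 * Re g4 = 0 \<and> Im h2 * Re g4 = 0"
    using K4[of "E 1 0 0 0" "E 0 1 0 0" "E 0 0 1 0"] K4[of "E 1 0 0 0" "E 0 1 0 0" "E 0 0 \<i> 0"]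
      K4[of "E \<i> 0 0 0" "E 0 1 0 0" "E 0 0 1 0"] K4[of "E \<i> 0 0 0" "E 0 1 0 0" "E 0 0 \<i> 0"]
      K4[of "E 1 0 0 0" "E 0 \<i> 0 0" "E 0 0 1 0"] K4[of "E \<i> 0 0 0" "E 0 \<i> 0 0" "E 0 0 1 0"] 4
    by (auto simp add: calc complex_eq_iff algebra_simps)
  then have g4: "g4 = 0" using h2 4 by (auto simp: complex_eq_iff)
  have e4: "e4 = cnj f4" and 4: "a4 = 0" "b4 = 0" "Re h4 = 0" using 4 by auto
  have *: "f4 * b2 = - (cnj f4 * cnj h2)"
    using J4[of "E 0 0 1 0"] J4[of "E 0 0 \<i> 0"] 4
    by (auto simp add: calc e4 complex_eq_iff algebra_simps)
  have f4: "f4 \<noteq> 0"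
  proof
    assume f4: "f4 = 0"
    have "w2 (E 0 1 0 0) = 0"
      by (rule coframe_central(2)[OF c]) (simp_all add: calc f4 e4 g4 4)
    then show False by (simp add: E)
  qed
  have "std2 br w1 w3 (\<lambda>X. f4 * w2 X) (\<lambda>X. Re (w4 X)) (\<lambda>X. Im (w4 X)) 0 (- 2 * Im c4) (f4 * c2)
      (f4 * h2) (2 * Re c4) (2 * Im h4) 2"
    unfolding std2_def
  proof (intro conjI allI impI)
    show "linear w1" "linear w3" "linear (\<lambda>X. f4 * w2 X)" using f form_mult[OF f(2)] by (auto simp: form_def)
    show "linear (\<lambda>X. Re (w4 X))" "linear (\<lambda>X. Im (w4 X))"
      using f(4) by (auto intro!: linearI simp: form_lin)
    show "X = 0" if "w1 X = 0 \<and> w3 X = 0 \<and> f4 * w2 X = 0 \<and> Re (w4 X) = 0 \<and> Im (w4 X) = 0" for X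
      by (rule coframe_inj[OF c]) (use that f4 complex_eq_iff[of "w4 X" 0] in auto)
    fix X Y
    show "w1 (br X Y) = 0" by (simp add: calc)
    show "w3 (br X Y) = complex_of_real (Re (w4 X)) * w1 Y - complex_of_real (Re (w4 Y)) * w1 X" by (simp add: calc)
    show "Re (w4 (br X Y)) = - 2 * Im c4 * Im (w1 X * cnj (w1 Y))"
      using 4 by (simp add: calc g4 e4 algebra_simps)
    have "f4 * w2 (br X Y) = (f4 * b2) * (w1 X * w3 Y - w3 X * w1 Y) +
        f4 * c2 * (w1 X * cnj (w1 Y) - w1 Y * cnj (w1 X)) +
        f4 * h2 * (w1 X * cnj (w3 Y) - w1 Y * cnj (w3 X) - w3 X * cnj (w1 Y) + w3 Y * cnj (w1 X))"
      by (simp add: calc algebra_simps)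
    then show "f4 * w2 (br X Y) = complex_of_real 0 * (complex_of_real (Re (w4 X)) * w3 Y - complex_of_real (Re (w4 Y)) * w3 X) -
        cnj (f4 * h2) * (w1 X * w3 Y - w3 X * w1 Y) +
        f4 * c2 * (w1 X * cnj (w1 Y) - w1 Y * cnj (w1 X)) +
        f4 * h2 * (w1 X * cnj (w3 Y) - w1 Y * cnj (w3 X) - w3 X * cnj (w1 Y) + w3 Y * cnj (w1 X))"
      unfolding * by simp
    show "Im (w4 (br X Y)) = 2 * Re c4 * Im (w1 X * cnj (w1 Y)) +
        2 * Im h4 * (Re (w1 X * cnj (w3 Y)) - Re (w1 Y * cnj (w3 X))) +
        2 * (Im (w1 X * cnj (f4 * w2 Y)) - Im (w1 Y * cnj (f4 * w2 X)) - 0 * Im (w3 X * cnj (w3 Y)))"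
      using 4 by (simp add: calc g4 e4 algebra_simps)
  qed
  moreover have "(2::real) \<noteq> 0" "f4 * h2 \<noteq> 0" using f4 h2 by auto
  ultimately show ?thesis by blast
qed

lemma frame1_h2_zero:
  assumes F: "frame1 w1 w2 w3 w4 a2 b2 c2 e2 0 0 0 a3 b3 c3 e3 f3 g3 0 a4 b4 c4 e4 f4 g4 h4"
  shows "e2 = 0" "b2 * f3 = 0" "b2 * g3 = 0"
proof -
  have c: "coframe w1 w2 w3 w4" by (rule frame1D(1)[OF F])
  have f: "form w1" "form w2" "form w3" "form w4" using c by (auto simp: coframe_def)
  obtain E where E: "\<And>a b c d. w1 (E a b c d) = a" "\<And>a b c d. w2 (E a b c d) = b"
    "\<And>a b c d. w3 (E a b c d) = c" "\<And>a b c d. w4 (E a b c d) = d" using coframe_vectors[OF c] by blast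
  note calc = frame1D(2-)[OF F] E Q7_def
  note J2 = form_jacobi[OF f(2), of "E 1 0 0 0" "E \<i> 0 0 0"]
    and K2 = form_jacobi[OF f(2)]
  have *: "b2 * g3 = 0 \<and> e2 * cnj e2 = b2 * f3 - e2 * cnj a2 \<and> e2 * cnj b2 = 0"
    using J2[of "E 0 1 0 0"] J2[of "E 0 \<i> 0 0"] J2[of "E 0 0 1 0"] J2[of "E 0 0 \<i> 0"]
      K2[of "E 1 0 0 0" "E 0 1 0 0" "E 0 \<i> 0 0"] K2[of "E \<i> 0 0 0" "E 0 1 0 0" "E 0 \<i> 0 0"]
    by (simp add: calc complex_eq_iff algebra_simps)
  show "b2 * g3 = 0" using * by blast
  show e2: "e2 = 0"
  proof (cases "b2 = 0")
    case True
    then have "a2 = 0" by (rule frame1_coefficients(4)[OF F])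
    then show ?thesis using * True by simp
  next
    case False
    then show ?thesis using * by simp
  qed
  have "e2 * cnj e2 = b2 * f3 - e2 * cnj a2" using * by blast
  then show "b2 * f3 = 0" by (simp add: e2)
qed

text \<open>If \<open>b2\<close> were nonzero, trace and determinant of \<open>M\<close> along the
  first vector would give \<open>a2 = a3 = 0\<close>; the Jacobi identity would then remove the
  terms of \<open>w4\<close> in \<open>w2\<close>, and the second vector would be central.\<close>

lemma frame1_b2_nonzero:
  assumes F: "frame1 w1 w2 w3 w4 a2 b2 c2 0 0 0 0 a3 0 c3 0 0 0 0 a4 b4 c4 e4 f4 g4 h4"
  shows "b2 = 0"
proof (rule ccontr)
  assume b2: "b2 \<noteq> 0"
  have c: "coframe w1 w2 w3 w4" by (rule frame1D(1)[OF F])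
  have f: "form w1" "form w2" "form w3" "form w4" using c by (auto simp: coframe_def)
  obtain E where E: "\<And>a b c d. w1 (E a b c d) = a" "\<And>a b c d. w2 (E a b c d) = b"
    "\<And>a b c d. w3 (E a b c d) = c" "\<And>a b c d. w4 (E a b c d) = d" using coframe_vectors[OF c] by blast
  note calc = frame1D(2-)[OF F] E Q7_def
  note J3 = form_jacobi[OF f(3), of "E 1 0 0 0" "E \<i> 0 0 0"]
    and K3 = form_jacobi[OF f(3)]
    and J4 = form_jacobi[OF f(4), of "E 1 0 0 0" "E \<i> 0 0 0"]
    and K4 = form_jacobi[OF f(4)]
  have 4: "b4 = 0 \<and> a4 = 0"
    using J3[of "E 0 1 0 0"] J3[of "E 0 \<i> 0 0"] J3[of "E 0 0 1 0"] J3[of "E 0 0 \<i> 0"]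
      K3[of "E 1 0 0 0" "E 0 1 0 0" "E 0 \<i> 0 0"] K3[of "E \<i> 0 0 0" "E 0 1 0 0" "E 0 \<i> 0 0"]
    by (simp add: calc complex_eq_iff algebra_simps)
  let ?S = "{Y. w1 Y = 0 \<and> w4 Y = 0}"
  have 1: "w2 (M (E 1 0 0 0) Y) = 2 * a2 * w2 Y + 2 * b2 * w3 Y" if "Y \<in> ?S" for Y
    using that by (simp add: form_M f form_lin(6) calc algebra_simps)
  have 2: "w3 (M (E 1 0 0 0) Y) = 2 * a3 * w2 Y + 0 * w3 Y" if "Y \<in> ?S" for Y
    using that by (simp add: form_M f form_lin(6) calc algebra_simps)
  have 3: "\<exists>Y\<in>?S. w2 Y = x \<and> w3 Y = y" for x y
    by (rule bexI[of _ "E 0 x y 0"]) (simp_all add: E)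
  have S: "M (E 1 0 0 0) Y \<in> ?S" if "Y \<in> ?S" for Y using that 4 by (simp add: form_M f form_lin(6) calc algebra_simps)
  have "2 * a2 + 0 = 0" by (rule M_2x2(1)[OF f(2,3) S 1 2 3])
  then have a2: "a2 = 0" by simp
  have "2 * a2 * 0 = 2 * b2 * (2 * a3)" by (rule M_2x2(2)[OF f(2,3) S 1 2 3])
  then have a3: "a3 = 0" using b2 by simp
  have "b2 * g4 = 0 \<and> b2 * f4 = 0 \<and> cnj b2 * e4 = 0"
    using J4[of "E 0 1 0 0"] J4[of "E 0 \<i> 0 0"] J4[of "E 0 0 1 0"] J4[of "E 0 0 \<i> 0"]
      K4[of "E 1 0 0 0" "E 0 1 0 0" "E 0 0 1 0"] K4[of "E 1 0 0 0" "E 0 1 0 0" "E 0 0 \<i> 0"]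
      K4[of "E \<i> 0 0 0" "E 0 1 0 0" "E 0 0 1 0"] K4[of "E \<i> 0 0 0" "E 0 1 0 0" "E 0 0 \<i> 0"]
    by (auto simp add: calc a2 a3 4 complex_eq_iff algebra_simps)
  then have 44: "g4 = 0" "f4 = 0" "e4 = 0" using b2 by auto
  have "w2 (E 0 1 0 0) = 0"
    by (rule coframe_central(2)[OF c]) (simp_all add: calc a2 a3 4 44)
  then show False by (simp add: E)
qed

lemma frame1_std1:
  assumes F: "frame1 w1 w2 w3 w4 0 0 c2 0 0 0 0 a3 0 c3 e3 f3 g3 0 a4 0 c4 e4 f4 g4 h4"
  shows "has_std1 br"
proof -
  have c: "coframe w1 w2 w3 w4" by (rule frame1D(1)[OF F])
  have f: "form w1" "form w2" "form w3" "form w4" using c by (auto simp: coframe_def)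
  obtain E where E: "\<And>a b c d. w1 (E a b c d) = a" "\<And>a b c d. w2 (E a b c d) = b"
    "\<And>a b c d. w3 (E a b c d) = c" "\<And>a b c d. w4 (E a b c d) = d" using coframe_vectors[OF c] by blast
  note calc = frame1D(2-)[OF F] E Q7_def
  note J3 = form_jacobi[OF f(3), of "E 1 0 0 0" "E \<i> 0 0 0"]
    and K3 = form_jacobi[OF f(3)]
    and J4 = form_jacobi[OF f(4), of "E 1 0 0 0" "E \<i> 0 0 0"]
    and K4 = form_jacobi[OF f(4)]
  have h4: "Re h4 = 0 \<and> Im g4 = 0"
    using J3[of "E 0 1 0 0"] J3[of "E 0 \<i> 0 0"] J3[of "E 0 0 1 0"] J3[of "E 0 0 \<i> 0"]
      K3[of "E 1 0 0 0" "E 0 1 0 0" "E 0 \<i> 0 0"] K3[of "E \<i> 0 0 0" "E 0 1 0 0" "E 0 \<i> 0 0"]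
    by (simp add: calc complex_eq_iff algebra_simps)
  \<comment> \<open>Otherwise the vector dual to \<open>w3\<close> would be central.\<close>
  have h0: "h4 \<noteq> 0"
  proof
    assume h: "h4 = 0"
    have "w3 (E 0 0 1 0) = 0"
      by (rule coframe_central(3)[OF c]) (simp_all add: calc h)
    then show False by (simp add: E)
  qed
  have g3: "h4 * g3 = 0"
    using K4[of "E 1 0 0 0" "E 0 1 0 0" "E 0 \<i> 0 0"] K4[of "E \<i> 0 0 0" "E 0 1 0 0" "E 0 \<i> 0 0"] h4
    by (simp add: calc complex_eq_iff algebra_simps)
  then have g3: "g3 = 0" using h0 by simp
  have 4: "a4 = 0 \<and> cnj e4 = f4"
    using J3[of "E 0 1 0 0"] J3[of "E 0 \<i> 0 0"]
    by (simp add: calc g3 complex_eq_iff algebra_simps)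
  then have f4: "f4 = cnj e4" and a4: "a4 = 0" by simp_all
  have *: "h4 * (a3 - cnj e3) + g4 * cnj c2 = 0"
    using J4[of "E 0 1 0 0"] J4[of "E 0 \<i> 0 0"] h4
    by (simp add: calc g3 f4 a4 complex_eq_iff algebra_simps)
  have "f3 \<noteq> 0 \<or> 2 * Re g4 \<noteq> 0"
  proof (rule ccontr)
    assume "\<not> ?thesis"
    then have f3: "f3 = 0" and g4: "g4 = 0" using h4 by (auto simp: complex_eq_iff)
    then have a3: "a3 = cnj e3" using * h0 by simp
    \<comment> \<open>Without \<open>f3\<close> and \<open>g4\<close> the vector with coordinates 0,
      1, \<open>x\<close>, \<open>2 * Re e3\<close> would be central: \<open>x\<close> cancels its
      brackets in \<open>w4\<close>, and the last coordinate those in \<open>w3\<close>.\<close>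
    define x where "x = cnj e4 / h4"
    have hx: "h4 * x = cnj e4" using h0 by (simp add: x_def)
    have "cnj h4 = - h4" using h4 by (simp add: complex_eq_iff)
    then have hc: "h4 * cnj x = - e4" using h0 by (simp add: x_def)
    have "w4 (br (E 0 1 x (2 * Re e3)) Y) = - (e4 + h4 * cnj x) * w1 Y + (cnj e4 - h4 * x) * cnj (w1 Y)" for Y
      by (simp add: calc f4 g4 a4 algebra_simps)
    then have w4: "w4 (br (E 0 1 x (2 * Re e3)) Y) = 0" for Y by (simp add: hc hx)
    have w3: "w3 (br (E 0 1 x (2 * Re e3)) Y) = 0" for Y
      by (simp add: calc g3 f3 a3 complex_eq_iff algebra_simps)
    have "w2 (E 0 1 x (2 * Re e3)) = 0"
      by (rule coframe_central(2)[OF c _ _ w3 w4]) (simp_all add: calc)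
    then show False by (simp add: E)
  qed
  moreover have "2 * Im h4 \<noteq> 0" using h0 h4 by (auto simp: complex_eq_iff)
  moreover have "std1 br w1 w2 w3 (\<lambda>X. Re (w4 X)) (\<lambda>X. Im (w4 X)) (- 2 * Im c4) c2 a3 c3 e3 f3 (2 * Re
      c4) (2 * e4) (2 * Re g4) (2 * Im h4)"
    unfolding std1_def
  proof (intro conjI allI impI)
    show "linear w1" "linear w2" "linear w3" using f by (auto simp: form_def)
    show "linear (\<lambda>X. Re (w4 X))" "linear (\<lambda>X. Im (w4 X))"
      using f(4) by (auto intro!: linearI simp: form_lin)
    show "X = 0" if "w1 X = 0 \<and> w2 X = 0 \<and> w3 X = 0 \<and> Re (w4 X) = 0 \<and> Im (w4 X) = 0" for X
      by (rule coframe_inj[OF c]) (use that complex_eq_iff[of "w4 X" 0] in auto)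
    have "h4 = \<i> * Im h4" "g4 = Re g4" using h4 by (simp_all add: complex_eq_iff)
    then have "\<i> * Im h4 * (a3 - cnj e3) + Re g4 * cnj c2 = 0" using * by metis
    then show "complex_of_real (2 * Im h4) * (a3 - cnj e3) = \<i> * complex_of_real (2 * Re g4) * cnj c2"
      by (simp add: complex_eq_iff)
  qed (use h4 in \<open>simp_all add: calc g3 f4 a4 algebra_simps\<close>)
  ultimately show ?thesis by blast
qed

lemma frame1_cases:
  assumes F: "frame1 w1 w2 w3 w4 a2 b2 c2 e2 0 0 h2 a3 b3 c3 e3 f3 g3 0 a4 b4 c4 e4 f4 g4 h4" and "h2 = 0 \<or> f3 = 0"
  shows "has_std1 br \<or> has_std2_0 br"
proof (cases "h2 = 0")
  case True
  note F = F[unfolded True]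
  have e2: "e2 = 0" by (rule frame1_h2_zero(1)[OF F])
  have "b2 = 0"
  proof (rule ccontr)
    assume b2: "b2 \<noteq> 0"
    then have "f3 = 0" "g3 = 0" using frame1_h2_zero(2,3)[OF F] by auto
    \<comment> \<open>\<open>k\<close> removes \<open>b3\<close> and \<open>l\<close> removes
      \<open>e3\<close>, which reaches the hypothesis of \<open>frame1_b2_nonzero\<close>.\<close>
    note F = frame1_shift4[OF frame1_shift3[OF F[unfolded e2 this], where k = "b3 / b2"], where l = "- cnj e3" and k = 0]
    have "b2 = 0" by (rule frame1_b2_nonzero) (use F b2 in simp)
    with b2 show False by simp
  qed
  moreover have "a2 = 0" "b3 = 0" "b4 = 0" using frame1_coefficients(4-6)[OF F] \<open>b2 = 0\<close> by auto
  ultimately have "frame1 w1 w2 w3 w4 0 0 c2 0 0 0 0 a3 0 c3 e3 f3 g3 0 a4 0 c4 e4 f4 g4 h4" using F e2 by simp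
  then show ?thesis by (intro disjI1 frame1_std1)
next
  case False
  then have f3: "f3 = 0" using assms(2) by blast
  note F = F[unfolded f3]
  note y = frame1_h2_nonzero[OF F False]
  \<comment> \<open>\<open>a3 = cnj e3\<close> lets one \<open>l\<close> remove both
    \<open>a3\<close> and \<open>e3\<close>; \<open>k\<close> removes \<open>c3\<close>.\<close>
  have "has_std2_0 br"
    by (rule frame1_std2[OF _ False])
      (use frame1_shift4[OF F, where l = "- cnj e3" and k = "- cnj c3"] y in simp)
  then show ?thesis ..
qed

lemma std_exists:
  "has_std1 br \<or> has_std2_0 br \<or> has_std2_1 br"
proof (cases "\<exists>X. D (D X) \<noteq> 0")
  case True
  then obtain X0 where "D (D X0) \<noteq> 0" ..
  from rank2_std2[OF this] show ?thesis by (intro disjI2)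
next
  case False
  then obtain w1 w2 w3 w4 a2 b2 c2 e2 f2 g2 h2 a3 b3 c3 e3 f3 g3 h3 a4 b4 c4 e4 f4 g4 h4 where
    F: "frame1 w1 w2 w3 w4 a2 b2 c2 e2 f2 g2 h2 a3 b3 c3 e3 f3 g3 h3 a4 b4 c4 e4 f4 g4 h4"
    using frame1_exists by metis
  have z: "g2 = 0" "f2 = h3" "f2 * h3 = h2 * f3" using frame1_coefficients[OF F] by blast+
  define k where "k = h3 / h2"
  note F' = frame1_shift3[OF F, where k = k]
  have k: "h3 - k * h2 = 0" using z by (cases "h2 = 0") (auto simp: k_def)
  have "f2 - k * h2 = 0" using k z by simp
  note F' = F'[unfolded z(1) this k]
  have "h2 = 0 \<or> f3 - k * h3 - k * 0 = 0" using z by (auto simp: k_def)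
  from frame1_cases[OF F' this] show ?thesis by (rule disjE) (erule disjI1, rule disjI2, erule disjI1)
qed

end

section \<open>From structure equations to normal forms\<close>

lemma linear_cmult: "linear w \<Longrightarrow> linear (\<lambda>X. (c::complex) * w X)"
  by (auto intro!: linearI simp: linear_add linear_scale algebra_simps)

lemma linear_parts:
  assumes "linear (w :: 'a::real_vector \<Rightarrow> complex)"
  shows "linear (\<lambda>X. Re (w X))" "linear (\<lambda>X. Im (w X))"
  using assms by (auto intro!: linearI simp: linear_add linear_scale)

section \<open>Reduction of \<open>std2\<close> to the second family\<close>

lemma std2D:
  assumes "std2 br w1 w2 w3 s t m n B C b k e"
  shows "linear w1" "linear w2" "linear w3" "linear s" "linear t"
    "w1 X = 0 \<Longrightarrow> w2 X = 0 \<Longrightarrow> w3 X = 0 \<Longrightarrow> s X = 0 \<Longrightarrow> t X = 0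
        \<Longrightarrow> X = 0"
    "w1 (br X Y) = 0"
    "s (br X Y) = n * Im (w1 X * cnj (w1 Y))"
    "w2 (br X Y) = complex_of_real (s X) * w1 Y - complex_of_real (s Y) * w1 X"
    "w3 (br X Y) = complex_of_real m * (complex_of_real (s X) * w2 Y - complex_of_real (s Y) * w2 X) - cnj C * (w1 X * w2 Y - w2 X * w1 Y)
         + B * (w1 X * cnj (w1 Y) - w1 Y * cnj (w1 X))
         + C * (w1 X * cnj (w2 Y) - w1 Y * cnj (w2 X) - w2 X * cnj (w1 Y) + w2 Y * cnj (w1 X))"
    "t (br X Y) = b * Im (w1 X * cnj (w1 Y)) + k * (Re (w1 X * cnj (w2 Y)) - Re (w1 Y * cnj (w2 X)))
         + e * (Im (w1 X * cnj (w3 Y)) - Im (w1 Y * cnj (w3 X)) - m * Im (w2 X * cnj (w2 Y)))"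
  using assms unfolding std2_def by blast+

text \<open>Terms with one conjugate lose a factor \<open>cnj l\<close>, so \<open>l = cnj C\<close>
  makes a nonzero \<open>C\<close> equal to 1, and \<open>l = cnj B\<close> does the same for
  \<open>B\<close>.\<close>

lemma std2_scale:
  assumes "std2 br w1 w2 w3 s t m n B C b k e" "l \<noteq> 0"
  shows "std2 br (\<lambda>X. l * w1 X) (\<lambda>X. l * w2 X) (\<lambda>X. l * w3 X) s (\<lambda>X. (cmod l)\<^sup>2 * t X)
    m (n / (cmod l)\<^sup>2) (B / cnj l) (C / cnj l) b k e"
proof -
  note d = std2D[OF assms(1)]
  have l2: "(cmod l)\<^sup>2 \<noteq> 0" "complex_of_real ((cmod l)\<^sup>2) = l * cnj l" "cnj l \<noteq> 0"
    using assms(2) complex_norm_square[of l] by simp_all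
  have q: "l * x * cnj (l * y) = complex_of_real ((cmod l)\<^sup>2) * (x * cnj y)" for x y
    by (simp add: l2(2) del: of_real_power)
  show ?thesis unfolding std2_def
  proof (intro conjI allI impI)
    show "linear (\<lambda>X. (cmod l)\<^sup>2 * t X)" using d(5) by (auto intro!: linearI simp: linear_add linear_scale algebra_simps)
    show "X = 0" if "l * w1 X = 0 \<and> l * w2 X = 0 \<and> l * w3 X = 0 \<and> s X = 0 \<and> (cmod l)\<^sup>2 * t X = 0" for X
      by (rule d(6)) (use that assms(2) l2 in auto)
    fix X Y
    show "s (br X Y) = n / (cmod l)\<^sup>2 * Im (l * w1 X * cnj (l * w1 Y))"
      unfolding d(8) q using l2(1) by simp
    show "(cmod l)\<^sup>2 * t (br X Y) = b * Im (l * w1 X * cnj (l * w1 Y)) +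
        k * (Re (l * w1 X * cnj (l * w2 Y)) - Re (l * w1 Y * cnj (l * w2 X))) +
        e * (Im (l * w1 X * cnj (l * w3 Y)) - Im (l * w1 Y * cnj (l * w3 X)) - m * Im (l * w2 X * cnj (l * w2 Y)))"
      unfolding d(11) q by (simp add: algebra_simps)
    show "l * w3 (br X Y) = complex_of_real m * (complex_of_real (s X) * (l * w2 Y) - complex_of_real (s Y) * (l * w2 X)) -
        cnj (C / cnj l) * (l * w1 X * (l * w2 Y) - l * w2 X * (l * w1 Y)) +
        B / cnj l * (l * w1 X * cnj (l * w1 Y) - l * w1 Y * cnj (l * w1 X)) +
        C / cnj l * (l * w1 X * cnj (l * w2 Y) - l * w1 Y * cnj (l * w2 X) - l * w2 X * cnj (l * w1 Y) + l * w2 Y * cnj (l * w1 X))"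
      unfolding d(10) using l2 assms(2) by (simp add: field_simps)
  qed (simp_all add: d linear_cmult algebra_simps)
qed

text \<open>For \<open>C = 1\<close> this removes the imaginary part of \<open>B\<close>; for
  \<open>C = 0\<close> it leaves \<open>B\<close> alone and, if \<open>m = 1\<close>, removes
  \<open>k\<close>.\<close>

lemma std2_shift2:
  fixes x :: real
  assumes "std2 br w1 w2 w3 s t m n B C b k e"
  defines "v2 \<equiv> \<lambda>X. w2 X + complex_of_real x * \<i> * w1 X"
  shows "std2 br w1 v2 (\<lambda>X. w3 X + complex_of_real (m * x) * \<i> * v2 X) s t
    m n (B + 2 * x * \<i> * C) C (b - 2 * k * x - e * m * x\<^sup>2) (k + 2 * m * e * x) e"
proof -
  note d = std2D[OF assms(1)]
  have w2: "w2 X = v2 X - complex_of_real x * \<i> * w1 X" for X by (simp add: v2_def)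
  show ?thesis unfolding std2_def
  proof (intro conjI allI impI)
    show "linear v2" unfolding v2_def by (intro linear_compose_add linear_cmult d)
    then show "linear (\<lambda>X. w3 X + complex_of_real (m * x) * \<i> * v2 X)" by (intro linear_compose_add linear_cmult d)
    show "X = 0" if "w1 X = 0 \<and> v2 X = 0 \<and> w3 X + complex_of_real (m * x) * \<i> * v2 X = 0 \<and> s X = 0 \<and> t X = 0" for X
      by (rule d(6)) (use that in \<open>auto simp: v2_def\<close>)
    fix X Y
    show v: "v2 (br X Y) = complex_of_real (s X) * w1 Y - complex_of_real (s Y) * w1 X" by (simp add: v2_def d(7,9))
    show "w3 (br X Y) + complex_of_real (m * x) * \<i> * v2 (br X Y) =
        complex_of_real m * (complex_of_real (s X) * v2 Y - complex_of_real (s Y) * v2 X) - cnj C * (w1 X * v2 Y - v2 X * w1 Y) +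
        (B + 2 * x * \<i> * C) * (w1 X * cnj (w1 Y) - w1 Y * cnj (w1 X)) +
        C * (w1 X * cnj (v2 Y) - w1 Y * cnj (v2 X) - v2 X * cnj (w1 Y) + v2 Y * cnj (w1 X))"
      unfolding v d(10) w2 by (simp add: algebra_simps)
    show "t (br X Y) = (b - 2 * k * x - e * m * x\<^sup>2) * Im (w1 X * cnj (w1 Y)) +
        (k + 2 * m * e * x) * (Re (w1 X * cnj (v2 Y)) - Re (w1 Y * cnj (v2 X))) +
        e * (Im (w1 X * cnj (w3 Y + complex_of_real (m * x) * \<i> * v2 Y)) - Im (w1 Y * cnj (w3 X + complex_of_real (m
            * x) * \<i> * v2 X)) -
         m * Im (v2 X * cnj (v2 Y)))"
      unfolding d(11) w2 by (simp add: algebra_simps power2_eq_square)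
  qed (use d in \<open>simp_all add: linear_cmult algebra_simps\<close>)
qed

lemma std2_shift1:
  assumes "std2 br w1 w2 w3 s t m n B C b k e"
  shows "std2 br w1 w2 (\<lambda>X. w3 X + complex_of_real x * w1 X) s t m n B C (b - 2 * e * x) k e"
proof -
  note d = std2D[OF assms(1)]
  show ?thesis unfolding std2_def
  proof (intro conjI allI impI)
    show "linear (\<lambda>X. w3 X + complex_of_real x * w1 X)" by (intro linear_compose_add linear_cmult d)
    show "X = 0" if "w1 X = 0 \<and> w2 X = 0 \<and> w3 X + complex_of_real x * w1 X = 0 \<and> s X = 0 \<and> t X = 0" for X
      by (rule d(6)) (use that in auto)
  qed (use d in \<open>simp_all add: algebra_simps\<close>)
qed

text \<open>For \<open>C = 1\<close> the real part of the differential of \<open>w3\<close> pairs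
  the real parts of \<open>w1, w2\<close> with coefficient 1 and the imaginary parts with
  coefficient 3; stretching the latter by sqrt 3 gives \<open>e 1 4 + e 2 5\<close>.\<close>

lemma std2_nf2c:
  fixes br :: "'a::euclidean_space \<Rightarrow> 'a \<Rightarrow> 'a"
  assumes "std2 br w1 w2 w3 s t m n (complex_of_real B) 1 0 k e" "e \<noteq> 0" "DIM('a) = 8"
  shows "lie_isomorphic br (nf2c m (- n / sqrt 3) (- 2 * B) (k / (sqrt 3 * e)))"
proof (rule lie_isomorphic_coframe)
  note d = std2D[OF assms(1)]
  define r where "r = sqrt 3"
  have r: "r * r = 3" "r \<noteq> 0" "r * (r * x) = 3 * x" for x by (auto simp: r_def)
  let ?w = "\<lambda>X. vector [r * Im (w1 X), Re (w1 X), - s X, r * Im (w2 X), Re (w2 X), Re (w3 X), - r * Im (w3 X),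
      r * t X / e] :: real^8"
  show "linear ?w" using d(1-5)
    by (intro linearI) (simp_all add: vec8_eq_iff linear_add linear_scale algebra_simps add_divide_distrib)
  show "X = 0" if "?w X = 0" for X
    by (rule d(6)) (use that assms(2) r in \<open>auto simp: vec8_eq_iff complex_eq_iff\<close>)
  show "?w (br X Y) = - nf2c m (- n / sqrt 3) (- 2 * B) (k / (sqrt 3 * e)) (?w X) (?w Y)" for X Y
    using assms(2) r(2) by (simp add: vec8_eq_iff nf2c_def ce_bracket_def d(7-11) r_def[symmetric] field_simps r(3))
qed (rule nf2c_def, rule assms(3))

lemma std2_nf2_0:
  fixes br :: "'a::euclidean_space \<Rightarrow> 'a \<Rightarrow> 'a"
  assumes "std2 br w1 w2 w3 s t 1 0 (complex_of_real B) 0 0 0 e" "e \<noteq> 0" "DIM('a) = 8"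
  shows "lie_isomorphic br (nf2 1 0 0 (- 2 * B) 0)"
proof (rule lie_isomorphic_coframe)
  note d = std2D[OF assms(1)]
  let ?w = "\<lambda>X. vector [Im (w1 X), Re (w1 X), - s X, Im (w2 X), Re (w2 X), Re (w3 X), - Im (w3 X), t X / e] :: real^8"
  show "linear ?w" using d(1-5)
    by (intro linearI) (simp_all add: vec8_eq_iff linear_add linear_scale algebra_simps add_divide_distrib)
  show "X = 0" if "?w X = 0" for X
    by (rule d(6)) (use that assms(2) in \<open>auto simp: vec8_eq_iff complex_eq_iff\<close>)
  show "?w (br X Y) = - nf2 1 0 0 (- 2 * B) 0 (?w X) (?w Y)" for X Y
    using assms(2) by (simp add: vec8_eq_iff nf2_def ce_bracket_def d(7-11) field_simps)
qed (rule nf2_def, rule assms(3))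

lemma std2_isomorphic:
  fixes br :: "'a::euclidean_space \<Rightarrow> 'a \<Rightarrow> 'a"
  assumes "std2 br w1 w2 w3 s t m n B C b k e" "e \<noteq> 0" "DIM('a) = 8" "m = 1 \<and> n = 0 \<or> m = 0 \<and> C \<noteq> 0"
  shows "\<exists>a. admissible a \<and> lie_isomorphic br (algebra_bracket a)"
proof (cases "C = 0")
  case False
  define B' where "B' = B / C"
  define n' where "n' = n / (cmod (cnj C))\<^sup>2"
  obtain v1 v2 v3 t' where 1: "std2 br v1 v2 v3 s t' m n' B' 1 b k e"
    using std2_scale[OF assms(1), of "cnj C"] False by (auto simp: B'_def n'_def)
  define x where "x = - Im B' / 2"
  have B: "B' + 2 * x * \<i> * 1 = complex_of_real (Re B')" by (simp add: x_def complex_eq_iff)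
  obtain b' k' where 2: "std2 br v1 (\<lambda>X. v2 X + complex_of_real x * \<i> * v1 X)
      (\<lambda>X. v3 X + complex_of_real (m * x) * \<i> * (v2 X + complex_of_real x * \<i> * v1 X)) s t' m n'
          (complex_of_real (Re B')) 1 b' k' e"
    using std2_shift2[OF 1, where x = x, unfolded B] by blast
  obtain u1 u2 u3 where 3: "std2 br u1 u2 u3 s t' m n' (complex_of_real (Re B')) 1 0 k' e"
    using std2_shift1[OF 2, of "b' / (2 * e)"] assms(2) by auto
  have "m * (- n' / sqrt 3) = 0" using assms(4) by (auto simp: n'_def)
  then have i: "lie_isomorphic br (nf2 m (- n' / sqrt 3) 1 (- 2 * Re B') (2 * (k' / (sqrt 3 * e))))"
    using lie_isomorphic_trans[OF std2_nf2c[OF 3 assms(2,3)] nf2c_iso_nf2] by simp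
  from assms(4) show ?thesis
  proof (elim disjE conjE)
    assume "m = 1" "n = 0"
    then have "lie_isomorphic br (nf2 1 0 1 (- 2 * Re B') (2 * (k' / (sqrt 3 * e))))" using i by (simp add: n'_def)
    then show ?thesis using nf2_G11 lie_isomorphic_trans by metis
  next
    assume "m = 0"
    then show ?thesis using i nf2_G10_G12 lie_isomorphic_trans by metis
  qed
next
  case True
  then have m: "m = 1" "n = 0" using assms(4) by auto
  define l where "l = (if B = 0 then 1 else cnj B)"
  define B' :: real where "B' = (if B = 0 then 0 else 1)"
  have l: "l \<noteq> 0" "B / cnj l = complex_of_real B'" by (auto simp: l_def B'_def)
  obtain v1 v2 v3 t' where 1: "std2 br v1 v2 v3 s t' 1 0 (complex_of_real B') 0 b k e"
    using std2_scale[OF assms(1) l(1)] unfolding l(2) m True by auto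
  define x where "x = - k / (2 * e)"
  have *: "k + 2 * 1 * e * x = 0" "complex_of_real B' + 2 * x * \<i> * 0 = complex_of_real B'"
    using assms(2) by (simp_all add: x_def)
  obtain b' where 2: "std2 br v1 (\<lambda>X. v2 X + complex_of_real x * \<i> * v1 X)
      (\<lambda>X. v3 X + complex_of_real (1 * x) * \<i> * (v2 X + complex_of_real x * \<i> * v1 X)) s t' 1 0 (complex_of_real B') 0 b' 0 e"
    using std2_shift2[OF 1, where x = x, unfolded *] by blast
  obtain u2 u3 where 3: "std2 br v1 u2 u3 s t' 1 0 (complex_of_real B') 0 0 0 e"
    using std2_shift1[OF 2, of "b' / (2 * e)"] assms(2) by auto
  show ?thesis using std2_nf2_0[OF 3 assms(2,3)] nf2_G9 lie_isomorphic_trans by metis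
qed

section \<open>Reduction of \<open>std1\<close> to the first family\<close>

lemma std1D:
  assumes "std1 br w1 w2 w3 s t n C A B E F b f G h"
  shows "linear w1" "linear w2" "linear w3" "linear s" "linear t"
    "w1 X = 0 \<Longrightarrow> w2 X = 0 \<Longrightarrow> w3 X = 0 \<Longrightarrow> s X = 0 \<Longrightarrow> t X = 0
        \<Longrightarrow> X = 0"
    "complex_of_real h * (A - cnj E) = \<i> * complex_of_real G * cnj C"
    "w1 (br X Y) = 0"
    "s (br X Y) = n * Im (w1 X * cnj (w1 Y))"
    "w2 (br X Y) = C * (w1 X * cnj (w1 Y) - w1 Y * cnj (w1 X))"
    "w3 (br X Y) = complex_of_real (s X) * w1 Y - complex_of_real (s Y) * w1 X + A * (w1 X * w2 Y - w2 X * w1 Y)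
         + B * (w1 X * cnj (w1 Y) - w1 Y * cnj (w1 X)) + E * (w1 X * cnj (w2 Y) - w1 Y * cnj (w2 X))
         + F * (w2 X * cnj (w1 Y) - w2 Y * cnj (w1 X))"
    "t (br X Y) = b * Im (w1 X * cnj (w1 Y)) + Im (f * (w1 X * cnj (w2 Y) - w1 Y * cnj (w2 X)))
         + G * Im (w2 X * cnj (w2 Y)) + h * Re (w1 X * cnj (w3 Y) - w1 Y * cnj (w3 X))"
  using assms unfolding std1_def by blast+

lemma std1_shift3:
  assumes "std1 br w1 w2 w3 s t n C A B E F b f G h"
  shows "std1 br w1 w2 (\<lambda>X. w3 X + (p * w2 X + complex_of_real x * \<i> * w1 X)) s t n C A (B + p * C) E F
    (b - 2 * h * x) (f - \<i> * h * cnj p) G h"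
proof -
  note d = std1D[OF assms]
  show ?thesis unfolding std1_def
  proof (intro conjI allI impI)
    show "linear (\<lambda>X. w3 X + (p * w2 X + complex_of_real x * \<i> * w1 X))" by (intro linear_compose_add linear_cmult d)
    show "X = 0" if "w1 X = 0 \<and> w2 X = 0 \<and> w3 X + (p * w2 X + complex_of_real x * \<i> * w1 X) = 0 \<and> s X
        = 0 \<and> t X = 0" for X
      by (rule d(6)) (use that in auto)
  qed (use d(7) in \<open>simp_all add: d(1-5,8-12) algebra_simps\<close>)
qed

text \<open>\<open>p\<close> removes \<open>B\<close>, and \<open>q = - (A + cnj E) / 2\<close>
  achieves \<open>E = - cnj A\<close>; the constrained quantity \<open>A - cnj E\<close> is
  untouched.\<close>

lemma std1_shift_s:
  assumes "std1 br w1 w2 w3 s t n C A B E F b f G h"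
  shows "std1 br w1 w2 w3 (\<lambda>X. s X + Re (2 * (p * w1 X + q * w2 X))) t (n - 4 * Im (q * C)) C (A + q) (B + cnj
      p) (E + cnj q) F b f G h"
proof -
  note d = std1D[OF assms]
  show ?thesis unfolding std1_def
  proof (intro conjI allI impI)
    show "linear (\<lambda>X. s X + Re (2 * (p * w1 X + q * w2 X)))"
      by (intro linear_compose_add linear_cmult linear_parts d)
    show "X = 0" if "w1 X = 0 \<and> w2 X = 0 \<and> w3 X = 0 \<and> s X + Re (2 * (p * w1 X + q * w2 X)) = 0 \<and> t X = 0" for X
      by (rule d(6)) (use that in auto)
    fix X Y
    show "w3 (br X Y) = complex_of_real (s X + Re (2 * (p * w1 X + q * w2 X))) * w1 Y - complex_of_real (s Y + Re (2 *
        (p * w1 Y + q * w2 Y))) * w1 X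
         + (A + q) * (w1 X * w2 Y - w2 X * w1 Y)
         + (B + cnj p) * (w1 X * cnj (w1 Y) - w1 Y * cnj (w1 X)) + (E + cnj q) * (w1 X * cnj (w2 Y) - w1 Y * cnj (w2 X))
         + F * (w2 X * cnj (w1 Y) - w2 Y * cnj (w1 X))"
      unfolding d(11) by (simp add: complex_eq_iff algebra_simps)
  qed (use d(7) in \<open>simp_all add: d(1-5,8-12) algebra_simps\<close>)
qed

text \<open>A unit \<open>u\<close> preserves all products of \<open>w1\<close> and
  \<open>w3\<close> with conjugates, so only \<open>r\<close> and the phase \<open>u\<^sup>2\<close>
  remain for normalising \<open>C\<close> and \<open>F\<close>.\<close>

lemma std1_scale:
  assumes "std1 br w1 w2 w3 s t n C A 0 E F 0 0 G h" "u * cnj u = 1" "r \<noteq> 0"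
  shows "std1 br (\<lambda>X. u * w1 X) (\<lambda>X. r * w2 X) (\<lambda>X. u * w3 X) s t n (r * C) (A / r) 0 (E / cnj
      r) (u\<^sup>2 * F / r) 0 0 (G / (cmod r)\<^sup>2) h"
proof -
  note d = std1D[OF assms(1)]
  have u: "u \<noteq> 0" using assms(2) by auto
  have uq: "u * x * cnj (u * y) = x * cnj y" for x y
    using assms(2) by (simp add: algebra_simps)
  have r: "complex_of_real ((cmod r)\<^sup>2) = r * cnj r" "(cmod r)\<^sup>2 \<noteq> 0" using complex_norm_square[of
      r] assms(3) by simp_all
  have rq: "r * x * cnj (r * y) = complex_of_real ((cmod r)\<^sup>2) * (x * cnj y)" for x y
    by (simp add: r(1) del: of_real_power)
  have uu: "cnj u = 1 / u" using assms(2) u by (simp add: field_simps)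
  show ?thesis unfolding std1_def
  proof (intro conjI allI impI)
    show "X = 0" if "u * w1 X = 0 \<and> r * w2 X = 0 \<and> u * w3 X = 0 \<and> s X = 0 \<and> t X = 0" for X
      by (rule d(6)) (use that assms(3) u in auto)
    have "complex_of_real h * (A / r - cnj (E / cnj r)) = complex_of_real h * (A - cnj E) / r"
      by (simp flip: diff_divide_distrib)
    also have "\<dots> = \<i> * complex_of_real (G / (cmod r)\<^sup>2) * cnj (r * C)"
      unfolding d(7) using assms(3) by (simp add: r(1) del: of_real_power)
    finally show "complex_of_real h * (A / r - cnj (E / cnj r)) = \<i> * complex_of_real (G / (cmod r)\<^sup>2) * cnj (r * C)" .
    fix X Y
    show "s (br X Y) = n * Im (u * w1 X * cnj (u * w1 Y))" unfolding uq d ..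
    show "r * w2 (br X Y) = r * C * (u * w1 X * cnj (u * w1 Y) - u * w1 Y * cnj (u * w1 X))" unfolding uq d by simp
    show "u * w3 (br X Y) = complex_of_real (s X) * (u * w1 Y) - complex_of_real (s Y) * (u * w1 X) +
        A / r * (u * w1 X * (r * w2 Y) - r * w2 X * (u * w1 Y)) +
        0 * (u * w1 X * cnj (u * w1 Y) - u * w1 Y * cnj (u * w1 X)) +
        E / cnj r * (u * w1 X * cnj (r * w2 Y) - u * w1 Y * cnj (r * w2 X)) +
        u\<^sup>2 * F / r * (r * w2 X * cnj (u * w1 Y) - r * w2 Y * cnj (u * w1 X))"
      unfolding d(11) using assms(3) u by (simp add: uu power2_eq_square field_simps)
    show "t (br X Y) = 0 * Im (u * w1 X * cnj (u * w1 Y)) +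
        Im (0 * (u * w1 X * cnj (r * w2 Y) - u * w1 Y * cnj (r * w2 X))) +
        G / (cmod r)\<^sup>2 * Im (r * w2 X * cnj (r * w2 Y)) +
        h * Re (u * w1 X * cnj (u * w3 Y) - u * w1 Y * cnj (u * w3 X))"
      unfolding d(12) uq rq using r(2) by simp
  qed (simp_all add: d linear_cmult)
qed

text \<open>An imaginary coefficient in the differential of \<open>w2\<close> means that
  \<open>Im (w2 X)\<close> is closed; it becomes the closed fourth coordinate of
  \<open>nf1\<close>.\<close>

lemma std1_nf1:
  fixes br :: "'a::euclidean_space \<Rightarrow> 'a \<Rightarrow> 'a"
  assumes "std1 br w1 w2 w3 s t n (\<i> * complex_of_real c) (complex_of_real (G * c / (2 * h))) 0
      (- complex_of_real (G * c / (2 * h))) (complex_of_real p) 0 0 G h" "h \<noteq> 0" "DIM('a) = 8"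
  shows "lie_isomorphic br (nf1 p (- n) (2 * c) (G / h))"
proof (rule lie_isomorphic_coframe)
  note d = std1D[OF assms(1)]
  let ?w = "\<lambda>X. vector [Re (w1 X), Im (w1 X), Re (w2 X), Im (w2 X), s X, - Re (w3 X), - Im (w3 X), - t X / h] :: real^8"
  show "linear ?w" using d(1-5)
    by (intro linearI) (simp_all add: vec8_eq_iff linear_add linear_scale algebra_simps add_divide_distrib diff_divide_distrib)
  show "X = 0" if "?w X = 0" for X
    by (rule d(6)) (use that assms(2) in \<open>auto simp: vec8_eq_iff complex_eq_iff\<close>)
  show "?w (br X Y) = - nf1 p (- n) (2 * c) (G / h) (?w X) (?w Y)" for X Y
    using assms(2) by (simp add: vec8_eq_iff nf1_def ce_bracket_def d(8-12) field_simps)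
qed (rule nf1_def, rule assms(3))

lemma unit_square_imaginary:
  obtains u and c :: real where "u * cnj u = 1" "u\<^sup>2 * x = \<i> * complex_of_real c"
proof (cases "x = 0")
  case True
  then show thesis using that[of 1 0] by simp
next
  case False
  \<comment> \<open>The phase that rotates \<open>x\<close> onto the positive imaginary axis;
    \<open>u\<close> is its square root.\<close>
  define v where "v = \<i> * cnj x / complex_of_real (cmod x)"
  have v: "cmod v = 1" "v * x = \<i> * complex_of_real (cmod x)"
    using False complex_norm_square[of x] by (simp_all add: v_def norm_mult norm_divide field_simps power2_eq_square)
  have "cmod (csqrt v) = 1" using v(1) by (simp add: norm_csqrt)
  then have "csqrt v * cnj (csqrt v) = 1" using complex_norm_square[of "csqrt v"] by simp
  then show thesis using that v(2) by (metis power2_csqrt)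
qed

lemma std1_isomorphic:
  fixes br :: "'a::euclidean_space \<Rightarrow> 'a \<Rightarrow> 'a"
  assumes S: "std1 br w1 w2 w3 s t n C A B E F b f G h" and h: "h \<noteq> 0" and FG: "F \<noteq> 0 \<or> G \<noteq> 0" and "DIM('a) = 8"
  shows "\<exists>a. admissible a \<and> lie_isomorphic br (algebra_bracket a)"
proof -
  define B1 where "B1 = B + cnj (f / (\<i> * h)) * C"
  have *: "b - 2 * h * (b / (2 * h)) = 0" "f - \<i> * complex_of_real h * cnj (cnj (f / (\<i> * complex_of_real h))) = 0"
    using h by simp_all
  obtain v3 where 1: "std1 br w1 w2 v3 s t n C A B1 E F 0 0 G h"
    using std1_shift3[OF S, where p = "cnj (f / (\<i> * h))" and x = "b / (2 * h)", unfolded *] unfolding B1_def by blast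
  define a where "a = (A - cnj E) / 2"
  have *: "A + - (A + cnj E) / 2 = a" "B1 + cnj (- cnj B1) = 0" "E + cnj (- (A + cnj E) / 2) = - cnj a"
    by (simp_all add: a_def field_simps)
  obtain n' s' where 2: "std1 br w1 w2 v3 s' t n' C a 0 (- cnj a) F 0 0 G h"
    using std1_shift_s[OF 1, where p = "- cnj B1" and q = "- (A + cnj E) / 2", unfolded *] by blast
  obtain u r and c \<phi> :: real where u: "u * cnj u = 1" "r \<noteq> 0" "r * C = \<i> * complex_of_real c" "u\<^sup>2
      * F / r = complex_of_real \<phi>"
    and \<phi>: "\<phi> = 1 \<or> \<phi> = 0 \<and> G \<noteq> 0"
  proof (cases "F = 0")
    case True
    \<comment> \<open>For \<open>F = 0\<close> only \<open>r * C\<close> has to become imaginary.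
      Otherwise \<open>r = u\<^sup>2 * F\<close> normalises \<open>F\<close> to 1, and the phase
      \<open>u\<close> is left for making \<open>r * C\<close> imaginary.\<close>
    define r where "r = (if C = 0 then 1 else \<i> * cnj C)"
    have "r \<noteq> 0" "r * C = \<i> * complex_of_real ((cmod C)\<^sup>2)"
      using complex_norm_square[of C] by (auto simp: r_def mult.commute)
    then show thesis using that[of 1 r "(cmod C)\<^sup>2" 0] True FG by simp
  next
    case False
    obtain u c where u: "u * cnj u = 1" "u\<^sup>2 * (F * C) = \<i> * complex_of_real c" using unit_square_imaginary by blast
    have "u \<noteq> 0" using u(1) by auto
    then show thesis using that[of u "u\<^sup>2 * F" c 1] False u by (simp add: mult.assoc)
  qed
  define G' where "G' = G / (cmod r)\<^sup>2"
  note 3 = std1_scale[OF 2 u(1,2), unfolded u(3,4), folded G'_def]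
  have e: "- cnj a / cnj r = - cnj (a / r)" by simp
  have "complex_of_real h * (a / r - cnj (- cnj a / cnj r)) = \<i> * complex_of_real G' * cnj (\<i> * complex_of_real c)"
    by (rule std1D(7)[OF 3])
  \<comment> \<open>With \<open>r * C\<close> imaginary the constraint determines
    \<open>a / r\<close> and makes it real; this is the origin of the terms with
    \<open>G * C / 2\<close> in \<open>nf1\<close>.\<close>
  then have a: "a / r = complex_of_real (G' * c / (2 * h))" using h u(2) by (simp add: field_simps)
  have e': "- cnj a / cnj r = - complex_of_real (G' * c / (2 * h))" unfolding e a by simp
  have i: "lie_isomorphic br (nf1 \<phi> (- n') (2 * c) (G' / h))"
    by (rule std1_nf1[OF 3[unfolded a e'] h assms(4)])
  have "\<phi> = 1 \<or> \<phi> = 0 \<and> G' / h \<noteq> 0" using \<phi> h u(2) by (auto simp: G'_def)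
  then have "\<exists>a. admissible a \<and> lie_isomorphic (nf1 \<phi> (- n') (2 * c) (G' / h)) (algebra_bracket a)"
  proof (elim disjE conjE)
    assume "\<phi> = 0" and g: "G' / h \<noteq> 0"
    show ?thesis
    proof (cases "2 * c = 0")
      case True
      have "admissible (if - n' = 0 then G7 else G8)" by simp
      then show ?thesis using nf1_G7_G8[OF g, of "- n'"] \<open>\<phi> = 0\<close> True by metis
    next
      case False
      have "admissible (if - n' = 0 then G5 else G6)" by simp
      then show ?thesis using nf1_G5_G6[OF False g, of "- n'"] \<open>\<phi> = 0\<close> by metis
    qed
  qed (use nf1_G1_to_G4 in simp)
  then show ?thesis using i lie_isomorphic_trans by metis
qed

section \<open>Passage from an abstract vector space to \<open>real^8\<close>\<close>

lemma linear_bij_euclidean: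
  assumes "dim (UNIV :: 'a::real_vector set) = DIM('b::euclidean_space)"
  obtains f :: "'a::real_vector \<Rightarrow> 'b::euclidean_space" where "linear f" "bij f"
proof -
  obtain B :: "'a set" where B: "independent B" "span B = UNIV" "card B = DIM('b)"
    using assms real_vector.basis_exists[of "UNIV :: 'a set"] by (metis UNIV_I real_vector.dim_span subset_antisym
        subset_UNIV real_vector.dim_eq_card_independent)
  have "finite B" using B(3) by (metis DIM_positive card.infinite less_irrefl)
  then obtain g where g: "bij_betw g B (Basis :: 'b set)"
    using B(3) finite_same_card_bij finite_Basis by blast
  obtain f where f: "linear f" "\<And>x. x \<in> B \<Longrightarrow> f x = g x"
    using real_vector.linear_independent_extend[OF B(1)] by blast
  obtain h :: "'b \<Rightarrow> 'a" where h: "linear h" "\<And>x. x \<in> Basis \<Longrightarrow> h x = inv_into B g x"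
    using linear_independent_extend[OF independent_Basis] by blast
  have "h (f x) = x" for x
  proof -
    have "(h \<circ> f) x = id x"
    proof (rule linear_eq_on[of _ _ x B])
      show "linear (h \<circ> f)" by (rule linear_compose[OF f(1) h(1)])
      show "(h \<circ> f) b = id b" if "b \<in> B" for b
        using that bij_betwE[OF g] bij_betw_inv_into_left[OF g that] by (simp add: f h)
    qed (use B in \<open>auto simp: linear_ident\<close>)
    then show ?thesis by simp
  qed
  moreover have "f (h x) = x" for x
  proof -
    have "(f \<circ> h) x = id x"
    proof (rule linear_eq_on[of _ _ x Basis])
      show "linear (f \<circ> h)" by (rule linear_compose[OF h(1) f(1)])
      show "(f \<circ> h) b = id b" if "b \<in> Basis" for b
        using that bij_betwE[OF bij_betw_inv_into[OF g]] bij_betw_inv_into_right[OF g that] by (simp add: f h)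
    qed (auto simp: linear_ident)
    then show ?thesis by simp
  qed
  ultimately have "bij f" by (intro o_bij[of h]) (auto simp: fun_eq_iff)
  then show thesis using that f(1) by blast
qed

lemma lie_isomorphic_properties:
  assumes iso: "linear f" "bij f" "\<And>X Y. f (br X Y) = br' (f X) (f Y)" and "lie_algebra br"
  shows "lie_algebra br'" "lie_nilpotent br \<Longrightarrow> lie_nilpotent br'" "lie_center br' = f ` lie_center br"
proof -
  define g where "g = inv f"
  have fg: "f (g X) = X" "g (f Y) = Y" for X Y
    using iso(2) by (simp_all add: g_def bij_is_surj surj_f_inv_f bij_is_inj)
  have b: "br' X Y = f (br (g X) (g Y))" for X Y by (simp add: iso(3) fg)
  have g: "linear g" unfolding g_def by (rule linear_inv[OF iso(1,2)])
  have br: "bilinear br" "br X X = 0" "br X (br Y Z) + br Y (br Z X) + br Z (br X Y) = 0" for X Y Z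
    using assms(4) by (auto simp: lie_algebra_def)
  note lin = linear_add[OF iso(1)] linear_scale[OF iso(1)] linear_add[OF g] linear_scale[OF g]
    bilinear_ladd[OF br(1)] bilinear_radd[OF br(1)] bilinear_lmul[OF br(1)] bilinear_rmul[OF br(1)]
  show "lie_algebra br'"
    unfolding lie_algebra_def bilinear_def b
    by (auto intro!: linearI simp: lin fg br(2) linear_0[OF iso(1)]) (simp flip: linear_add[OF iso(1)] add: br(3) linear_0[OF iso(1)])
  have l: "lower_central_series br' k = f ` lower_central_series br k" for k
  proof (induction k)
    case 0
    show ?case using iso(2) by (simp add: bij_is_surj)
  next
    case (Suc k)
    have "{br' X Y |X Y. Y \<in> f ` lower_central_series br k} = f ` {br X Y |X Y. Y \<in> lower_central_series br k}"
      by (auto simp: b fg image_iff) (metis fg(2))+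
    then show ?case by (simp only: lower_central_series.simps Suc.IH linear_span_image[OF iso(1)])
  qed
  show "lie_nilpotent br'" if "lie_nilpotent br"
    using that unfolding lie_nilpotent_def l by (metis image_empty image_insert linear_0[OF iso(1)])
  have c: "X \<in> lie_center br' \<longleftrightarrow> g X \<in> lie_center br" for X
    unfolding lie_center_def by (simp add: b) (metis fg linear_0[OF g] linear_0[OF iso(1)])
  show "lie_center br' = f ` lie_center br"
  proof (intro equalityI subsetI)
    show "X \<in> f ` lie_center br" if "X \<in> lie_center br'" for X
      using that by (intro image_eqI[of _ _ "g X"]) (simp_all add: c fg)
    show "X \<in> lie_center br'" if "X \<in> f ` lie_center br" for X
      using that by (auto simp: c fg)
  qed
qed

lemma subspace_center: "lie_algebra br \<Longrightarrow> subspace (lie_center br)"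
  unfolding lie_algebra_def lie_center_def subspace_def
  by (auto simp: bilinear_lzero bilinear_ladd bilinear_lmul)

lemma dim_1_span:
  assumes "subspace S" "dim S = 1"
  obtains z where "S = span {z}" "z \<noteq> 0"
proof -
  obtain B where B: "B \<subseteq> S" "independent B" "S \<subseteq> span B" "card B = dim S" using real_vector.basis_exists by metis
  then obtain z where z: "B = {z}" using assms(2) by (metis One_nat_def card_1_singletonE)
  then have "z \<noteq> 0" using B(2) real_vector.dependent_zero by blast
  moreover have "S = span {z}" using B z assms(1) by (metis real_vector.span_minimal subset_antisym)
  ultimately show thesis using that by blast
qed

lemma (in lie_complex) isomorphic_admissible:
  "\<exists>a. admissible a \<and> lie_isomorphic br (algebra_bracket a)"
  using std_exists
  apply (elim disjE exE conjE)
  subgoal by (rule std1_isomorphic[OF _ _ _ dim8]) (assumption | erule disjI1)+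
  subgoal by (rule std1_isomorphic[OF _ _ _ dim8]) (assumption | erule disjI2)+
  subgoal by (rule std2_isomorphic[OF _ _ dim8]) (assumption | simp)+
  subgoal by (rule std2_isomorphic[OF _ _ dim8]) (assumption | simp)+
  done

theorem theorem1p1:
  fixes br :: "'a::real_vector \<Rightarrow> 'a \<Rightarrow> 'a"
  assumes "lie_algebra br"
    and "dim (UNIV :: 'a set) = 8"
    and "lie_nilpotent br"
    and "dim (lie_center br) = 1"
  shows "((\<exists>J. complex_structure br J) \<longleftrightarrow>
            (\<exists>a. admissible a \<and> lie_isomorphic br (algebra_bracket a))) \<and>
         (\<forall>a b. admissible a \<and> admissible b \<and>
            lie_isomorphic (algebra_bracket a) (algebra_bracket b) \<longrightarrow> a = b)"
proof (intro conjI iffI)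
  assume "\<exists>J. complex_structure br J"
  then obtain J where J: "complex_structure br J" ..
  obtain f :: "'a \<Rightarrow> real^8" where f: "linear f" "bij f"
    using linear_bij_euclidean[where 'a = 'a and 'b = "real^8"] assms(2) by auto
  \<comment> \<open>The separating forms were built with an inner product, so the bracket is moved
    to \<open>real^8\<close> first.\<close>
  define br' where "br' X Y = f (br (inv f X) (inv f Y))" for X Y
  have h: "f (br X Y) = br' (f X) (f Y)" for X Y using f(2) by (simp add: br'_def bij_is_inj)
  then have iso: "lie_isomorphic br br'" using f unfolding lie_isomorphic_def by blast
  obtain J' where J': "complex_structure br' J'"
    using complex_structure_transport[OF lie_isomorphic_sym[OF iso] J] by blast
  note p = lie_isomorphic_properties[where f = f and br = br and br' = br', OF f h assms(1)]
  obtain z where z: "lie_center br = span {z}" "z \<noteq> 0"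
    using dim_1_span[OF subspace_center[OF assms(1)] assms(4)] by blast
  have z': "lie_center br' = span {f z}" using p(3) z(1) linear_span_image[OF f(1), of "{z}"] by simp
  have "f z \<noteq> 0" using z(2) f by (metis bij_is_inj injD linear_0)
  then interpret lie_complex br' J' "f z"
    using p(1) p(2)[OF assms(3)] J' z' by unfold_locales simp_all
  show "\<exists>a. admissible a \<and> lie_isomorphic br (algebra_bracket a)"
    using isomorphic_admissible iso lie_isomorphic_trans by metis
next
  assume "\<exists>a. admissible a \<and> lie_isomorphic br (algebra_bracket a)"
  then show "\<exists>J. complex_structure br J"
    using admissible_complex complex_structure_transport by metis
next
  show "\<forall>a b. admissible a \<and> admissible b \<and>
            lie_isomorphic (algebra_bracket a) (algebra_bracket b) \<longrightarrow> a = b"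
    using algebra_bracket_iso_unique by blast
qed

end
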